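(* Let $T>0$. Each of the following Brownian processes $(B_t)_{t\in[0,T]}$, started from $B_0=0$, is positively associated in $\mathcal{C}([0,T],\mathbb{R})$: (1) the Brownian bridge, i.e. Brownian motion conditioned on $B_T=x$, for any $x\in\mathbb{R}$; (2) the Brownian excursion, i.e. Brownian motion conditioned on $B_T=0$ and $B_t\geq 0$ for all $t\in[0,T]$; (3) the Brownian meander, i.e. Brownian motion conditioned on $B_t\geq 0$ for all $t\in[0,T]$; (4) the Brownian motion conditioned to remain in a (time-dependent) interval, i.e. conditioned on $B_t\in[a(t),b(t)]$ for all $t\in[0,T]$, where $a,b\in\mathcal{D}([0,T],[-\infty,+\infty])$ satisfy $\mathbf{P}_\omega(\forall\, t\in[0,T],\ \omega_t\in[a(t),b(t)])>0$, with $\mathbf{P}_\omega$ the canonical Wiener measure on $\mathcal{C}([0,T],\mathbb{R})$.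
   Context: $\mathcal{C}([0,T],\mathbb{R})$ is the space of continuous functions from $[0,T]$ to $\mathbb{R}$, with the $\sigma$-algebra induced by the uniform convergence topology and the partial order $u\preceq v$ iff $u(t)\leq v(t)$ for all $t\in[0,T]$. $\mathcal{D}([0,T],[-\infty,+\infty])$ is the set of right-continuous functions with left-hand limits from $[0,T]$ to $[-\infty,+\infty]$. The conditionings on null events in (1)–(3) are understood in the usual sense: the Brownian bridge to $x$ has the law of $W_t-\frac{t}{T}(W_T-x)$ for $W$ a standard Brownian motion; the Brownian excursion (resp. meander) of length $T$ is the weak limit as $\varepsilon\to0^+$ of the Brownian bridge from $0$ to $0$ (resp. Brownian motion started from $0$) on $[0,T]$ conditioned to stay above $-\varepsilon$. A function $f:E\to\mathbb{R}$ on a partially ordered measurable space $E$ is increasing if $u\preceq v$ implies $f(u)\leq f(v)$. A random variable $X$ on $E$ with law $\mathbf{P}$ is positively associated if for all increasing functions $f,g\in L^2(\mathbf{P})$, $\mathbf{E}[f(X)g(X)]\geq\mathbf{E}[f(X)]\,\mathbf{E}[g(X)]$. *)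

theory Defs
  imports "HOL-Probability.Probability"
begin

section \<open>Positive association\<close>

text \<open>A partially ordered measurable space is given by a measure space \<open>E\<close>, of which only the
  carrier and the sigma-algebra matter, and an order relation \<open>le\<close> on its carrier.\<close>

definition increasing_on_space ::
    "'e measure \<Rightarrow> ('e \<Rightarrow> 'e \<Rightarrow> bool) \<Rightarrow> ('e \<Rightarrow> real) \<Rightarrow> bool" where
  "increasing_on_space E le f \<longleftrightarrow> (\<forall>u\<in>space E. \<forall>v\<in>space E. le u v \<longrightarrow> f u \<le> f v)"

definition square_integrable :: "'e measure \<Rightarrow> ('e \<Rightarrow> real) \<Rightarrow> bool" where
  "square_integrable P f \<longleftrightarrow> f \<in> borel_measurable P \<and> integrable P (\<lambda>u. (f u)\<^sup>2)"

definition positively_associated ::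
    "'a measure \<Rightarrow> 'e measure \<Rightarrow> ('e \<Rightarrow> 'e \<Rightarrow> bool) \<Rightarrow> ('a \<Rightarrow> 'e) \<Rightarrow> bool" where
  "positively_associated M E le X \<longleftrightarrow>
     (\<forall>f g. increasing_on_space E le f \<longrightarrow> increasing_on_space E le g \<longrightarrow>
        square_integrable (distr M E X) f \<longrightarrow> square_integrable (distr M E X) g \<longrightarrow>
        (\<integral>\<omega>. f (X \<omega>) * g (X \<omega>) \<partial>M) \<ge> (\<integral>\<omega>. f (X \<omega>) \<partial>M) * (\<integral>\<omega>. g (X \<omega>) \<partial>M))"

section \<open>Measures on a metric space\<close>

definition borel_of_metric :: "'e metric \<Rightarrow> 'e measure" where
  "borel_of_metric X = sigma (mspace X) {U. openin (mtopology_of X) U}"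

lemma space_borel_of_metric [simp]: "space (borel_of_metric X) = mspace X"
  by (simp add: borel_of_metric_def space_measure_of_conv)

lemma sets_borel_of_metric:
  "sets (borel_of_metric X) = sigma_sets (mspace X) {U. openin (mtopology_of X) U}"
proof -
  have "{U. openin (mtopology_of X) U} \<subseteq> Pow (mspace X)"
    using openin_subset[of "mtopology_of X"] by auto
  then show ?thesis
    by (simp add: borel_of_metric_def)
qed

definition weak_limit_of_measures ::
    "'e metric \<Rightarrow> ('i \<Rightarrow> 'e measure) \<Rightarrow> 'e measure \<Rightarrow> 'i filter \<Rightarrow> bool" where
  "weak_limit_of_measures X \<mu> Q F \<longleftrightarrow>
     (\<forall>f. continuous_map (mtopology_of X) euclideanreal f \<longrightarrow> bounded (f ` mspace X) \<longrightarrow>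
        ((\<lambda>i. \<integral>u. f u \<partial>(\<mu> i)) \<longlongrightarrow> (\<integral>u. f u \<partial>Q)) F)"

section \<open>The path space\<close>

text \<open>Paths are functions on all of \<open>real\<close> that are \<open>undefined\<close> outside \<open>{0..T}\<close>
  (see \<open>mspace_path_metric\<close> below); the distance is the uniform one.\<close>

definition path_metric :: "real \<Rightarrow> (real \<Rightarrow> real) metric" where
  "path_metric T = cfunspace (top_of_set {0..T}) euclidean_metric"

lemma mspace_path_metric:
  "mspace (path_metric T) = {w \<in> extensional {0..T}. continuous_on {0..T} w}"
  unfolding path_metric_def
  by (subst compactin_mspace_cfunspace) (auto simp: compactin_subtopology)

definition path_space :: "real \<Rightarrow> (real \<Rightarrow> real) measure" where
  "path_space T = borel_of_metric (path_metric T)"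

definition path_le :: "real \<Rightarrow> (real \<Rightarrow> real) \<Rightarrow> (real \<Rightarrow> real) \<Rightarrow> bool" where
  "path_le T u v \<longleftrightarrow> (\<forall>t\<in>{0..T}. u t \<le> v t)"

lemma space_path_space: "space (path_space T) = {w \<in> extensional {0..T}. continuous_on {0..T} w}"
  by (simp add: path_space_def mspace_path_metric)

section \<open>Wiener measure and the conditioned processes\<close>

text \<open>For \<open>T > 0\<close> the property below determines \<open>W\<close> uniquely: it is the law of standard Brownian
  motion on \<open>{0..T}\<close> started from \<open>0\<close>.\<close>

definition wiener_measure :: "real \<Rightarrow> (real \<Rightarrow> real) measure \<Rightarrow> bool" where
  "wiener_measure T W \<longleftrightarrow>
     prob_space W \<and> sets W = sets (path_space T) \<and>
     (AE w in W. w 0 = 0) \<and>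
     (\<forall>s t. 0 \<le> s \<longrightarrow> s < t \<longrightarrow> t \<le> T \<longrightarrow>
        distributed W lborel (\<lambda>w. w t - w s) (normal_density 0 (sqrt (t - s)))) \<and>
     (\<forall>(n::nat) \<tau>. 0 \<le> \<tau> 0 \<longrightarrow> (\<forall>i<n. \<tau> i < \<tau> (Suc i)) \<longrightarrow> \<tau> n \<le> T \<longrightarrow>
        prob_space.indep_vars W (\<lambda>_. borel) (\<lambda>i w. w (\<tau> (Suc i)) - w (\<tau> i)) {..<n})"

definition bridge_path :: "real \<Rightarrow> real \<Rightarrow> (real \<Rightarrow> real) \<Rightarrow> real \<Rightarrow> real" where
  "bridge_path T x w = (\<lambda>t\<in>{0..T}. w t - t / T * (w T - x))"

definition brownian_bridge_law ::
    "real \<Rightarrow> (real \<Rightarrow> real) measure \<Rightarrow> real \<Rightarrow> (real \<Rightarrow> real) measure" where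
  "brownian_bridge_law T W x = distr W (path_space T) (bridge_path T x)"

text \<open>For the processes below, replacing \<open>c \<le> w t\<close> by \<open>c < w t\<close> with \<open>c < 0\<close> changes the event by
  a null set only.\<close>

definition stays_above :: "real \<Rightarrow> real \<Rightarrow> (real \<Rightarrow> real) set" where
  "stays_above T c = {w \<in> space (path_space T). \<forall>t\<in>{0..T}. c \<le> w t}"

definition brownian_excursion_law ::
    "real \<Rightarrow> (real \<Rightarrow> real) measure \<Rightarrow> (real \<Rightarrow> real) measure \<Rightarrow> bool" where
  "brownian_excursion_law T W Q \<longleftrightarrow>
     weak_limit_of_measures (path_metric T)
       (\<lambda>\<epsilon>. uniform_measure (brownian_bridge_law T W 0) (stays_above T (- \<epsilon>))) Q (at_right 0)"

definition brownian_meander_law ::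
    "real \<Rightarrow> (real \<Rightarrow> real) measure \<Rightarrow> (real \<Rightarrow> real) measure \<Rightarrow> bool" where
  "brownian_meander_law T W Q \<longleftrightarrow>
     weak_limit_of_measures (path_metric T)
       (\<lambda>\<epsilon>. uniform_measure W (stays_above T (- \<epsilon>))) Q (at_right 0)"

definition cadlag_on :: "real \<Rightarrow> (real \<Rightarrow> ereal) \<Rightarrow> bool" where
  "cadlag_on T a \<longleftrightarrow>
     (\<forall>t\<in>{0..<T}. (a \<longlongrightarrow> a t) (at_right t)) \<and>
     (\<forall>t\<in>{0<..T}. \<exists>l. (a \<longlongrightarrow> l) (at_left t))"

definition stays_between :: "real \<Rightarrow> (real \<Rightarrow> ereal) \<Rightarrow> (real \<Rightarrow> ereal) \<Rightarrow> (real \<Rightarrow> real) set" where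
  "stays_between T a b =
     {w \<in> space (path_space T). \<forall>t\<in>{0..T}. a t \<le> ereal (w t) \<and> ereal (w t) \<le> b t}"

section \<open>Measurability\<close>

lemma dist_le_mdist_path_metric:
  assumes "u \<in> space (path_space T)" "v \<in> space (path_space T)" "t \<in> {0..T}"
  shows "dist (u t) (v t) \<le> mdist (path_metric T) u v"
  using assms mdist_cfunspace_imp_mdist_le[of u "top_of_set {0..T}" euclidean_metric v _ t]
  by (auto simp: path_space_def path_metric_def)

lemma continuous_map_path_eval:
  assumes "t \<in> {0..T}"
  shows "continuous_map (mtopology_of (path_metric T)) euclideanreal (\<lambda>w. w t)"
proof -
  have "Lipschitz_continuous_map (path_metric T) euclidean_metric (\<lambda>w. w t)"
    using dist_le_mdist_path_metric[OF _ _ assms]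
    by (auto simp: Lipschitz_continuous_map_def path_space_def intro!: exI[of _ 1])
  from Lipschitz_continuous_imp_continuous_map[OF this] show ?thesis by simp
qed

lemma sets_path_space_openin:
  assumes "openin (mtopology_of (path_metric T)) U"
  shows "U \<in> sets (path_space T)"
  using assms by (auto simp: path_space_def sets_borel_of_metric)

lemma sets_path_space_closedin:
  assumes "closedin (mtopology_of (path_metric T)) C"
  shows "C \<in> sets (path_space T)"
proof -
  have C: "C \<subseteq> space (path_space T)"
    using closedin_subset[OF assms] by (simp add: path_space_def)
  have "space (path_space T) - C \<in> sets (path_space T)"
    using assms by (intro sets_path_space_openin) (simp add: closedin_def path_space_def)
  then have "space (path_space T) - (space (path_space T) - C) \<in> sets (path_space T)"
    by blast
  then show ?thesis using C by (simp add: double_diff)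
qed

lemma measurable_path_eval:
  assumes "t \<in> {0..T}"
  shows "(\<lambda>w. w t) \<in> borel_measurable (path_space T)"
proof (rule borel_measurableI)
  fix S :: "real set" assume "open S"
  then have "openin (mtopology_of (path_metric T)) {w \<in> mspace (path_metric T). w t \<in> S}"
    using continuous_map_path_eval[OF assms] by (auto simp: continuous_map_def)
  moreover have "(\<lambda>w. w t) -` S \<inter> space (path_space T) = {w \<in> mspace (path_metric T). w t \<in> S}"
    by (auto simp: path_space_def)
  ultimately show "(\<lambda>w. w t) -` S \<inter> space (path_space T) \<in> sets (path_space T)"
    by (simp add: sets_path_space_openin)
qed

lemma measurable_bridge_path:
  assumes T: "T > 0"
  shows "bridge_path T x \<in> path_space T \<rightarrow>\<^sub>M path_space T"
proof -
  interpret P: Metric_space "mspace (path_metric T)" "mdist (path_metric T)"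
    by (rule Metric_space_mspace_mdist)
  have mem: "bridge_path T x w \<in> mspace (path_metric T)" if "w \<in> mspace (path_metric T)" for w
  proof -
    have "continuous_on {0..T} (\<lambda>t. w t - t / T * (w T - x))"
      using that T by (intro continuous_intros) (auto simp: mspace_path_metric)
    then have "continuous_on {0..T} (bridge_path T x w)"
      by (rule continuous_on_eq) (simp add: bridge_path_def)
    then show ?thesis
      by (simp add: mspace_path_metric bridge_path_def)
  qed
  have lip: "mdist (path_metric T) (bridge_path T x u) (bridge_path T x v)
               \<le> 2 * mdist (path_metric T) u v"
    if "u \<in> mspace (path_metric T)" "v \<in> mspace (path_metric T)" for u v
    unfolding path_metric_def
  proof (rule mdist_cfunspace_le)
    show "0 \<le> 2 * mdist (cfunspace (top_of_set {0..T}) euclidean_metric) u v"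
      using P.nonneg[of u v] by (simp add: path_metric_def)
    fix t assume "t \<in> topspace (top_of_set {0..T})"
    then have t: "t \<in> {0..T}" by simp
    have d: "dist (u s) (v s) \<le> mdist (path_metric T) u v" if "s \<in> {0..T}" for s
      using \<open>u \<in> _\<close> \<open>v \<in> _\<close> that by (intro dist_le_mdist_path_metric) (auto simp: path_space_def)
    have "dist (bridge_path T x u t) (bridge_path T x v t)
            = \<bar>(u t - v t) - t / T * (u T - v T)\<bar>"
      using t by (simp add: bridge_path_def dist_real_def algebra_simps)
    also have "\<dots> \<le> \<bar>u t - v t\<bar> + \<bar>t / T\<bar> * \<bar>u T - v T\<bar>"
      using abs_triangle_ineq4[of "u t - v t" "t / T * (u T - v T)"] by (simp only: abs_mult)
    also have "\<dots> \<le> \<bar>u t - v t\<bar> + 1 * \<bar>u T - v T\<bar>"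
      using t T by (intro add_left_mono mult_right_mono) auto
    also have "\<dots> \<le> 2 * mdist (path_metric T) u v"
      using d[OF t] d[of T] T by (simp add: dist_real_def)
    finally show "mdist euclidean_metric (bridge_path T x u t) (bridge_path T x v t)
        \<le> 2 * mdist (cfunspace (top_of_set {0..T}) euclidean_metric) u v"
      by (simp add: path_metric_def)
  qed
  have cont: "continuous_map (mtopology_of (path_metric T)) (mtopology_of (path_metric T)) (bridge_path T x)"
    using mem lip
    by (intro Lipschitz_continuous_imp_continuous_map)
       (auto simp: Lipschitz_continuous_map_def intro!: exI[of _ 2])
  show ?thesis
    unfolding path_space_def
  proof (rule measurableI)
    fix w assume "w \<in> space (borel_of_metric (path_metric T))"
    then show "bridge_path T x w \<in> space (borel_of_metric (path_metric T))" using mem by simp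
  next
    fix A assume "A \<in> sets (borel_of_metric (path_metric T))"
    then have "A \<in> sigma_sets (mspace (path_metric T)) {U. openin (mtopology_of (path_metric T)) U}"
      by (simp add: sets_borel_of_metric)
    moreover have "bridge_path T x \<in> borel_of_metric (path_metric T) \<rightarrow>\<^sub>M
        sigma (mspace (path_metric T)) {U. openin (mtopology_of (path_metric T)) U}"
    proof (rule measurable_measure_of)
      show "{U. openin (mtopology_of (path_metric T)) U} \<subseteq> Pow (mspace (path_metric T))"
        using openin_subset[of "mtopology_of (path_metric T)"] by auto
      show "bridge_path T x \<in> space (borel_of_metric (path_metric T)) \<rightarrow> mspace (path_metric T)"
        using mem by auto
      fix U assume "U \<in> {U. openin (mtopology_of (path_metric T)) U}"
      then have "openin (mtopology_of (path_metric T)) {w \<in> mspace (path_metric T). bridge_path T x w \<in> U}"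
        using cont by (auto simp: continuous_map_def)
      moreover have "bridge_path T x -` U \<inter> space (borel_of_metric (path_metric T))
          = {w \<in> mspace (path_metric T). bridge_path T x w \<in> U}" by auto
      ultimately show "bridge_path T x -` U \<inter> space (borel_of_metric (path_metric T))
          \<in> sets (borel_of_metric (path_metric T))"
        by (auto simp: sets_borel_of_metric)
    qed
    ultimately show "bridge_path T x -` A \<inter> space (borel_of_metric (path_metric T))
        \<in> sets (borel_of_metric (path_metric T))"
      by (metis \<open>A \<in> sets _\<close> borel_of_metric_def measurable_sets)
  qed
qed

lemma sets_path_space_pointwise_closed:
  assumes "\<And>t. t \<in> {0..T} \<Longrightarrow> closed (C t)"
  shows "{w \<in> space (path_space T). \<forall>t\<in>{0..T}. w t \<in> C t} \<in> sets (path_space T)"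
proof (cases "{0..T} = {}")
  case True
  then show ?thesis by simp
next
  case False
  have "closedin (mtopology_of (path_metric T))
          {w \<in> topspace (mtopology_of (path_metric T)). w t \<in> C t}" if "t \<in> {0..T}" for t
    using closedin_continuous_map_preimage[OF continuous_map_path_eval[OF that], of "C t"] assms[OF that]
    by (simp only: closed_closedin)
  then have "closedin (mtopology_of (path_metric T))
          (\<Inter>t\<in>{0..T}. {w \<in> topspace (mtopology_of (path_metric T)). w t \<in> C t})"
    by (rule closedin_INT[OF False])
  then have "(\<Inter>t\<in>{0..T}. {w \<in> topspace (mtopology_of (path_metric T)). w t \<in> C t})
      \<in> sets (path_space T)"
    by (rule sets_path_space_closedin)
  also have "(\<Inter>t\<in>{0..T}. {w \<in> topspace (mtopology_of (path_metric T)). w t \<in> C t})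
      = {w \<in> space (path_space T). \<forall>t\<in>{0..T}. w t \<in> C t}"
    unfolding topspace_mtopology_of path_space_def space_borel_of_metric using False by blast
  finally show ?thesis .
qed

lemma measurable_stays_above: "stays_above T c \<in> sets (path_space T)"
  using sets_path_space_pointwise_closed[of T "\<lambda>_. {c..}"] by (simp add: stays_above_def)

lemma measurable_stays_between: "stays_between T a b \<in> sets (path_space T)"
proof -
  have "closed (ereal -` {a t..b t})" for t
    by (rule closed_vimage[OF closed_atLeastAtMost continuous_on_ereal[OF continuous_on_id]])
  from sets_path_space_pointwise_closed[of T "\<lambda>t. ereal -` {a t..b t}", OF this]
  show ?thesis by (simp add: stays_between_def)
qed

end

theory Submission
  imports Defs
begin

text \<open>Brownian motion is a limit of Gaussian random walks, and the law of such a walk satisfies the four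
  functions inequality of Ahlswede, Daykin and Preston on the lattice of sequences, where sup and inf
  are taken coordinatewise. The increments are added one at a time: the transition density
  \<open>p (z - x)\<close> is log-concave, hence
  \<open>p (z - x) * p (z' - x') \<le> p (max z z' - max x x') * p (min z z' - min x x')\<close>, so the
  one-dimensional inequality \<open>four_functions_line\<close> can be integrated coordinate by coordinate
  (\<open>four_functions_gaussian_step\<close>). This covers Brownian motion on a grid
  (\<open>wiener_four_functions\<close>). The bridge is covered as well (\<open>bridge_four_functions\<close>): by time
  inversion, \<open>w t / t - w T / T\<close>, read backwards from time \<open>T\<close>, is again a walk with independent
  Gaussian increments, and the bridge is obtained from it by increasing affine maps of the coordinates.

  Conditioning on a box of grid values is harmless, because a box is closed under sup and inf: if \<open>I\<close>
  is its indicator and \<open>F\<close>, \<open>G\<close> are nonnegative and increasing, the functions \<open>F * I\<close>, \<open>G * I\<close>,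
  \<open>F * G * I\<close>, \<open>I\<close> satisfy the hypothesis of the four functions inequality. As the grid is
  refined, right-continuity of \<open>a\<close> and \<open>b\<close> makes the boxes detect every path that leaves
  \<open>[a, b]\<close>, and Bernstein polynomials rebuild the path from its grid values, monotonically and
  uniformly. In the limit, Brownian motion and the bridge, conditioned to stay between \<open>a\<close> and
  \<open>b\<close>, satisfy the correlation inequality for bounded Lipschitz increasing functions
  (\<open>stays_between_increasing_correlated\<close>). For such functions the inequality passes to weak limits,
  which gives the excursion and the meander.

  It remains to go from Lipschitz to arbitrary measurable increasing functions
  (\<open>increasing_square_integrable_correlated\<close>). A probability measure on the path space is inner
  regular, and the set of paths above some element of a compact set is closed; hence a
  measurable upper set is approximated from inside by closed upper sets
  (\<open>upper_set_inner_approximation\<close>). The distance to an upper set \<open>C\<close> is decreasing in the path,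
  because the difference \<open>v - u \<ge> 0\<close> of two paths can be added to any element of \<open>C\<close>; so
  the indicator of \<open>C\<close> is a limit of increasing Lipschitz functions. Thus upper sets are positively
  correlated, the layer cake formula extends this to nonnegative increasing functions, and truncation
  to square integrable ones.\<close>

section \<open>The four functions inequality for Gaussian walks\<close>

text \<open>For finite numbers, \<open>(c - a) * (c - b) \<ge> 0\<close> gives \<open>c * (a + b) \<le> c * c + a * b \<le> c * (c + d)\<close>.
  This is the core of the four functions inequality on a two-element chain.\<close>

lemma ennreal_add_le_add_if_mult_le:
  fixes a b c d :: ennreal
  assumes "a \<le> c" "b \<le> c" "a * b \<le> c * d"
  shows "a + b \<le> c + d"
proof (cases "c = top \<or> d = top")
  case True
  then show ?thesis by auto
next
  case False
  then obtain c' d' where c: "c = ennreal c'" "c' \<ge> 0" and d: "d = ennreal d'" "d' \<ge> 0"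
    by (metis ennreal_cases)
  obtain a' b' where a: "a = ennreal a'" "a' \<ge> 0" and b: "b = ennreal b'" "b' \<ge> 0"
    using assms(1,2) False by (metis ennreal_cases neq_top_trans)
  have le: "a' \<le> c'" "b' \<le> c'" "a' * b' \<le> c' * d'"
    using assms a b c d by (auto simp flip: ennreal_mult)
  have "a' + b' \<le> c' + d'"
  proof (cases "c' = 0")
    case True
    then show ?thesis using le d by simp
  next
    case False
    then have "c' > 0" using c by simp
    have "0 \<le> (c' - a') * (c' - b')" using le by simp
    then have "c' * (a' + b') \<le> c' * (c' + d')"
      using le(3) by (simp add: algebra_simps)
    then show ?thesis using \<open>c' > 0\<close> by simp
  qed
  then show ?thesis using a b c d by (simp flip: ennreal_plus)
qed

text \<open>Both sides are double integrals. Symmetrising the integrands in \<open>x\<close> and \<open>y\<close> reduces the claim to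
  a pointwise inequality on the sublattice generated by the two points, which
  \<open>ennreal_add_le_add_if_mult_le\<close> provides.\<close>

lemma four_functions_line:
  fixes f1 f2 f3 f4 :: "real \<Rightarrow> ennreal"
  assumes meas [measurable]: "f1 \<in> borel_measurable M" "f2 \<in> borel_measurable M"
      "f3 \<in> borel_measurable M" "f4 \<in> borel_measurable M"
    and le: "\<And>x y. f1 x * f2 y \<le> f3 (max x y) * f4 (min x y)"
  shows "(\<integral>\<^sup>+x. f1 x \<partial>M) * (\<integral>\<^sup>+x. f2 x \<partial>M) \<le> (\<integral>\<^sup>+x. f3 x \<partial>M) * (\<integral>\<^sup>+x. f4 x \<partial>M)"
proof -
  have sym: "(\<integral>\<^sup>+x. \<integral>\<^sup>+y. f x * g y + f y * g x \<partial>M \<partial>M) = 2 * ((\<integral>\<^sup>+x. f x \<partial>M) * (\<integral>\<^sup>+x. g x \<partial>M))"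
    if [measurable]: "f \<in> borel_measurable M" "g \<in> borel_measurable M" for f g :: "real \<Rightarrow> ennreal"
    by (simp add: nn_integral_add nn_integral_cmult nn_integral_multc mult.commute flip: mult_2)
  have pt: "f1 x * f2 y + f1 y * f2 x \<le> f3 x * f4 y + f3 y * f4 x" for x y
  proof -
    have main: "f1 x * f2 y + f1 y * f2 x \<le> f3 y * f4 x + f3 x * f4 y" if "x \<le> y" for x y
    proof (rule ennreal_add_le_add_if_mult_le)
      show "f1 x * f2 y \<le> f3 y * f4 x" "f1 y * f2 x \<le> f3 y * f4 x"
        using le[of x y] le[of y x] that by (auto simp: max_def min_def split: if_splits)
      have "(f1 x * f2 x) * (f1 y * f2 y) \<le> (f3 x * f4 x) * (f3 y * f4 y)"
        using mult_mono[OF le[of x x] le[of y y]] by simp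
      then show "f1 x * f2 y * (f1 y * f2 x) \<le> f3 y * f4 x * (f3 x * f4 y)"
        by (simp add: mult_ac)
    qed
    show ?thesis
      using main[of x y] main[of y x] by (cases "x \<le> y") (auto simp: add.commute)
  qed
  have "2 * ((\<integral>\<^sup>+x. f1 x \<partial>M) * (\<integral>\<^sup>+x. f2 x \<partial>M)) \<le> 2 * ((\<integral>\<^sup>+x. f3 x \<partial>M) * (\<integral>\<^sup>+x. f4 x \<partial>M))"
    unfolding sym[OF meas(1,2), symmetric] sym[OF meas(3,4), symmetric]
    by (intro nn_integral_mono) (rule pt)
  then show ?thesis
    by (subst (asm) ennreal_mult_le_mult_iff) auto
qed

text \<open>When \<open>z - z'\<close> and \<open>x - x'\<close> have the same sign the right-hand side only permutes the factors;
  otherwise max and min pair the points in the order that makes the sum of the squared increments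
  smallest.\<close>

lemma normal_density_mult_le_max_min:
  fixes x x' z z' \<sigma> :: real
  shows "normal_density 0 \<sigma> (z - x) * normal_density 0 \<sigma> (z' - x')
    \<le> normal_density 0 \<sigma> (max z z' - max x x') * normal_density 0 \<sigma> (min z z' - min x x')"
proof -
  have prod: "normal_density 0 \<sigma> p * normal_density 0 \<sigma> q
      = (1 / sqrt (2 * pi * \<sigma>\<^sup>2))\<^sup>2 * exp (- (p\<^sup>2 + q\<^sup>2) / (2 * \<sigma>\<^sup>2))" for p q
    by (simp add: normal_density_def power2_eq_square diff_divide_distrib add_divide_distrib exp_diff
        exp_minus field_simps exp_add)
  have "(max z z' - max x x')\<^sup>2 + (min z z' - min x x')\<^sup>2 \<le> (z - x)\<^sup>2 + (z' - x')\<^sup>2"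
  proof -
    have *: "(z - x')\<^sup>2 + (z' - x)\<^sup>2 \<le> (z - x)\<^sup>2 + (z' - x')\<^sup>2"
      if "(z - z') * (x - x') \<le> 0"
      using that by (simp add: power2_eq_square algebra_simps)
    show ?thesis
    proof (cases "(z - z') * (x - x') \<le> 0")
      case True
      with * show ?thesis
        by (cases "z \<le> z'"; cases "x \<le> x'")
           (auto simp: max_def min_def mult_le_0_iff power2_commute)
    next
      case False
      then show ?thesis
        by (cases "z \<le> z'"; cases "x \<le> x'")
           (auto simp: max_def min_def mult_le_0_iff not_le)
    qed
  qed
  then show ?thesis
    unfolding prod by (intro mult_left_mono) (auto intro!: divide_right_mono)
qed

text \<open>The law of the random sequence \<open>Z\<close> satisfies the conclusion of the four functions theorem of
  Ahlswede and Daykin. With \<open>f1 = F * I\<close>, \<open>f2 = G * I\<close>, \<open>f3 = F * G * I\<close>, \<open>f4 = I\<close> it contains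
  the FKG inequality, but unlike that inequality it is preserved when coordinates are integrated out
  one after the other.\<close>

definition four_functions :: "'a measure \<Rightarrow> ('a \<Rightarrow> nat \<Rightarrow> real) \<Rightarrow> bool" where
  "four_functions M Z \<longleftrightarrow>
    (\<forall>f1 f2 f3 f4 :: (nat \<Rightarrow> real) \<Rightarrow> ennreal.
       f1 \<in> borel_measurable borel \<longrightarrow> f2 \<in> borel_measurable borel \<longrightarrow>
       f3 \<in> borel_measurable borel \<longrightarrow> f4 \<in> borel_measurable borel \<longrightarrow>
       (\<forall>x y. f1 x * f2 y \<le> f3 (sup x y) * f4 (inf x y)) \<longrightarrow>
       (\<integral>\<^sup>+\<omega>. f1 (Z \<omega>) \<partial>M) * (\<integral>\<^sup>+\<omega>. f2 (Z \<omega>) \<partial>M)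
         \<le> (\<integral>\<^sup>+\<omega>. f3 (Z \<omega>) \<partial>M) * (\<integral>\<^sup>+\<omega>. f4 (Z \<omega>) \<partial>M))"

lemma four_functionsD:
  assumes "four_functions M Z"
    and "f1 \<in> borel_measurable borel" "f2 \<in> borel_measurable borel"
      "f3 \<in> borel_measurable borel" "f4 \<in> borel_measurable borel"
    and "\<And>x y. f1 x * f2 y \<le> f3 (sup x y) * f4 (inf x y)"
  shows "(\<integral>\<^sup>+\<omega>. f1 (Z \<omega>) \<partial>M) * (\<integral>\<^sup>+\<omega>. f2 (Z \<omega>) \<partial>M)
         \<le> (\<integral>\<^sup>+\<omega>. f3 (Z \<omega>) \<partial>M) * (\<integral>\<^sup>+\<omega>. f4 (Z \<omega>) \<partial>M)"
  using assms unfolding four_functions_def by blast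

lemma four_functions_cong_AE:
  assumes "four_functions M Z" "AE \<omega> in M. Z' \<omega> = Z \<omega>"
  shows "four_functions M Z'"
proof -
  have eq: "(\<integral>\<^sup>+\<omega>. f (Z' \<omega>) \<partial>M) = (\<integral>\<^sup>+\<omega>. f (Z \<omega>) \<partial>M)" for f :: "(nat \<Rightarrow> real) \<Rightarrow> ennreal"
    using assms(2) by (intro nn_integral_cong_AE) auto
  show ?thesis
    using assms(1) unfolding four_functions_def eq .
qed

text \<open>A lattice homomorphism turns the hypothesis on \<open>f1, \<dots>, f4\<close> into the same hypothesis on their
  compositions with it.\<close>

lemma four_functions_map:
  assumes "four_functions M Z" and [measurable]: "h \<in> borel_measurable borel"
    and "\<And>x y. h (sup x y) = sup (h x) (h y)" "\<And>x y. h (inf x y) = inf (h x) (h y)"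
  shows "four_functions M (\<lambda>\<omega>. h (Z \<omega>))"
  unfolding four_functions_def
proof (intro allI impI)
  fix f1 f2 f3 f4 :: "(nat \<Rightarrow> real) \<Rightarrow> ennreal"
  assume [measurable]: "f1 \<in> borel_measurable borel" "f2 \<in> borel_measurable borel"
    "f3 \<in> borel_measurable borel" "f4 \<in> borel_measurable borel"
    and le: "\<forall>x y. f1 x * f2 y \<le> f3 (sup x y) * f4 (inf x y)"
  show "(\<integral>\<^sup>+\<omega>. f1 (h (Z \<omega>)) \<partial>M) * (\<integral>\<^sup>+\<omega>. f2 (h (Z \<omega>)) \<partial>M)
      \<le> (\<integral>\<^sup>+\<omega>. f3 (h (Z \<omega>)) \<partial>M) * (\<integral>\<^sup>+\<omega>. f4 (h (Z \<omega>)) \<partial>M)"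
    by (rule four_functionsD[OF assms(1)]) (use le in \<open>auto simp only: assms(3,4)\<close>, measurable)
qed

lemma four_functions_const:
  assumes "prob_space M"
  shows "four_functions M (\<lambda>_. c)"
proof -
  interpret prob_space M by fact
  show ?thesis
    unfolding four_functions_def
    by (auto simp: emeasure_space_1) (metis inf.idem sup.idem)
qed

lemma measurable_fun_upd_pair [measurable]:
  "(\<lambda>p. (fst p)(k := snd p)) \<in> borel_measurable (borel :: ((nat \<Rightarrow> real) \<times> real) measure)"
proof (rule borel_measurable_continuous_onI, rule continuous_on_coordinatewise_then_product)
  fix i
  show "continuous_on UNIV (\<lambda>p::(nat \<Rightarrow> real) \<times> real. ((fst p)(k := snd p)) i)"
    by (cases "i = k")
       (auto intro!: continuous_intros continuous_on_product_coordinates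
          continuous_on_compose2[OF continuous_on_product_coordinates continuous_on_fst])
qed

lemma measurable_seq_coordinate [measurable]:
  "(\<lambda>x::nat \<Rightarrow> real. x j) \<in> borel_measurable borel"
  by (intro borel_measurable_continuous_onI continuous_on_product_coordinates)

text \<open>Hypothesis \<open>law\<close> says that \<open>X\<close> is a centred Gaussian variable independent of \<open>Z\<close>. Integrating a
  function of the extended sequence over the new coordinate yields a function \<open>J f\<close> of \<open>Z\<close>, and
  \<open>four_functions_line\<close>, applied to the products of \<open>f1, \<dots>, f4\<close> with the transition densities,
  shows that \<open>J f1, \<dots>, J f4\<close> satisfy the hypothesis for \<open>Z\<close>.\<close>

lemma four_functions_gaussian_step:
  fixes Z :: "'a \<Rightarrow> nat \<Rightarrow> real" and X :: "'a \<Rightarrow> real"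
  assumes ff: "four_functions M Z" and jk: "j \<noteq> k"
    and law: "\<And>F. F \<in> borel_measurable (borel :: ((nat \<Rightarrow> real) \<times> real) measure) \<Longrightarrow>
      (\<integral>\<^sup>+\<omega>. F (Z \<omega>, X \<omega>) \<partial>M)
        = (\<integral>\<^sup>+\<omega>. \<integral>\<^sup>+x. F (Z \<omega>, x) * ennreal (normal_density 0 \<sigma> x) \<partial>lborel \<partial>M)"
  shows "four_functions M (\<lambda>\<omega>. (Z \<omega>)(k := Z \<omega> j + X \<omega>))"
  unfolding four_functions_def
proof (intro allI impI)
  fix f1 f2 f3 f4 :: "(nat \<Rightarrow> real) \<Rightarrow> ennreal"
  assume [measurable]: "f1 \<in> borel_measurable borel" "f2 \<in> borel_measurable borel"
    "f3 \<in> borel_measurable borel" "f4 \<in> borel_measurable borel"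
    and le: "\<forall>x y. f1 x * f2 y \<le> f3 (sup x y) * f4 (inf x y)"
  define J where "J f x = (\<integral>\<^sup>+z. f (x(k := z)) * ennreal (normal_density 0 \<sigma> (z - x j)) \<partial>lborel)"
    for f :: "(nat \<Rightarrow> real) \<Rightarrow> ennreal" and x :: "nat \<Rightarrow> real"
  have upd: "(\<lambda>z. x(k := z)) \<in> borel_measurable borel" for x :: "nat \<Rightarrow> real"
    by (rule measurable_compose[OF _ measurable_fun_upd_pair, of "\<lambda>z. (x, z)", simplified])
      (simp add: borel_prod[symmetric])
  note [measurable] = upd
  have J_measurable: "J f \<in> borel_measurable borel" if [measurable]: "f \<in> borel_measurable borel" for f
  proof -
    have [measurable]: "(\<lambda>p. f ((fst p)(k := snd p))) \<in> borel_measurable (borel \<Otimes>\<^sub>M lborel)"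
      using measurable_compose[OF measurable_fun_upd_pair that]
      by (simp add: borel_prod[symmetric] cong: measurable_cong_sets)
    show ?thesis
      unfolding J_def by measurable
  qed
  have kernel_measurable: "(\<lambda>z. f (x(k := z)) * ennreal (normal_density 0 \<sigma> (z - c))) \<in> borel_measurable lborel"
    if [measurable]: "f \<in> borel_measurable borel" for f x c
    using measurable_compose[OF upd that, of x] by simp
  have J_eq: "(\<integral>\<^sup>+\<omega>. f ((Z \<omega>)(k := Z \<omega> j + X \<omega>)) \<partial>M) = (\<integral>\<^sup>+\<omega>. J f (Z \<omega>) \<partial>M)"
    if [measurable]: "f \<in> borel_measurable borel" for f
  proof -
    have [measurable]: "(\<lambda>p::(nat \<Rightarrow> real) \<times> real. (fst p, fst p j + snd p)) \<in> borel \<rightarrow>\<^sub>M borel"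
      unfolding borel_prod[symmetric] by measurable
    have "(\<lambda>p::(nat \<Rightarrow> real) \<times> real. f ((fst p)(k := fst p j + snd p))) \<in> borel_measurable borel"
      using measurable_compose[OF _ measurable_compose[OF measurable_fun_upd_pair that],
          of "\<lambda>p. (fst p, fst p j + snd p)" borel] by simp
    from law[OF this] have "(\<integral>\<^sup>+\<omega>. f ((Z \<omega>)(k := Z \<omega> j + X \<omega>)) \<partial>M)
      = (\<integral>\<^sup>+\<omega>. \<integral>\<^sup>+x. f ((Z \<omega>)(k := Z \<omega> j + x)) * ennreal (normal_density 0 \<sigma> x) \<partial>lborel \<partial>M)"
      by simp
    also have "\<dots> = (\<integral>\<^sup>+\<omega>. J f (Z \<omega>) \<partial>M)"
    proof (rule nn_integral_cong)
      fix \<omega>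
      show "(\<integral>\<^sup>+x. f ((Z \<omega>)(k := Z \<omega> j + x)) * ennreal (normal_density 0 \<sigma> x) \<partial>lborel) = J f (Z \<omega>)"
        unfolding J_def by (subst nn_integral_real_affine[where c = 1 and t = "- Z \<omega> j"]) auto
    qed
    finally show ?thesis .
  qed
  show "(\<integral>\<^sup>+\<omega>. f1 ((Z \<omega>)(k := Z \<omega> j + X \<omega>)) \<partial>M) * (\<integral>\<^sup>+\<omega>. f2 ((Z \<omega>)(k := Z \<omega> j + X \<omega>)) \<partial>M)
     \<le> (\<integral>\<^sup>+\<omega>. f3 ((Z \<omega>)(k := Z \<omega> j + X \<omega>)) \<partial>M) * (\<integral>\<^sup>+\<omega>. f4 ((Z \<omega>)(k := Z \<omega> j + X \<omega>)) \<partial>M)"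
    unfolding J_eq[OF \<open>f1 \<in> _\<close>] J_eq[OF \<open>f2 \<in> _\<close>] J_eq[OF \<open>f3 \<in> _\<close>] J_eq[OF \<open>f4 \<in> _\<close>]
  proof (rule four_functionsD[OF ff])
    fix x y :: "nat \<Rightarrow> real"
    show "J f1 x * J f2 y \<le> J f3 (sup x y) * J f4 (inf x y)"
      unfolding J_def
    proof (rule four_functions_line)
      show "(\<lambda>z. f1 (x(k := z)) * ennreal (normal_density 0 \<sigma> (z - x j))) \<in> borel_measurable lborel"
        "(\<lambda>z. f2 (y(k := z)) * ennreal (normal_density 0 \<sigma> (z - y j))) \<in> borel_measurable lborel"
        "(\<lambda>z. f3 ((sup x y)(k := z)) * ennreal (normal_density 0 \<sigma> (z - sup x y j))) \<in> borel_measurable lborel"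
        "(\<lambda>z. f4 ((inf x y)(k := z)) * ennreal (normal_density 0 \<sigma> (z - inf x y j))) \<in> borel_measurable lborel"
        by (intro kernel_measurable; fact)+
      fix z z' :: real
      have upd_sup: "sup (x(k := z)) (y(k := z')) = (sup x y)(k := max z z')"
        and upd_inf: "inf (x(k := z)) (y(k := z')) = (inf x y)(k := min z z')"
        by (auto simp: fun_eq_iff sup_max inf_min)
      have "f1 (x(k := z)) * f2 (y(k := z')) \<le> f3 ((sup x y)(k := max z z')) * f4 ((inf x y)(k := min z z'))"
        using le unfolding upd_sup[symmetric] upd_inf[symmetric] by blast
      moreover have "ennreal (normal_density 0 \<sigma> (z - x j)) * ennreal (normal_density 0 \<sigma> (z' - y j))
        \<le> ennreal (normal_density 0 \<sigma> (max z z' - sup x y j)) * ennreal (normal_density 0 \<sigma> (min z z' - inf x y j))"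
        using normal_density_mult_le_max_min[of \<sigma> z "x j" z' "y j"]
        by (simp add: sup_max inf_min ennreal_mult[symmetric] del: normal_density_nonneg)
           (simp add: ennreal_mult[symmetric])
      ultimately have "(f1 (x(k := z)) * f2 (y(k := z')))
          * (ennreal (normal_density 0 \<sigma> (z - x j)) * ennreal (normal_density 0 \<sigma> (z' - y j)))
        \<le> (f3 ((sup x y)(k := max z z')) * f4 ((inf x y)(k := min z z')))
          * (ennreal (normal_density 0 \<sigma> (max z z' - sup x y j)) * ennreal (normal_density 0 \<sigma> (min z z' - inf x y j)))"
        by (rule mult_mono) simp_all
      then show "f1 (x(k := z)) * ennreal (normal_density 0 \<sigma> (z - x j)) * (f2 (y(k := z')) * ennreal (normal_density 0 \<sigma> (z' - y j)))
        \<le> f3 ((sup x y)(k := max z z')) * ennreal (normal_density 0 \<sigma> (max z z' - sup x y j))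
          * (f4 ((inf x y)(k := min z z')) * ennreal (normal_density 0 \<sigma> (min z z' - inf x y j)))"
        by (simp add: mult_ac)
    qed
  qed (auto intro: J_measurable)
qed

section \<open>Independent Gaussian increments of a bridge\<close>

text \<open>If \<open>a\<close> and \<open>y\<close> are independent of variances \<open>\<alpha>\<close> and \<open>\<beta>\<close>, then \<open>v = a + y\<close> and
  \<open>u = a / \<alpha> - v / (\<alpha> + \<beta>)\<close> are uncorrelated, with variances \<open>\<alpha> + \<beta>\<close> and
  \<open>\<beta> / (\<alpha> * (\<alpha> + \<beta>))\<close>. The joint density therefore factorises; the factor \<open>\<alpha>\<close> is the
  Jacobian of the substitution.\<close>

lemma normal_density_product_shear:
  fixes \<alpha> \<beta> :: real
  assumes "\<alpha> > 0" "\<beta> > 0"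
  shows "\<alpha> * (normal_density 0 (sqrt \<beta>) (v - (\<alpha> * v / (\<alpha> + \<beta>) + \<alpha> * u))
      * normal_density 0 (sqrt \<alpha>) (\<alpha> * v / (\<alpha> + \<beta>) + \<alpha> * u))
    = normal_density 0 (sqrt (\<beta> / (\<alpha> * (\<alpha> + \<beta>)))) u * normal_density 0 (sqrt (\<alpha> + \<beta>)) v"
proof -
  define \<gamma> where "\<gamma> = \<alpha> + \<beta>"
  have \<gamma>: "\<gamma> > 0" using assms by (simp add: \<gamma>_def)
  define a where "a = \<alpha> * v / \<gamma> + \<alpha> * u"
  have nd: "normal_density 0 (sqrt s) z = 1 / sqrt (2 * pi * s) * exp (- (z\<^sup>2 / (2 * s)))" if "s > 0" for s z
    using that by (simp add: normal_density_def)
  have const: "\<alpha> * (1 / sqrt (2 * pi * \<beta>) * (1 / sqrt (2 * pi * \<alpha>)))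
      = 1 / sqrt (2 * pi * (\<beta> / (\<alpha> * \<gamma>))) * (1 / sqrt (2 * pi * \<gamma>))"
    using assms \<gamma> by (simp add: real_sqrt_mult real_sqrt_divide field_simps)
  have "(v - a)\<^sup>2 / (2 * \<beta>) + a\<^sup>2 / (2 * \<alpha>) = u\<^sup>2 / (2 * (\<beta> / (\<alpha> * \<gamma>))) + v\<^sup>2 / (2 * \<gamma>)"
  proof -
    have "v - a = (\<beta> * v - \<alpha> * \<gamma> * u) / \<gamma>" "a = (\<alpha> * v + \<alpha> * \<gamma> * u) / \<gamma>"
      using \<gamma> by (simp_all add: a_def field_simps) (simp add: \<gamma>_def algebra_simps)
    moreover have "(p / \<gamma>)\<^sup>2 / (2 * \<beta>) + (q / \<gamma>)\<^sup>2 / (2 * \<alpha>) = (p\<^sup>2 * \<alpha> + q\<^sup>2 * \<beta>) / (2 * \<alpha> * \<beta> * \<gamma>\<^sup>2)" for p q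
      using assms \<gamma> by (simp add: field_simps power2_eq_square)
    ultimately have "(v - a)\<^sup>2 / (2 * \<beta>) + a\<^sup>2 / (2 * \<alpha>)
        = ((\<beta> * v - \<alpha> * \<gamma> * u)\<^sup>2 * \<alpha> + (\<alpha> * v + \<alpha> * \<gamma> * u)\<^sup>2 * \<beta>) / (2 * \<alpha> * \<beta> * \<gamma>\<^sup>2)"
      by metis
    also have "(\<beta> * v - \<alpha> * \<gamma> * u)\<^sup>2 * \<alpha> + (\<alpha> * v + \<alpha> * \<gamma> * u)\<^sup>2 * \<beta>
        = \<alpha> * \<gamma> * (\<beta> * v\<^sup>2 + \<alpha> * \<gamma>\<^sup>2 * u\<^sup>2)"
      by (simp add: \<gamma>_def power2_eq_square algebra_simps)
    also have "\<dots> / (2 * \<alpha> * \<beta> * \<gamma>\<^sup>2) = u\<^sup>2 / (2 * (\<beta> / (\<alpha> * \<gamma>))) + v\<^sup>2 / (2 * \<gamma>)"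
      using assms \<gamma> by (simp add: field_simps power2_eq_square)
    finally show ?thesis .
  qed
  then have "exp (- ((v - a)\<^sup>2 / (2 * \<beta>))) * exp (- (a\<^sup>2 / (2 * \<alpha>)))
      = exp (- (u\<^sup>2 / (2 * (\<beta> / (\<alpha> * \<gamma>))))) * exp (- (v\<^sup>2 / (2 * \<gamma>)))"
    by (simp flip: exp_add)
  then have "(\<alpha> * (1 / sqrt (2 * pi * \<beta>) * (1 / sqrt (2 * pi * \<alpha>))))
        * (exp (- ((v - a)\<^sup>2 / (2 * \<beta>))) * exp (- (a\<^sup>2 / (2 * \<alpha>))))
      = (1 / sqrt (2 * pi * (\<beta> / (\<alpha> * \<gamma>))) * (1 / sqrt (2 * pi * \<gamma>)))
        * (exp (- (u\<^sup>2 / (2 * (\<beta> / (\<alpha> * \<gamma>))))) * exp (- (v\<^sup>2 / (2 * \<gamma>))))"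
    using const by presburger
  moreover have "\<beta> / (\<alpha> * \<gamma>) > 0" using assms \<gamma> by simp
  ultimately show ?thesis
    using assms \<gamma> unfolding \<gamma>_def[symmetric] a_def[symmetric]
    by (simp only: nd) (simp only: mult_ac)
qed

text \<open>Two affine substitutions, \<open>v = a + y\<close> for fixed \<open>a\<close> and \<open>a = \<alpha> * (u + v / (\<alpha> + \<beta>))\<close> for
  fixed \<open>v\<close>, realise the linear change of variables without a determinant.\<close>

lemma nn_integral_gaussian_shear:
  fixes \<alpha> \<beta> :: real and H :: "real \<times> real \<Rightarrow> ennreal"
  assumes "\<alpha> > 0" "\<beta> > 0" and [measurable]: "H \<in> borel_measurable (borel \<Otimes>\<^sub>M borel)"
  shows "(\<integral>\<^sup>+a. (\<integral>\<^sup>+y. H (a / \<alpha> - (a + y) / (\<alpha> + \<beta>), a + y) * normal_density 0 (sqrt \<beta>) y \<partial>lborel)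
          * normal_density 0 (sqrt \<alpha>) a \<partial>lborel)
    = (\<integral>\<^sup>+v. (\<integral>\<^sup>+u. H (u, v) * normal_density 0 (sqrt (\<beta> / (\<alpha> * (\<alpha> + \<beta>)))) u \<partial>lborel)
          * normal_density 0 (sqrt (\<alpha> + \<beta>)) v \<partial>lborel)"
    (is "?L = ?R")
proof -
  define \<gamma> where "\<gamma> = \<alpha> + \<beta>"
  have \<gamma>: "\<gamma> > 0" using assms by (simp add: \<gamma>_def)
  have [measurable]: "(\<lambda>p. H (snd p / \<alpha> - fst p / \<gamma>, fst p)) \<in> borel_measurable (lborel \<Otimes>\<^sub>M lborel)"
    by (rule measurable_compose[OF _ assms(3)]) measurable
  have [measurable]: "(\<lambda>p. H (fst p / \<alpha> - snd p / \<gamma>, snd p)) \<in> borel_measurable (lborel \<Otimes>\<^sub>M lborel)"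
    by (rule measurable_compose[OF _ assms(3)]) measurable
  have "?L = (\<integral>\<^sup>+a. (\<integral>\<^sup>+v. H (a / \<alpha> - v / \<gamma>, v) * (ennreal (normal_density 0 (sqrt \<beta>) (v - a))
      * ennreal (normal_density 0 (sqrt \<alpha>) a)) \<partial>lborel) \<partial>lborel)"
  proof (rule nn_integral_cong)
    fix a :: real
    have [measurable]: "(\<lambda>v. H (a / \<alpha> - v / \<gamma>, v)) \<in> borel_measurable borel"
      by (rule measurable_compose[OF _ assms(3)]) measurable
    have [measurable]: "(\<lambda>y. H (a / \<alpha> - (a + y) / \<gamma>, a + y)) \<in> borel_measurable borel"
      by (rule measurable_compose[OF _ assms(3)]) measurable
    have "(\<integral>\<^sup>+y. H (a / \<alpha> - (a + y) / (\<alpha> + \<beta>), a + y) * normal_density 0 (sqrt \<beta>) y \<partial>lborel)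
      = (\<integral>\<^sup>+v. H (a / \<alpha> - v / \<gamma>, v) * normal_density 0 (sqrt \<beta>) (v - a) \<partial>lborel)"
      unfolding \<gamma>_def[symmetric]
      by (subst nn_integral_real_affine[where c = 1 and t = "- a"]) auto
    then show "(\<integral>\<^sup>+y. H (a / \<alpha> - (a + y) / (\<alpha> + \<beta>), a + y) * normal_density 0 (sqrt \<beta>) y \<partial>lborel)
          * normal_density 0 (sqrt \<alpha>) a
      = (\<integral>\<^sup>+v. H (a / \<alpha> - v / \<gamma>, v) * (ennreal (normal_density 0 (sqrt \<beta>) (v - a))
      * ennreal (normal_density 0 (sqrt \<alpha>) a)) \<partial>lborel)"
      by (simp add: nn_integral_multc[symmetric] mult.assoc)
  qed
  also have "\<dots> = (\<integral>\<^sup>+v. (\<integral>\<^sup>+a. H (a / \<alpha> - v / \<gamma>, v) * (ennreal (normal_density 0 (sqrt \<beta>) (v - a))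
      * ennreal (normal_density 0 (sqrt \<alpha>) a)) \<partial>lborel) \<partial>lborel)"
    by (rule lborel_pair.Fubini') (simp add: case_prod_beta)
  also have "\<dots> = ?R"
  proof (rule nn_integral_cong)
    fix v :: real
    have [measurable]: "(\<lambda>a. H (a / \<alpha> - v / \<gamma>, v)) \<in> borel_measurable borel"
      "(\<lambda>u. H (u, v)) \<in> borel_measurable borel"
      by (rule measurable_compose[OF _ assms(3)], measurable)+
    have "(\<integral>\<^sup>+a. H (a / \<alpha> - v / \<gamma>, v) * (ennreal (normal_density 0 (sqrt \<beta>) (v - a))
        * ennreal (normal_density 0 (sqrt \<alpha>) a)) \<partial>lborel)
      = \<alpha> * (\<integral>\<^sup>+u. H ((\<alpha> * v / \<gamma> + \<alpha> * u) / \<alpha> - v / \<gamma>, v) * (ennreal (normal_density 0 (sqrt \<beta>) (v - (\<alpha> * v / \<gamma> + \<alpha> * u)))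
        * ennreal (normal_density 0 (sqrt \<alpha>) (\<alpha> * v / \<gamma> + \<alpha> * u))) \<partial>lborel)"
      using \<open>\<alpha> > 0\<close> by (subst nn_integral_real_affine[where c = \<alpha> and t = "\<alpha> * v / \<gamma>"]) auto
    also have "\<dots> = (\<integral>\<^sup>+u. H ((\<alpha> * v / \<gamma> + \<alpha> * u) / \<alpha> - v / \<gamma>, v) * ennreal (\<alpha> * (normal_density 0 (sqrt \<beta>) (v - (\<alpha> * v / \<gamma> + \<alpha> * u))
        * normal_density 0 (sqrt \<alpha>) (\<alpha> * v / \<gamma> + \<alpha> * u))) \<partial>lborel)"
      using \<open>\<alpha> > 0\<close> by (simp add: nn_integral_cmult[symmetric] ennreal_mult mult_ac)
    also have "\<dots> = (\<integral>\<^sup>+u. H (u, v) * ennreal (normal_density 0 (sqrt (\<beta> / (\<alpha> * (\<alpha> + \<beta>)))) u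
        * normal_density 0 (sqrt (\<alpha> + \<beta>)) v) \<partial>lborel)"
      using \<open>\<alpha> > 0\<close> unfolding \<gamma>_def normal_density_product_shear[OF assms(1,2)]
      by (simp add: add_divide_distrib)
    also have "\<dots> = (\<integral>\<^sup>+u. H (u, v) * normal_density 0 (sqrt (\<beta> / (\<alpha> * (\<alpha> + \<beta>)))) u \<partial>lborel)
          * normal_density 0 (sqrt (\<alpha> + \<beta>)) v"
      by (simp add: nn_integral_multc[symmetric] ennreal_mult mult.assoc)
    finally show "(\<integral>\<^sup>+a. H (a / \<alpha> - v / \<gamma>, v) * (ennreal (normal_density 0 (sqrt \<beta>) (v - a))
        * ennreal (normal_density 0 (sqrt \<alpha>) a)) \<partial>lborel)
      = (\<integral>\<^sup>+u. H (u, v) * normal_density 0 (sqrt (\<beta> / (\<alpha> * (\<alpha> + \<beta>)))) u \<partial>lborel)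
          * normal_density 0 (sqrt (\<alpha> + \<beta>)) v" .
  qed
  finally show ?thesis .
qed

text \<open>Independence expressed through the joint law, so that the two value spaces may have different types.\<close>

definition indep_pair :: "'a measure \<Rightarrow> 'b measure \<Rightarrow> ('a \<Rightarrow> 'b) \<Rightarrow> 'c measure \<Rightarrow> ('a \<Rightarrow> 'c) \<Rightarrow> bool" where
  "indep_pair M S Z R X \<longleftrightarrow> Z \<in> M \<rightarrow>\<^sub>M S \<and> X \<in> M \<rightarrow>\<^sub>M R \<and>
     distr M (S \<Otimes>\<^sub>M R) (\<lambda>\<omega>. (Z \<omega>, X \<omega>)) = distr M S Z \<Otimes>\<^sub>M distr M R X"

context prob_space
begin

lemma indep_pair_compose:
  assumes ind: "indep_pair M S Z R X" and [measurable]: "g \<in> S \<rightarrow>\<^sub>M S'" "h \<in> R \<rightarrow>\<^sub>M R'"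
  shows "indep_pair M S' (\<lambda>\<omega>. g (Z \<omega>)) R' (\<lambda>\<omega>. h (X \<omega>))"
proof -
  have [measurable]: "Z \<in> M \<rightarrow>\<^sub>M S" "X \<in> M \<rightarrow>\<^sub>M R"
    and eq: "distr M (S \<Otimes>\<^sub>M R) (\<lambda>\<omega>. (Z \<omega>, X \<omega>)) = distr M S Z \<Otimes>\<^sub>M distr M R X"
    using ind by (auto simp: indep_pair_def)
  interpret Z: prob_space "distr M S Z" by (rule prob_space_distr) simp
  interpret X: prob_space "distr M R X" by (rule prob_space_distr) simp
  have dh: "prob_space (distr (distr M R X) R' h)"
    by (rule X.prob_space_distr) simp
  have "distr M (S' \<Otimes>\<^sub>M R') (\<lambda>\<omega>. (g (Z \<omega>), h (X \<omega>)))
      = distr (distr M (S \<Otimes>\<^sub>M R) (\<lambda>\<omega>. (Z \<omega>, X \<omega>))) (S' \<Otimes>\<^sub>M R') (\<lambda>(x, y). (g x, h y))"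
    by (subst distr_distr) (auto simp: comp_def)
  also have "\<dots> = distr (distr M S Z) S' g \<Otimes>\<^sub>M distr (distr M R X) R' h"
    unfolding eq using prob_space_imp_sigma_finite[OF dh] by (subst pair_measure_distr) auto
  also have "\<dots> = distr M S' (\<lambda>\<omega>. g (Z \<omega>)) \<Otimes>\<^sub>M distr M R' (\<lambda>\<omega>. h (X \<omega>))"
    by (simp add: distr_distr comp_def)
  finally show ?thesis
    by (simp add: indep_pair_def)
qed

lemma nn_integral_indep_pair:
  assumes ind: "indep_pair M S Z R X" and F [measurable]: "F \<in> borel_measurable (S \<Otimes>\<^sub>M R)"
  shows "(\<integral>\<^sup>+\<omega>. F (Z \<omega>, X \<omega>) \<partial>M) = (\<integral>\<^sup>+z. \<integral>\<^sup>+x. F (z, x) \<partial>distr M R X \<partial>distr M S Z)"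
proof -
  have [measurable]: "Z \<in> M \<rightarrow>\<^sub>M S" "X \<in> M \<rightarrow>\<^sub>M R"
    and eq: "distr M (S \<Otimes>\<^sub>M R) (\<lambda>\<omega>. (Z \<omega>, X \<omega>)) = distr M S Z \<Otimes>\<^sub>M distr M R X"
    using ind by (auto simp: indep_pair_def)
  interpret X: prob_space "distr M R X" by (rule prob_space_distr) simp
  have "(\<integral>\<^sup>+\<omega>. F (Z \<omega>, X \<omega>) \<partial>M) = (\<integral>\<^sup>+p. F p \<partial>distr M (S \<Otimes>\<^sub>M R) (\<lambda>\<omega>. (Z \<omega>, X \<omega>)))"
    by (subst nn_integral_distr) auto
  also have "\<dots> = (\<integral>\<^sup>+p. F p \<partial>(distr M S Z \<Otimes>\<^sub>M distr M R X))"
    by (simp add: eq)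
  also have "\<dots> = (\<integral>\<^sup>+z. \<integral>\<^sup>+x. F (z, x) \<partial>distr M R X \<partial>distr M S Z)"
    by (subst X.nn_integral_fst[symmetric]) (auto cong: measurable_cong_sets)
  finally show ?thesis .
qed

lemma nn_integral_indep_pair_swapped:
  assumes ind: "indep_pair M S Z R X" and F [measurable]: "F \<in> borel_measurable (S \<Otimes>\<^sub>M R)"
  shows "(\<integral>\<^sup>+\<omega>. F (Z \<omega>, X \<omega>) \<partial>M) = (\<integral>\<^sup>+x. \<integral>\<^sup>+\<omega>. F (Z \<omega>, x) \<partial>M \<partial>distr M R X)"
proof -
  have [measurable]: "Z \<in> M \<rightarrow>\<^sub>M S" "X \<in> M \<rightarrow>\<^sub>M R"
    using ind by (auto simp: indep_pair_def)
  interpret Z: prob_space "distr M S Z" by (rule prob_space_distr) simp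
  interpret X: prob_space "distr M R X" by (rule prob_space_distr) simp
  interpret pair_sigma_finite "distr M S Z" "distr M R X" ..
  have "(\<integral>\<^sup>+\<omega>. F (Z \<omega>, X \<omega>) \<partial>M) = (\<integral>\<^sup>+x. \<integral>\<^sup>+z. F (z, x) \<partial>distr M S Z \<partial>distr M R X)"
    unfolding nn_integral_indep_pair[OF assms]
    by (rule Fubini'[symmetric]) (auto simp: case_prod_beta cong: measurable_cong_sets)
  also have "\<dots> = (\<integral>\<^sup>+x. \<integral>\<^sup>+\<omega>. F (Z \<omega>, x) \<partial>M \<partial>distr M R X)"
    by (intro nn_integral_cong) (subst nn_integral_distr, auto)
  finally show ?thesis .
qed

lemma nn_integral_indep_pair_density:
  assumes ind: "indep_pair M S Z (borel :: real measure) X" and X: "distributed M lborel X p"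
    and [measurable]: "p \<in> borel_measurable borel" and F [measurable]: "F \<in> borel_measurable (S \<Otimes>\<^sub>M borel)"
  shows "(\<integral>\<^sup>+\<omega>. F (Z \<omega>, X \<omega>) \<partial>M) = (\<integral>\<^sup>+\<omega>. \<integral>\<^sup>+x. F (Z \<omega>, x) * p x \<partial>lborel \<partial>M)"
proof -
  have [measurable]: "Z \<in> M \<rightarrow>\<^sub>M S" "X \<in> borel_measurable M"
    using ind by (auto simp: indep_pair_def)
  have dX: "distr M borel X = density lborel p"
    using distributed_distr_eq_density[OF X] by (simp cong: distr_cong)
  have "(\<integral>\<^sup>+\<omega>. F (Z \<omega>, X \<omega>) \<partial>M) = (\<integral>\<^sup>+z. \<integral>\<^sup>+x. F (z, x) \<partial>density lborel p \<partial>distr M S Z)"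
    unfolding nn_integral_indep_pair[OF ind F] dX ..
  also have "\<dots> = (\<integral>\<^sup>+z. \<integral>\<^sup>+x. F (z, x) * p x \<partial>lborel \<partial>distr M S Z)"
    by (intro nn_integral_cong) (subst nn_integral_density, auto simp: mult.commute)
  also have "\<dots> = (\<integral>\<^sup>+\<omega>. \<integral>\<^sup>+x. F (Z \<omega>, x) * p x \<partial>lborel \<partial>M)"
    by (subst nn_integral_distr) auto
  finally show ?thesis .
qed

text \<open>The two combinations of \<open>A\<close> and \<open>Y\<close> are independent, by the factorisation of their joint density.
  When \<open>A = w s\<close> and \<open>A + Y = w t\<close> are values of a Brownian path with \<open>s = \<alpha>\<close> and \<open>t = \<alpha> + \<beta>\<close>,
  the first one is the increment \<open>w s / s - w t / t\<close> of the time-inverted path.\<close>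

lemma nn_integral_gaussian_bridge_increment:
  fixes A Y :: "'a \<Rightarrow> real" and H :: "real \<times> real \<Rightarrow> ennreal"
  assumes ind: "indep_pair M borel A borel Y"
    and A: "distributed M lborel A (normal_density 0 (sqrt \<alpha>))"
    and Y: "distributed M lborel Y (normal_density 0 (sqrt \<beta>))"
    and pos: "\<alpha> > 0" "\<beta> > 0" and H [measurable]: "H \<in> borel_measurable (borel \<Otimes>\<^sub>M borel)"
  shows "(\<integral>\<^sup>+\<omega>. H (A \<omega> / \<alpha> - (A \<omega> + Y \<omega>) / (\<alpha> + \<beta>), A \<omega> + Y \<omega>) \<partial>M)
    = (\<integral>\<^sup>+\<omega>. \<integral>\<^sup>+u. H (u, A \<omega> + Y \<omega>) * normal_density 0 (sqrt (\<beta> / (\<alpha> * (\<alpha> + \<beta>)))) u \<partial>lborel \<partial>M)"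
proof -
  have [measurable]: "random_variable borel A" "random_variable borel Y"
    using ind by (auto simp: indep_pair_def)
  have dA: "distr M borel A = density lborel (normal_density 0 (sqrt \<alpha>))"
    using distributed_distr_eq_density[OF A] by (simp cong: distr_cong)
  \<comment> \<open>The joint law of the two combinations; the claim compares it for \<open>H\<close> and for \<open>H\<close> averaged
    over its first argument.\<close>
  have joint: "(\<integral>\<^sup>+\<omega>. G (A \<omega> / \<alpha> - (A \<omega> + Y \<omega>) / (\<alpha> + \<beta>), A \<omega> + Y \<omega>) \<partial>M)
    = (\<integral>\<^sup>+v. (\<integral>\<^sup>+u. G (u, v) * normal_density 0 (sqrt (\<beta> / (\<alpha> * (\<alpha> + \<beta>)))) u \<partial>lborel)
          * normal_density 0 (sqrt (\<alpha> + \<beta>)) v \<partial>lborel)"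
    if G [measurable]: "G \<in> borel_measurable (borel \<Otimes>\<^sub>M borel)" for G
  proof -
    have [measurable]: "(\<lambda>p. G (fst p / \<alpha> - (fst p + snd p) / (\<alpha> + \<beta>), fst p + snd p)) \<in> borel_measurable (borel \<Otimes>\<^sub>M borel)"
      by (rule measurable_compose[OF _ G]) measurable
    have "(\<integral>\<^sup>+\<omega>. G (A \<omega> / \<alpha> - (A \<omega> + Y \<omega>) / (\<alpha> + \<beta>), A \<omega> + Y \<omega>) \<partial>M)
      = (\<integral>\<^sup>+\<omega>. \<integral>\<^sup>+y. G (A \<omega> / \<alpha> - (A \<omega> + y) / (\<alpha> + \<beta>), A \<omega> + y) * normal_density 0 (sqrt \<beta>) y \<partial>lborel \<partial>M)"
      using nn_integral_indep_pair_density[OF ind Y, of "\<lambda>p. G (fst p / \<alpha> - (fst p + snd p) / (\<alpha> + \<beta>), fst p + snd p)"]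
      by simp
    also have "\<dots> = (\<integral>\<^sup>+a. \<integral>\<^sup>+y. G (a / \<alpha> - (a + y) / (\<alpha> + \<beta>), a + y) * normal_density 0 (sqrt \<beta>) y \<partial>lborel
        \<partial>distr M borel A)"
    proof (subst nn_integral_distr)
      have [measurable]: "(\<lambda>p. G (fst p / \<alpha> - (fst p + snd p) / (\<alpha> + \<beta>), fst p + snd p)) \<in> borel_measurable (borel \<Otimes>\<^sub>M lborel)"
        by (rule measurable_compose[OF _ G]) measurable
      show "(\<lambda>a. \<integral>\<^sup>+y. G (a / \<alpha> - (a + y) / (\<alpha> + \<beta>), a + y) * normal_density 0 (sqrt \<beta>) y \<partial>lborel)
        \<in> borel_measurable (distr M borel A)"
        by simp
    qed simp_all
    also have "\<dots> = (\<integral>\<^sup>+a. (\<integral>\<^sup>+y. G (a / \<alpha> - (a + y) / (\<alpha> + \<beta>), a + y) * normal_density 0 (sqrt \<beta>) y \<partial>lborel)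
          * normal_density 0 (sqrt \<alpha>) a \<partial>lborel)"
    proof -
      have [measurable]: "(\<lambda>p. G (fst p / \<alpha> - (fst p + snd p) / (\<alpha> + \<beta>), fst p + snd p)) \<in> borel_measurable (lborel \<Otimes>\<^sub>M lborel)"
        by (rule measurable_compose[OF _ G]) measurable
      show ?thesis
        unfolding dA by (subst nn_integral_density) (auto simp: mult.commute)
    qed
    finally show ?thesis
      unfolding nn_integral_gaussian_shear[OF pos G] .
  qed
  define \<sigma> where "\<sigma> = sqrt (\<beta> / (\<alpha> * (\<alpha> + \<beta>)))"
  have "\<sigma> > 0" using pos by (simp add: \<sigma>_def)
  have one: "(\<integral>\<^sup>+u. ennreal (normal_density 0 \<sigma> u) \<partial>lborel) = 1"
    using prob_space.emeasure_space_1[OF prob_space_normal_density[OF \<open>\<sigma> > 0\<close>, of 0]]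
    by (simp add: emeasure_density)
  have [measurable]: "(\<lambda>p. H (snd p, snd (fst p))) \<in> borel_measurable ((borel \<Otimes>\<^sub>M borel) \<Otimes>\<^sub>M lborel)"
    by (rule measurable_compose[OF _ H]) measurable
  have "(\<lambda>p. \<integral>\<^sup>+u. H (u, snd p) * normal_density 0 \<sigma> u \<partial>lborel) \<in> borel_measurable (borel \<Otimes>\<^sub>M borel)"
    by simp
  from joint[OF this] have "(\<integral>\<^sup>+\<omega>. \<integral>\<^sup>+u. H (u, A \<omega> + Y \<omega>) * normal_density 0 \<sigma> u \<partial>lborel \<partial>M)
    = (\<integral>\<^sup>+v. (\<integral>\<^sup>+u'. (\<integral>\<^sup>+u. H (u, v) * normal_density 0 \<sigma> u \<partial>lborel) * normal_density 0 \<sigma> u' \<partial>lborel)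
          * normal_density 0 (sqrt (\<alpha> + \<beta>)) v \<partial>lborel)"
    by (simp add: \<sigma>_def)
  also have "\<dots> = (\<integral>\<^sup>+v. (\<integral>\<^sup>+u. H (u, v) * normal_density 0 \<sigma> u \<partial>lborel)
          * normal_density 0 (sqrt (\<alpha> + \<beta>)) v \<partial>lborel)"
    by (simp add: nn_integral_cmult one)
  finally show ?thesis
    unfolding joint[OF H] \<sigma>_def by simp
qed

end

section \<open>Brownian motion and Brownian bridge on a grid\<close>

definition grid_time :: "real \<Rightarrow> nat \<Rightarrow> nat \<Rightarrow> real" where
  "grid_time T N i = real i * T / real N"

text \<open>Sequences are extended by \<open>0\<close>, so that all grids share the index type \<open>nat\<close>.\<close>

definition grid_values :: "real \<Rightarrow> nat \<Rightarrow> (real \<Rightarrow> real) \<Rightarrow> nat \<Rightarrow> real" where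
  "grid_values T N w i = (if i \<le> N then w (grid_time T N i) else 0)"

lemma grid_time_0 [simp]: "grid_time T N 0 = 0"
  by (simp add: grid_time_def)

lemma grid_time_last: "N > 0 \<Longrightarrow> grid_time T N N = T"
  by (simp add: grid_time_def)

lemma grid_time_mem: "T > 0 \<Longrightarrow> N > 0 \<Longrightarrow> i \<le> N \<Longrightarrow> grid_time T N i \<in> {0..T}"
  by (simp add: grid_time_def field_simps)

lemma grid_time_pos: "T > 0 \<Longrightarrow> N > 0 \<Longrightarrow> i > 0 \<Longrightarrow> grid_time T N i > 0"
  by (simp add: grid_time_def)

lemma grid_time_Suc: "grid_time T N (Suc i) = grid_time T N i + T / real N"
  by (simp add: grid_time_def field_simps add_divide_distrib)

lemma wiener_increments_indep:
  assumes T: "T > 0" and W: "wiener_measure T W" and N: "N > 0"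
  defines "y \<equiv> \<lambda>i w. w (grid_time T N (Suc i)) - w (grid_time T N i)"
  assumes "k \<le> N"
  shows "indep_pair W (Pi\<^sub>M {..<k} (\<lambda>_. borel)) (\<lambda>w. \<lambda>i\<in>{..<k}. y i w)
           (Pi\<^sub>M {k..<N} (\<lambda>_. borel)) (\<lambda>w. \<lambda>i\<in>{k..<N}. y i w)"
proof -
  interpret prob_space W using W by (simp add: wiener_measure_def)
  have "indep_vars (\<lambda>_. borel) y {..<N}"
  proof -
    have "0 \<le> grid_time T N 0" "\<forall>i<N. grid_time T N i < grid_time T N (Suc i)" "grid_time T N N \<le> T"
      using T N by (auto simp: grid_time_last grid_time_Suc)
    then show ?thesis
      using W unfolding wiener_measure_def y_def by blast
  qed
  then have "indep_var (Pi\<^sub>M {..<k} (\<lambda>_. borel)) (\<lambda>w. restrict (\<lambda>i. y i w) {..<k})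
      (Pi\<^sub>M {k..<N} (\<lambda>_. borel)) (\<lambda>w. restrict (\<lambda>i. y i w) {k..<N})"
    by (rule indep_var_restrict) (use \<open>k \<le> N\<close> in auto)
  then show ?thesis
    by (simp add: indep_var_distribution_eq indep_pair_def)
qed

lemma wiener_increment_distributed:
  assumes "wiener_measure T W" "0 \<le> s" "s < t" "t \<le> T"
  shows "distributed W lborel (\<lambda>w. w t - w s) (normal_density 0 (sqrt (t - s)))"
proof -
  have "\<forall>s t. 0 \<le> s \<longrightarrow> s < t \<longrightarrow> t \<le> T \<longrightarrow>
        distributed W lborel (\<lambda>w. w t - w s) (normal_density 0 (sqrt (t - s)))"
    using assms(1) unfolding wiener_measure_def by (elim conjE)
  then show ?thesis using assms(2-4) by simp
qed

text \<open>Induction over the number of grid points revealed so far; each step adds one independent increment.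
  The walk is started at \<open>0\<close> exactly by subtracting \<open>w 0\<close>, which vanishes almost surely.\<close>

lemma wiener_four_functions:
  assumes T: "T > 0" and W: "wiener_measure T W" and N: "N > 0"
  shows "four_functions W (grid_values T N)"
proof -
  interpret prob_space W using W by (simp add: wiener_measure_def)
  define y where "y = (\<lambda>i (w :: real \<Rightarrow> real). w (grid_time T N (Suc i)) - w (grid_time T N i))"
  define S where "S k w i = (if i \<le> k then w (grid_time T N i) - w 0 else 0)"
    for k :: nat and w :: "real \<Rightarrow> real" and i :: nat
  have "four_functions W (S k)" if "k \<le> N" for k
    using that
  proof (induction k)
    case 0
    have "S 0 = (\<lambda>_ _. 0)"
      by (auto simp: S_def fun_eq_iff)
    then show ?case
      using four_functions_const[OF prob_space_axioms] by simp
  next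
    case (Suc k)
    define g where "g x i = (if i \<le> k then \<Sum>j<i. x j else 0)" for x :: "nat \<Rightarrow> real" and i
    have g [measurable]: "g \<in> Pi\<^sub>M {..<k} (\<lambda>_. borel) \<rightarrow>\<^sub>M borel"
    proof (rule measurable_coordinatewise_then_product)
      show "(\<lambda>x. g x i) \<in> borel_measurable (Pi\<^sub>M {..<k} (\<lambda>_. borel))" for i
        unfolding g_def by (cases "i \<le> k") (auto intro!: borel_measurable_sum)
    qed
    have "indep_pair W borel (\<lambda>w. g (\<lambda>i\<in>{..<k}. y i w)) borel (\<lambda>w. (\<lambda>i\<in>{k..<N}. y i w) k)"
      using Suc.prems unfolding y_def
      by (intro indep_pair_compose[OF wiener_increments_indep[OF T W N]]) auto
    moreover have "g (\<lambda>i\<in>{..<k}. y i w) = S k w" for w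
    proof
      fix i
      have "(\<Sum>j<i. restrict (\<lambda>i. y i w) {..<k} j) = (\<Sum>j<i. y j w)" if "i \<le> k"
        using that by (intro sum.cong) auto
      then show "g (\<lambda>i\<in>{..<k}. y i w) i = S k w i"
        by (auto simp: g_def S_def y_def sum_lessThan_telescope[of "\<lambda>i. w (grid_time T N i)"])
    qed
    ultimately have ind: "indep_pair W borel (S k) borel (y k)"
      using Suc.prems by simp
    have dist: "distributed W lborel (y k) (normal_density 0 (sqrt (T / N)))"
    proof -
      have "grid_time T N k < grid_time T N (Suc k)" "grid_time T N (Suc k) - grid_time T N k = T / N"
        using T N by (auto simp: grid_time_Suc)
      moreover have "0 \<le> grid_time T N k" "grid_time T N (Suc k) \<le> T"
        using grid_time_mem[OF T N, of k] grid_time_mem[OF T N, of "Suc k"] Suc.prems by auto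
      ultimately show ?thesis
        using wiener_increment_distributed[OF W, of "grid_time T N k" "grid_time T N (Suc k)"]
        by (simp add: y_def)
    qed
    have "four_functions W (\<lambda>w. (S k w)(Suc k := S k w k + y k w))"
    proof (rule four_functions_gaussian_step)
      show "four_functions W (S k)" using Suc by simp
      fix F :: "(nat \<Rightarrow> real) \<times> real \<Rightarrow> ennreal" assume "F \<in> borel_measurable borel"
      then show "(\<integral>\<^sup>+w. F (S k w, y k w) \<partial>W)
        = (\<integral>\<^sup>+w. \<integral>\<^sup>+x. F (S k w, x) * ennreal (normal_density 0 (sqrt (T / N)) x) \<partial>lborel \<partial>W)"
        by (intro nn_integral_indep_pair_density[OF ind dist]) (auto simp: borel_prod)
    qed simp
    moreover have "(S k w)(Suc k := S k w k + y k w) = S (Suc k) w" for w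
      by (auto simp: S_def y_def fun_eq_iff)
    ultimately show ?case by simp
  qed
  from this[of N] have "four_functions W (S N)" by simp
  then show ?thesis
  proof (rule four_functions_cong_AE)
    show "AE w in W. grid_values T N w = S N w"
      using W unfolding wiener_measure_def
      by (auto simp: grid_values_def S_def fun_eq_iff)
  qed
qed

text \<open>Backwards in time, \<open>z\<close> is a random walk: its increment over the grid cell \<open>[m, m + 1]\<close> is
  independent of its values at later grid points. Those are functions of \<open>w\<close> at grid point \<open>m + 1\<close>
  and of the later increments \<open>R\<close> of \<open>w\<close>. Independence of \<open>w\<close> at grid point \<open>m + 1\<close> is
  \<open>nn_integral_gaussian_bridge_increment\<close>, and \<open>R\<close> is independent of the past, so it is integrated
  last.\<close>

lemma bridge_walk_law:
  fixes F :: "(nat \<Rightarrow> real) \<times> real \<Rightarrow> ennreal"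
  assumes T: "T > 0" and W: "wiener_measure T W" and m: "0 < m" "m < N"
    and F [measurable]: "F \<in> borel_measurable (borel \<Otimes>\<^sub>M borel)"
  defines "z \<equiv> \<lambda>w i. (w (grid_time T N i) - w 0) / grid_time T N i"
  defines "Z \<equiv> \<lambda>w i. if Suc m \<le> i \<and> i \<le> N then z w i - z w N else 0"
  defines "\<sigma> \<equiv> sqrt (T / N / (grid_time T N m * (grid_time T N m + T / N)))"
  shows "(\<integral>\<^sup>+w. F (Z w, z w m - z w (Suc m)) \<partial>W)
    = (\<integral>\<^sup>+w. \<integral>\<^sup>+u. F (Z w, u) * ennreal (normal_density 0 \<sigma> u) \<partial>lborel \<partial>W)"
proof -
  interpret prob_space W using W by (simp add: wiener_measure_def)
  have N: "N > 0" using m by simp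
  define y where "y = (\<lambda>i (w :: real \<Rightarrow> real). w (grid_time T N (Suc i)) - w (grid_time T N i))"
  define A where "A w = w (grid_time T N m) - w 0" for w :: "real \<Rightarrow> real"
  define \<alpha> where "\<alpha> = grid_time T N m"
  define \<beta> where "\<beta> = T / N"
  have \<alpha>\<beta>: "\<alpha> > 0" "\<beta> > 0" "\<alpha> + \<beta> = grid_time T N (Suc m)"
    using T m by (auto simp: \<alpha>_def \<beta>_def grid_time_pos grid_time_Suc)
  define R where "R w = (\<lambda>i\<in>{Suc m..<N}. y i w)" for w
  define \<zeta> where "\<zeta> v r i = (if Suc m \<le> i \<and> i \<le> N then (v + (\<Sum>l=Suc m..<i. r l)) / grid_time T N i
      - (v + (\<Sum>l=Suc m..<N. r l)) / grid_time T N N else 0)" for v :: real and r :: "nat \<Rightarrow> real" and i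
  let ?P = "Pi\<^sub>M {Suc m..<N} (\<lambda>_. borel :: real measure)"
  have \<zeta>_meas: "(\<lambda>p. \<zeta> (fst p) (snd p)) \<in> borel \<Otimes>\<^sub>M ?P \<rightarrow>\<^sub>M borel"
  proof (rule measurable_coordinatewise_then_product)
    show "(\<lambda>p. \<zeta> (fst p) (snd p) i) \<in> borel_measurable (borel \<Otimes>\<^sub>M ?P)" for i
    proof (cases "Suc m \<le> i \<and> i \<le> N")
      case True
      have "(\<lambda>p. \<Sum>l=Suc m..<j. snd p l) \<in> borel_measurable ((borel :: real measure) \<Otimes>\<^sub>M ?P)" if "j \<le> N" for j
        using that
        by (intro borel_measurable_sum measurable_compose[OF measurable_snd measurable_component_singleton]) auto
      from this[of i] this[of N] True show ?thesis
        unfolding \<zeta>_def by simp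
    qed (auto simp: \<zeta>_def)
  qed
  have ind_past: "indep_pair W (borel \<Otimes>\<^sub>M borel) (\<lambda>w. (A w, y m w)) ?P R"
  proof -
    have "indep_pair W (borel \<Otimes>\<^sub>M borel) (\<lambda>w. (\<lambda>x. (\<Sum>l<m. x l, x m)) (\<lambda>i\<in>{..<Suc m}. y i w)) ?P R"
      using m unfolding y_def R_def
      by (intro indep_pair_compose[OF wiener_increments_indep[OF T W N], where h = "\<lambda>x. x"]
           measurable_Pair borel_measurable_sum measurable_component_singleton) auto
    moreover have "(\<Sum>l<m. restrict (\<lambda>i. y i w) {..<Suc m} l) = A w" for w
    proof -
      have "(\<Sum>l<m. restrict (\<lambda>i. y i w) {..<Suc m} l) = (\<Sum>l<m. y l w)"
        by (intro sum.cong) auto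
      then show ?thesis by (simp add: y_def A_def sum_lessThan_telescope[of "\<lambda>i. w (grid_time T N i)"])
    qed
    ultimately show ?thesis by simp
  qed
  have ind: "indep_pair W borel A borel (y m)"
  proof -
    have "indep_pair W borel (\<lambda>w. (\<lambda>x. \<Sum>l<m. x l) (\<lambda>i\<in>{..<m}. y i w)) borel (\<lambda>w. (\<lambda>x. x m) (\<lambda>i\<in>{m..<N}. y i w))"
      using m unfolding y_def
      by (intro indep_pair_compose[OF wiener_increments_indep[OF T W N]]
           borel_measurable_sum measurable_component_singleton) auto
    moreover have "(\<Sum>l<m. restrict (\<lambda>i. y i w) {..<m} l) = A w" for w
    proof -
      have "(\<Sum>l<m. restrict (\<lambda>i. y i w) {..<m} l) = (\<Sum>l<m. y l w)"
        by (intro sum.cong) auto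
      then show ?thesis by (simp add: y_def A_def sum_lessThan_telescope[of "\<lambda>i. w (grid_time T N i)"])
    qed
    ultimately show ?thesis using m by simp
  qed
  note normal = wiener_increment_distributed[OF W]
  have dA: "distributed W lborel A (normal_density 0 (sqrt \<alpha>))"
    using normal[of 0 \<alpha>] \<alpha>\<beta> grid_time_mem[OF T N, of m] m unfolding A_def \<alpha>_def by simp
  have dY: "distributed W lborel (y m) (normal_density 0 (sqrt \<beta>))"
    using normal[of \<alpha> "\<alpha> + \<beta>"] \<alpha>\<beta> grid_time_mem[OF T N, of "Suc m"] m
    unfolding y_def \<alpha>_def[symmetric] \<alpha>\<beta>(3)[symmetric] by simp
  have sum_R: "A w + y m w + (\<Sum>l=Suc m..<i. R w l) = w (grid_time T N i) - w 0"
    if "Suc m \<le> i" "i \<le> N" for w i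
  proof -
    have "(\<Sum>l=Suc m..<i. R w l) = (\<Sum>l=Suc m..<i. y l w)"
      using that by (intro sum.cong) (auto simp: R_def)
    also have "\<dots> = w (grid_time T N i) - w (grid_time T N (Suc m))"
      unfolding y_def using that by (subst sum_Suc_diff') auto
    finally show ?thesis by (simp add: A_def y_def)
  qed
  have Z_eq: "Z w = \<zeta> (A w + y m w) (R w)" for w
    unfolding Z_def \<zeta>_def z_def using sum_R m by (auto simp: fun_eq_iff)
  have U_eq: "z w m - z w (Suc m) = A w / \<alpha> - (A w + y m w) / (\<alpha> + \<beta>)" for w
    unfolding z_def \<alpha>\<beta>(3) by (simp add: A_def y_def \<alpha>_def)
  have H_meas: "(\<lambda>q. F (\<zeta> (snd q) r, fst q)) \<in> borel_measurable (borel \<Otimes>\<^sub>M borel)" if "r \<in> space ?P" for r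
  proof -
    have "(\<lambda>v. \<zeta> v r) \<in> borel \<rightarrow>\<^sub>M borel"
      using measurable_compose[OF measurable_Pair2'[OF that, of borel] \<zeta>_meas] by simp
    then show ?thesis
      by (intro measurable_compose[OF _ F] measurable_Pair) (auto intro: measurable_compose[OF measurable_snd])
  qed
  have F1: "(\<lambda>p. F (\<zeta> (fst (fst p) + snd (fst p)) (snd p), fst (fst p) / \<alpha> - (fst (fst p) + snd (fst p)) / (\<alpha> + \<beta>)))
      \<in> borel_measurable ((borel \<Otimes>\<^sub>M borel) \<Otimes>\<^sub>M ?P)"
    by (intro measurable_compose[OF _ F] measurable_Pair
          measurable_compose[OF _ \<zeta>_meas, of "\<lambda>p. (fst (fst p) + snd (fst p), snd p)", simplified]) measurable
  have F2: "(\<lambda>p. \<integral>\<^sup>+u. F (\<zeta> (fst (fst p) + snd (fst p)) (snd p), u) * normal_density 0 \<sigma> u \<partial>lborel)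
      \<in> borel_measurable ((borel \<Otimes>\<^sub>M borel) \<Otimes>\<^sub>M ?P)"
  proof -
    have [measurable]: "(\<lambda>q. F (\<zeta> (fst (fst (fst q)) + snd (fst (fst q))) (snd (fst q)), snd q))
      \<in> borel_measurable (((borel \<Otimes>\<^sub>M borel) \<Otimes>\<^sub>M ?P) \<Otimes>\<^sub>M lborel)"
      by (intro measurable_compose[OF _ F] measurable_Pair
          measurable_compose[OF _ \<zeta>_meas, of "\<lambda>q. (fst (fst (fst q)) + snd (fst (fst q)), snd (fst q))", simplified]) measurable
    show ?thesis by simp
  qed
  have "(\<integral>\<^sup>+w. F (Z w, z w m - z w (Suc m)) \<partial>W)
    = (\<integral>\<^sup>+r. \<integral>\<^sup>+w. F (\<zeta> (A w + y m w) r, A w / \<alpha> - (A w + y m w) / (\<alpha> + \<beta>)) \<partial>W \<partial>distr W ?P R)"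
    unfolding Z_eq U_eq using nn_integral_indep_pair_swapped[OF ind_past F1] by simp
  also have "\<dots> = (\<integral>\<^sup>+r. \<integral>\<^sup>+w. \<integral>\<^sup>+u. F (\<zeta> (A w + y m w) r, u) * normal_density 0 \<sigma> u \<partial>lborel \<partial>W \<partial>distr W ?P R)"
  proof (rule nn_integral_cong)
    fix r assume "r \<in> space (distr W ?P R)"
    then have "r \<in> space ?P" by simp
    from nn_integral_gaussian_bridge_increment[OF ind dA dY \<alpha>\<beta>(1,2) H_meas[OF this]]
    show "(\<integral>\<^sup>+w. F (\<zeta> (A w + y m w) r, A w / \<alpha> - (A w + y m w) / (\<alpha> + \<beta>)) \<partial>W)
      = (\<integral>\<^sup>+w. \<integral>\<^sup>+u. F (\<zeta> (A w + y m w) r, u) * normal_density 0 \<sigma> u \<partial>lborel \<partial>W)"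
      by (simp add: \<sigma>_def \<alpha>_def \<beta>_def)
  qed
  also have "\<dots> = (\<integral>\<^sup>+w. \<integral>\<^sup>+u. F (Z w, u) * ennreal (normal_density 0 \<sigma> u) \<partial>lborel \<partial>W)"
    unfolding Z_eq using nn_integral_indep_pair_swapped[OF ind_past F2] by simp
  finally show ?thesis .
qed

text \<open>At grid points \<open>t > 0\<close> the bridge equals \<open>t * (w t / t - w T / T) + t / T * x\<close>, an increasing
  affine function of a backward Gaussian walk, and such functions preserve sup and inf.\<close>

lemma bridge_four_functions:
  assumes T: "T > 0" and W: "wiener_measure T W" and N: "N > 0"
  shows "four_functions W (\<lambda>w. grid_values T N (bridge_path T x w))"
proof -
  interpret prob_space W using W by (simp add: wiener_measure_def)
  define z where "z w i = (w (grid_time T N i) - w 0) / grid_time T N i" for w :: "real \<Rightarrow> real" and i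
  define Z where "Z m w i = (if m \<le> i \<and> i \<le> N then z w i - z w N else 0)" for m :: nat and w i
  \<comment> \<open>\<open>Z m\<close> records the walk from the end of the grid down to index \<open>m\<close>; index \<open>0\<close>, where the
    division by time fails, is left out because the bridge vanishes there.\<close>
  have "four_functions W (Z 1)"
  proof (rule inc_induct[of 1 N "\<lambda>m. four_functions W (Z m)"])
    have "Z N = (\<lambda>_ _. 0)" by (auto simp: Z_def fun_eq_iff)
    then show "four_functions W (Z N)"
      using four_functions_const[OF prob_space_axioms] by simp
  next
    fix m assume m: "1 \<le> m" "m < N" and IH: "four_functions W (Z (Suc m))"
    have "four_functions W (\<lambda>w. (Z (Suc m) w)(m := Z (Suc m) w (Suc m) + (z w m - z w (Suc m))))"
    proof (rule four_functions_gaussian_step[OF IH])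
      fix F :: "(nat \<Rightarrow> real) \<times> real \<Rightarrow> ennreal" assume "F \<in> borel_measurable borel"
      then have F: "F \<in> borel_measurable (borel \<Otimes>\<^sub>M borel)" by (simp add: borel_prod)
      show "(\<integral>\<^sup>+w. F (Z (Suc m) w, z w m - z w (Suc m)) \<partial>W)
        = (\<integral>\<^sup>+w. \<integral>\<^sup>+u. F (Z (Suc m) w, u)
            * ennreal (normal_density 0 (sqrt (T / N / (grid_time T N m * (grid_time T N m + T / N)))) u) \<partial>lborel \<partial>W)"
        unfolding Z_def[abs_def] z_def[abs_def]
        by (rule bridge_walk_law[OF T W _ _ F]) (use m in auto)
    qed simp
    moreover have "(Z (Suc m) w)(m := Z (Suc m) w (Suc m) + (z w m - z w (Suc m))) = Z m w" for w
      using m by (auto simp: Z_def fun_eq_iff)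
    ultimately show "four_functions W (Z m)" by simp
  qed (use N in simp)
  define h where "h v i = (if 1 \<le> i \<and> i \<le> N then grid_time T N i * v i + grid_time T N i / T * x else 0)"
    for v :: "nat \<Rightarrow> real" and i
  have "four_functions W (\<lambda>w. h (Z 1 w))"
  proof (rule four_functions_map[OF \<open>four_functions W (Z 1)\<close>])
    show "h \<in> borel_measurable borel"
    proof (rule measurable_coordinatewise_then_product)
      show "(\<lambda>v. h v i) \<in> borel_measurable borel" for i
        unfolding h_def by (cases "1 \<le> i \<and> i \<le> N") simp_all
    qed
    have "grid_time T N i \<ge> 0" for i using T by (simp add: grid_time_def)
    then have "grid_time T N i * max p q = max (grid_time T N i * p) (grid_time T N i * q)"
      "grid_time T N i * min p q = min (grid_time T N i * p) (grid_time T N i * q)" for i p q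
      by (simp_all add: max_mult_distrib_left min_mult_distrib_left not_less)
    then show "h (sup p q) = sup (h p) (h q)" "h (inf p q) = inf (h p) (h q)" for p q
      by (auto simp: h_def fun_eq_iff sup_max inf_min max_add_distrib_left min_add_distrib_left)
  qed
  then show ?thesis
  proof (rule four_functions_cong_AE)
    have "AE w in W. w 0 = 0" using W by (simp add: wiener_measure_def)
    then show "AE w in W. grid_values T N (bridge_path T x w) = h (Z 1 w)"
    proof eventually_elim
      fix w :: "real \<Rightarrow> real" assume w0: "w 0 = 0"
      show "grid_values T N (bridge_path T x w) = h (Z 1 w)"
      proof
        fix i
        consider "i = 0" | "1 \<le> i" "i \<le> N" | "i > N" by linarith
        then show "grid_values T N (bridge_path T x w) i = h (Z 1 w) i"
        proof cases
          case 1
          then show ?thesis using T w0 by (simp add: grid_values_def h_def bridge_path_def)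
        next
          case 2
          then have "grid_time T N i > 0" "grid_time T N i \<in> {0..T}"
            using T N by (auto simp: grid_time_pos grid_time_mem simp del: atLeastAtMost_iff)
          then show ?thesis
            using 2 T N w0
            by (simp add: grid_values_def h_def bridge_path_def Z_def z_def grid_time_last field_simps)
        next
          case 3
          then show ?thesis by (simp add: grid_values_def h_def)
        qed
      qed
    qed
  qed
qed

section \<open>Lipschitz increasing functions on the path space\<close>

lemma mdist_path_metric_le:
  assumes "0 \<le> c" "\<And>t. t \<in> {0..T} \<Longrightarrow> \<bar>u t - v t\<bar> \<le> c"
  shows "mdist (path_metric T) u v \<le> c"
  unfolding path_metric_def
  by (rule mdist_cfunspace_le) (use assms in \<open>auto simp: dist_real_def\<close>)

lemma abs_diff_le_mdist_path_metric:
  assumes "u \<in> space (path_space T)" "v \<in> space (path_space T)" "t \<in> {0..T}"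
  shows "\<bar>u t - v t\<bar> \<le> mdist (path_metric T) u v"
  using dist_le_mdist_path_metric[OF assms] by (simp add: dist_real_def)

lemma restrict_mem_path_space:
  assumes "continuous_on {0..T} f"
  shows "restrict f {0..T} \<in> space (path_space T)"
  using assms by (auto simp: space_path_space cong: continuous_on_cong_simp)

lemma borel_measurable_path_space_continuous:
  assumes "continuous_map (mtopology_of (path_metric T)) euclideanreal f"
  shows "f \<in> borel_measurable (path_space T)"
proof (rule borel_measurableI)
  fix S :: "real set" assume "open S"
  then have "openin (mtopology_of (path_metric T)) {w \<in> mspace (path_metric T). f w \<in> S}"
    using assms by (auto simp: continuous_map_def)
  moreover have "f -` S \<inter> space (path_space T) = {w \<in> mspace (path_metric T). f w \<in> S}"
    by (auto simp: path_space_def)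
  ultimately show "f -` S \<inter> space (path_space T) \<in> sets (path_space T)"
    by (simp add: sets_path_space_openin)
qed

definition path_Lipschitz :: "real \<Rightarrow> real \<Rightarrow> ((real \<Rightarrow> real) \<Rightarrow> real) \<Rightarrow> bool" where
  "path_Lipschitz T L f \<longleftrightarrow> L \<ge> 0 \<and>
     (\<forall>u\<in>space (path_space T). \<forall>v\<in>space (path_space T). \<bar>f u - f v\<bar> \<le> L * mdist (path_metric T) u v)"

lemma path_Lipschitz_continuous_map:
  assumes "path_Lipschitz T L f"
  shows "continuous_map (mtopology_of (path_metric T)) euclideanreal f"
proof -
  have "Lipschitz_continuous_map (path_metric T) euclidean_metric f"
    using assms unfolding Lipschitz_continuous_map_def path_Lipschitz_def
    by (auto simp: dist_real_def path_space_def)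
  from Lipschitz_continuous_imp_continuous_map[OF this] show ?thesis by simp
qed

lemma path_Lipschitz_measurable: "path_Lipschitz T L f \<Longrightarrow> f \<in> borel_measurable (path_space T)"
  by (intro borel_measurable_path_space_continuous path_Lipschitz_continuous_map)

text \<open>Being bounded and continuous, these functions have integrals that converge under weak limits, and they
  are still rich enough to recover the indicators of closed upper sets.\<close>

definition increasing_test :: "real \<Rightarrow> ((real \<Rightarrow> real) \<Rightarrow> real) \<Rightarrow> bool" where
  "increasing_test T f \<longleftrightarrow> (\<forall>w\<in>space (path_space T). 0 \<le> f w \<and> f w \<le> 1) \<and>
     increasing_on_space (path_space T) (path_le T) f \<and> (\<exists>L. path_Lipschitz T L f)"

lemma increasing_test_measurable: "increasing_test T f \<Longrightarrow> f \<in> borel_measurable (path_space T)"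
  by (auto simp: increasing_test_def intro: path_Lipschitz_measurable)

definition path_infdist :: "real \<Rightarrow> (real \<Rightarrow> real) set \<Rightarrow> (real \<Rightarrow> real) \<Rightarrow> real" where
  "path_infdist T C w = (INF c\<in>C. mdist (path_metric T) w c)"

lemma path_infdist_le: "c \<in> C \<Longrightarrow> path_infdist T C w \<le> mdist (path_metric T) w c"
  unfolding path_infdist_def by (intro cINF_lower bdd_belowI[of _ 0]) auto

lemma path_infdist_nonneg: "C \<noteq> {} \<Longrightarrow> 0 \<le> path_infdist T C w"
  unfolding path_infdist_def by (intro cINF_greatest) auto

lemma path_infdist_less:
  assumes "C \<noteq> {}" "path_infdist T C w < e"
  obtains c where "c \<in> C" "mdist (path_metric T) w c < e"
  using assms unfolding path_infdist_def
  by (subst (asm) cINF_less_iff) (auto intro: bdd_belowI[of _ 0])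

lemma path_Lipschitz_infdist:
  assumes "C \<noteq> {}" "C \<subseteq> space (path_space T)"
  shows "path_Lipschitz T 1 (path_infdist T C)"
proof -
  interpret P: Metric_space "mspace (path_metric T)" "mdist (path_metric T)"
    by (rule Metric_space_mspace_mdist)
  have le: "path_infdist T C u \<le> path_infdist T C v + mdist (path_metric T) u v"
    if "u \<in> space (path_space T)" "v \<in> space (path_space T)" for u v
  proof -
    have "path_infdist T C u - mdist (path_metric T) u v \<le> path_infdist T C v"
      unfolding path_infdist_def[of T C v]
    proof (rule cINF_greatest[OF assms(1)])
      fix c assume c: "c \<in> C"
      then have "mdist (path_metric T) u c \<le> mdist (path_metric T) u v + mdist (path_metric T) v c"
        using that assms(2) by (intro P.triangle) (auto simp: path_space_def)
      then show "path_infdist T C u - mdist (path_metric T) u v \<le> mdist (path_metric T) v c"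
        using path_infdist_le[OF c, of T u] by simp
    qed
    then show ?thesis by simp
  qed
  show ?thesis
    unfolding path_Lipschitz_def
  proof (intro conjI ballI)
    fix u v assume uv: "u \<in> space (path_space T)" "v \<in> space (path_space T)"
    show "\<bar>path_infdist T C u - path_infdist T C v\<bar> \<le> 1 * mdist (path_metric T) u v"
      using le[OF uv] le[OF uv(2,1)] P.commute[of u v] by simp
  qed simp
qed

lemma closedin_path_infdist_eq_0:
  assumes "closedin (mtopology_of (path_metric T)) C" "C \<noteq> {}" "w \<in> space (path_space T)" "path_infdist T C w = 0"
  shows "w \<in> C"
proof (rule ccontr)
  interpret P: Metric_space "mspace (path_metric T)" "mdist (path_metric T)"
    by (rule Metric_space_mspace_mdist)
  assume "w \<notin> C"
  have "openin P.mtopology (mspace (path_metric T) - C)"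
    using assms(1) by (simp add: closedin_def mtopology_of_def)
  then obtain r where r: "r > 0" "P.mball w r \<subseteq> mspace (path_metric T) - C"
    using assms(3) \<open>w \<notin> C\<close> unfolding P.openin_mtopology by (auto simp: path_space_def)
  obtain c where c: "c \<in> C" "mdist (path_metric T) w c < r"
    using path_infdist_less[OF assms(2), of T w r] assms(4) r(1) by auto
  have "c \<in> mspace (path_metric T)"
    using closedin_subset[OF assms(1)] c(1) by auto
  then have "c \<in> P.mball w r"
    using c assms(3) by (simp add: path_space_def)
  then show False using r(2) c(1) by auto
qed

definition path_upper :: "real \<Rightarrow> (real \<Rightarrow> real) set \<Rightarrow> bool" where
  "path_upper T U \<longleftrightarrow> (\<forall>u\<in>U. \<forall>v\<in>space (path_space T). path_le T u v \<longrightarrow> v \<in> U)"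

lemma path_upperD: "path_upper T U \<Longrightarrow> u \<in> U \<Longrightarrow> v \<in> space (path_space T) \<Longrightarrow> path_le T u v \<Longrightarrow> v \<in> U"
  by (auto simp: path_upper_def)

text \<open>If \<open>c\<close> is a point of the upper set \<open>C\<close> near \<open>u\<close>, then \<open>c + (v - u)\<close> lies in \<open>C\<close> too and is
  just as near to \<open>v\<close>.\<close>

lemma path_infdist_antimono:
  assumes C: "C \<noteq> {}" "C \<subseteq> space (path_space T)"
    and upper: "path_upper T C"
    and uv: "u \<in> space (path_space T)" "v \<in> space (path_space T)" "path_le T u v"
  shows "path_infdist T C v \<le> path_infdist T C u"
  unfolding path_infdist_def[of T C u]
proof (rule cINF_greatest[OF C(1)])
  fix c assume c: "c \<in> C"
  define c' where "c' = (\<lambda>t\<in>{0..T}. c t + (v t - u t))"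
  have "c \<in> space (path_space T)" using c C(2) by auto
  then have c'_space: "c' \<in> space (path_space T)"
    unfolding c'_def using uv by (intro restrict_mem_path_space continuous_intros) (auto simp: space_path_space)
  have "path_le T c c'" using uv(3) by (simp add: path_le_def c'_def)
  then have "c' \<in> C" using path_upperD[OF upper c c'_space] by simp
  then have "path_infdist T C v \<le> mdist (path_metric T) v c'" by (rule path_infdist_le)
  also have "\<dots> \<le> mdist (path_metric T) u c"
  proof (rule mdist_path_metric_le)
    fix t assume "t \<in> {0..T}"
    then show "\<bar>v t - c' t\<bar> \<le> mdist (path_metric T) u c"
      using abs_diff_le_mdist_path_metric[OF uv(1) \<open>c \<in> space _\<close>, of t] by (simp add: c'_def)
  qed simp
  finally show "path_infdist T C v \<le> mdist (path_metric T) u c" .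
qed

text \<open>The function is \<open>1\<close> on \<open>C\<close> and \<open>0\<close> at distance more than \<open>1 / j\<close>. The infimum that defines
  the distance is meaningless for the empty set, whose approximations are \<open>0\<close> instead.\<close>

definition infdist_bump :: "real \<Rightarrow> (real \<Rightarrow> real) set \<Rightarrow> nat \<Rightarrow> (real \<Rightarrow> real) \<Rightarrow> real" where
  "infdist_bump T C j w = (if C = {} then 0 else max 0 (1 - real j * path_infdist T C w))"

lemma increasing_test_infdist_bump:
  assumes C: "C \<subseteq> space (path_space T)"
    and upper: "path_upper T C"
  shows "increasing_test T (infdist_bump T C j)"
proof (cases "C = {}")
  case True
  then show ?thesis
    by (auto simp: increasing_test_def infdist_bump_def increasing_on_space_def path_Lipschitz_def intro!: exI[of _ 0])
next
  case False
  have "path_Lipschitz T (real j) (infdist_bump T C j)"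
    unfolding path_Lipschitz_def
  proof (intro conjI ballI)
    fix u v assume uv: "u \<in> space (path_space T)" "v \<in> space (path_space T)"
    have "\<bar>infdist_bump T C j u - infdist_bump T C j v\<bar> \<le> \<bar>real j * path_infdist T C u - real j * path_infdist T C v\<bar>"
      using False by (auto simp: infdist_bump_def max_def)
    also have "\<dots> = real j * \<bar>path_infdist T C u - path_infdist T C v\<bar>"
      by (simp add: abs_mult flip: right_diff_distrib)
    also have "\<dots> \<le> real j * mdist (path_metric T) u v"
      using path_Lipschitz_infdist[OF False C] uv by (intro mult_left_mono) (auto simp: path_Lipschitz_def)
    finally show "\<bar>infdist_bump T C j u - infdist_bump T C j v\<bar> \<le> real j * mdist (path_metric T) u v" .
  qed simp
  moreover have "infdist_bump T C j u \<le> infdist_bump T C j v"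
    if "u \<in> space (path_space T)" "v \<in> space (path_space T)" "path_le T u v" for u v
    using path_infdist_antimono[OF False C upper that] False
    by (simp add: infdist_bump_def mult_left_mono max.coboundedI2)
  moreover have "0 \<le> infdist_bump T C j w" "infdist_bump T C j w \<le> 1" for w
    using path_infdist_nonneg[OF False, of T w] by (auto simp: infdist_bump_def)
  ultimately show ?thesis
    by (auto simp: increasing_test_def increasing_on_space_def)
qed

lemma infdist_bump_tendsto:
  assumes "closedin (mtopology_of (path_metric T)) C" "w \<in> space (path_space T)"
  shows "(\<lambda>j. infdist_bump T C j w) \<longlonglongrightarrow> indicator C w"
proof (cases "C = {}")
  case True
  then show ?thesis by (simp add: infdist_bump_def)
next
  case False
  define d where "d = path_infdist T C w"
  have "d \<ge> 0" unfolding d_def by (rule path_infdist_nonneg[OF False])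
  show ?thesis
  proof (cases "w \<in> C")
    case True
    have "mdist (path_metric T) w w = 0" using assms(2) by (auto simp: path_space_def)
    then have "d = 0" using path_infdist_le[OF True, of T w] \<open>d \<ge> 0\<close> by (simp add: d_def)
    then show ?thesis using True False by (simp add: infdist_bump_def d_def)
  next
    case False
    then have "d > 0"
      using closedin_path_infdist_eq_0[OF assms(1) \<open>C \<noteq> {}\<close> assms(2)] \<open>d \<ge> 0\<close> by (force simp: d_def)
    obtain N :: nat where N: "1 / d < real N" using reals_Archimedean2 by blast
    have "infdist_bump T C j w = 0" if "j \<ge> N" for j
    proof -
      have "1 / d \<le> real j" using N that by linarith
      then have "1 \<le> real j * d" using \<open>d > 0\<close> by (simp add: field_simps)
      then show ?thesis by (simp add: infdist_bump_def d_def)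
    qed
    then have "eventually (\<lambda>j. infdist_bump T C j w = 0) sequentially"
      by (auto simp: eventually_sequentially)
    then show ?thesis using False by (simp add: tendsto_eventually)
  qed
qed

section \<open>Reconstruction of a path from its grid values\<close>

definition bernstein_path :: "real \<Rightarrow> nat \<Rightarrow> (nat \<Rightarrow> real) \<Rightarrow> real \<Rightarrow> real" where
  "bernstein_path T N x = (\<lambda>t\<in>{0..T}. \<Sum>k\<le>N. x k * Bernstein N k (t / T))"

lemma bernstein_path_mem: "T > 0 \<Longrightarrow> bernstein_path T N x \<in> space (path_space T)"
  unfolding bernstein_path_def Bernstein_def
  by (intro restrict_mem_path_space continuous_intros) auto

lemma bernstein_path_mono:
  assumes "T > 0" "\<And>k. k \<le> N \<Longrightarrow> x k \<le> y k"
  shows "path_le T (bernstein_path T N x) (bernstein_path T N y)"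
  unfolding path_le_def bernstein_path_def
  using assms by (auto intro!: sum_mono mult_right_mono Bernstein_nonneg)

text \<open>The Bernstein basis consists of functions with values in \<open>[0, 1]\<close>. The estimate makes a Lipschitz
  function of the rebuilt path continuous, hence measurable, in the grid values.\<close>

lemma mdist_bernstein_path_le:
  assumes "T > 0"
  shows "mdist (path_metric T) (bernstein_path T N x) (bernstein_path T N y) \<le> (\<Sum>k\<le>N. \<bar>x k - y k\<bar>)"
proof (rule mdist_path_metric_le)
  fix t assume t: "t \<in> {0..T}"
  have B: "0 \<le> Bernstein N k (t / T)" for k
    using t assms by (intro Bernstein_nonneg) auto
  have B1: "Bernstein N k (t / T) \<le> 1" if "k \<le> N" for k
    using member_le_sum[of k "{..N}" "\<lambda>k. Bernstein N k (t / T)"] that B by simp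
  have "\<bar>bernstein_path T N x t - bernstein_path T N y t\<bar> = \<bar>\<Sum>k\<le>N. (x k - y k) * Bernstein N k (t / T)\<bar>"
    using t by (simp add: bernstein_path_def sum_subtractf left_diff_distrib)
  also have "\<dots> \<le> (\<Sum>k\<le>N. \<bar>(x k - y k) * Bernstein N k (t / T)\<bar>)"
    by (rule sum_abs)
  also have "\<dots> \<le> (\<Sum>k\<le>N. \<bar>x k - y k\<bar>)"
    using B B1 by (intro sum_mono) (auto simp: abs_mult intro!: mult_right_le_one_le)
  finally show "\<bar>bernstein_path T N x t - bernstein_path T N y t\<bar> \<le> (\<Sum>k\<le>N. \<bar>x k - y k\<bar>)" .
qed (simp add: sum_nonneg)

lemma bernstein_path_measurable:
  assumes "T > 0" "path_Lipschitz T L f"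
  shows "(\<lambda>x. f (bernstein_path T N x)) \<in> borel_measurable (borel :: (nat \<Rightarrow> real) measure)"
proof (rule borel_measurable_continuous_onI, unfold continuous_on_def, rule ballI)
  fix x :: "nat \<Rightarrow> real"
  have "((\<lambda>y. f (bernstein_path T N y) - f (bernstein_path T N x)) \<longlongrightarrow> 0) (at x)"
  proof (rule Lim_null_comparison)
    have "\<bar>f (bernstein_path T N y) - f (bernstein_path T N x)\<bar> \<le> L * (\<Sum>k\<le>N. \<bar>y k - x k\<bar>)" for y
    proof -
      have "\<bar>f (bernstein_path T N y) - f (bernstein_path T N x)\<bar>
          \<le> L * mdist (path_metric T) (bernstein_path T N y) (bernstein_path T N x)"
        using assms bernstein_path_mem by (auto simp: path_Lipschitz_def)
      also have "\<dots> \<le> L * (\<Sum>k\<le>N. \<bar>y k - x k\<bar>)"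
        using assms by (intro mult_left_mono mdist_bernstein_path_le) (auto simp: path_Lipschitz_def)
      finally show ?thesis .
    qed
    then show "\<forall>\<^sub>F y in at x. norm (f (bernstein_path T N y) - f (bernstein_path T N x))
        \<le> L * (\<Sum>k\<le>N. \<bar>y k - x k\<bar>)" by simp
    have "((\<lambda>y::nat \<Rightarrow> real. y k) \<longlongrightarrow> x k) (at x)" for k
      using continuous_on_product_coordinates[of k] by (auto simp: continuous_on_def)
    then have "((\<lambda>y. L * (\<Sum>k\<le>N. \<bar>y k - x k\<bar>)) \<longlongrightarrow> L * (\<Sum>k\<le>N. \<bar>x k - x k\<bar>)) (at x)"
      by (intro tendsto_intros)
    then show "((\<lambda>y. L * (\<Sum>k\<le>N. \<bar>y k - x k\<bar>)) \<longlongrightarrow> 0) (at x)" by simp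
  qed
  then show "((\<lambda>x. f (bernstein_path T N x)) \<longlongrightarrow> f (bernstein_path T N x)) (at x)"
    by (rule LIM_zero_cancel)
qed

lemma continuous_on_rescaled_path:
  assumes "T > 0" "w \<in> space (path_space T)"
  shows "continuous_on {0..1} (\<lambda>s. w (T * s))"
proof (rule continuous_on_compose2[of "{0..T}" w])
  show "continuous_on {0..T} w" using assms by (simp add: space_path_space)
qed (use assms in \<open>auto intro!: continuous_intros simp: mult_left_le\<close>)

text \<open>Bernstein's proof of the Weierstrass theorem, transported from \<open>[0, 1]\<close> to \<open>[0, T]\<close>.\<close>

lemma bernstein_path_tendsto:
  assumes T: "T > 0" and f: "path_Lipschitz T L f" and w: "w \<in> space (path_space T)"
  shows "(\<lambda>N. f (bernstein_path T N (\<lambda>k. if k \<le> N then w (T * (real k / real N)) else 0))) \<longlonglongrightarrow> f w"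
    (is "(\<lambda>N. f (?b N)) \<longlonglongrightarrow> _")
proof -
  interpret P: Metric_space "mspace (path_metric T)" "mdist (path_metric T)"
    by (rule Metric_space_mspace_mdist)
  have "(\<lambda>N. mdist (path_metric T) (?b N) w) \<longlonglongrightarrow> 0"
  proof (rule LIMSEQ_I)
    fix e :: real assume "e > 0"
    note cont = continuous_on_rescaled_path[OF T w]
    obtain N0 where N0: "\<And>N s. N \<ge> N0 \<Longrightarrow> s \<in> {0..1} \<Longrightarrow>
        \<bar>w (T * s) - (\<Sum>k\<le>N. w (T * (real k / real N)) * Bernstein N k s)\<bar> < e / 2"
      using Bernstein_Weierstrass[OF cont, of "e / 2"] \<open>e > 0\<close> by auto
    have "mdist (path_metric T) (?b N) w \<le> e / 2" if "N \<ge> N0" for N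
    proof (rule mdist_path_metric_le)
      fix t assume t: "t \<in> {0..T}"
      then show "\<bar>?b N t - w t\<bar> \<le> e / 2"
        using N0[OF that, of "t / T"] T by (simp add: bernstein_path_def abs_minus_commute)
    qed (use \<open>e > 0\<close> in simp)
    then show "\<exists>N0. \<forall>N\<ge>N0. norm (mdist (path_metric T) (?b N) w - 0) < e"
      using \<open>e > 0\<close> by (intro exI[of _ N0]) force
  qed
  then have lim: "(\<lambda>N. L * mdist (path_metric T) (?b N) w) \<longlonglongrightarrow> 0"
    by (rule tendsto_mult_right_zero)
  have "(\<lambda>N. f (?b N) - f w) \<longlonglongrightarrow> 0"
    by (rule Lim_null_comparison[OF _ lim])
       (use f w bernstein_path_mem[OF T] in \<open>auto simp: path_Lipschitz_def\<close>)
  then show ?thesis by (rule LIM_zero_cancel)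
qed

section \<open>Inner approximation of upper sets by closed upper sets\<close>

text \<open>Restriction of a path to the rational multiples of \<open>T\<close> embeds the path space into
  \<open>rat \<Rightarrow> real\<close>. That type is a complete separable metric space, so finite measures on it are
  inner regular, while the order of paths remains the coordinatewise order.\<close>

definition rational_values :: "real \<Rightarrow> (real \<Rightarrow> real) \<Rightarrow> rat \<Rightarrow> real" where
  "rational_values T w r = (if 0 \<le> r \<and> r \<le> 1 then w (T * of_rat r) else 0)"

lemma of_rat_unit_interval: "(T :: real) > 0 \<Longrightarrow> 0 \<le> r \<Longrightarrow> r \<le> 1 \<Longrightarrow> T * of_rat r \<in> {0..T}"
  by (auto simp: mult_left_le)

lemma closure_rationals_unit_interval: "closure (of_rat ` {0..1::rat}) = {0..1::real}"
proof
  show "closure (of_rat ` {0..1::rat}) \<subseteq> {0..1::real}"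
    by (rule closure_minimal) auto
  have eq: "{0<..<1} \<inter> \<rat> \<subseteq> (of_rat ` {0..1::rat} :: real set)"
    by (auto simp: Rats_def)
  have "{0<..<1::real} \<subseteq> closure ({0<..<1} \<inter> \<rat>)"
    using open_Int_closure_subset[of "{0<..<1::real}" \<rat>] by (simp add: Rats_closure_real)
  then have "closure {0<..<1::real} \<subseteq> closure (of_rat ` {0..1::rat})"
    using eq closure_mono closure_minimal closed_closure by (meson order_trans)
  then show "{0..1::real} \<subseteq> closure (of_rat ` {0..1::rat})"
    by simp
qed

lemma path_le_iff_rational_values:
  assumes T: "T > 0" and uv: "u \<in> space (path_space T)" "v \<in> space (path_space T)"
  shows "path_le T u v \<longleftrightarrow> rational_values T u \<le> rational_values T v"
proof
  assume "path_le T u v"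
  then show "rational_values T u \<le> rational_values T v"
    using of_rat_unit_interval[OF T] by (auto simp: path_le_def rational_values_def le_fun_def)
next
  assume le: "rational_values T u \<le> rational_values T v"
  have *: "u (T * s) - v (T * s) \<le> 0" if "s \<in> {0..1}" for s
  proof (rule continuous_le_on_closure[where f = "\<lambda>s. u (T * s) - v (T * s)" and S = "of_rat ` {0..1}"])
    show "continuous_on (closure (of_rat ` {0..1})) (\<lambda>s. u (T * s) - v (T * s))"
      unfolding closure_rationals_unit_interval
      by (intro continuous_intros continuous_on_rescaled_path T uv)
    show "s \<in> closure (of_rat ` {0..1})" unfolding closure_rationals_unit_interval by (rule that)
    fix s :: real assume "s \<in> of_rat ` {0..1}"
    then obtain r :: rat where r: "s = of_rat r" "0 \<le> r" "r \<le> 1" by auto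
    have "rational_values T u r \<le> rational_values T v r" using le by (auto simp: le_fun_def)
    then show "u (T * s) - v (T * s) \<le> 0" using r by (simp add: rational_values_def)
  qed
  show "path_le T u v"
    unfolding path_le_def
  proof
    fix t assume "t \<in> {0..T}"
    then show "u t \<le> v t" using *[of "t / T"] T by simp
  qed
qed

lemma measurable_rational_values:
  assumes "T > 0"
  shows "rational_values T \<in> path_space T \<rightarrow>\<^sub>M borel"
proof (rule measurable_coordinatewise_then_product)
  show "(\<lambda>w. rational_values T w r) \<in> borel_measurable (path_space T)" for r
  proof (cases "0 \<le> r \<and> r \<le> 1")
    case True
    then show ?thesis
      using measurable_path_eval[OF of_rat_unit_interval[OF assms]] by (simp add: rational_values_def)
  qed (auto simp: rational_values_def)
qed

text \<open>The sigma-algebra of the uniform topology is generated by the values at rational times. Indeed the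
  distance to a closed set is the limit of the distances of the Bernstein approximations, which depend
  on finitely many such values.\<close>

lemma path_space_eq_vimage_rational_values:
  assumes T: "T > 0" and A: "A \<in> sets (path_space T)"
  obtains A' where "A' \<in> sets borel" "A = rational_values T -` A' \<inter> space (path_space T)"
proof -
  \<comment> \<open>\<open>V\<close> is the sigma-algebra generated by the values at rational times.\<close>
  define V where "V = vimage_algebra (space (path_space T)) (rational_values T) borel"
  have rv: "rational_values T \<in> V \<rightarrow>\<^sub>M borel"
    unfolding V_def by (rule measurable_vimage_algebra1) simp
  have spV: "space V = space (path_space T)" by (simp add: V_def)
  have closed: "C \<in> sets V" if C: "closedin (mtopology_of (path_metric T)) C" for C
  proof (cases "C = {}")
    case False
    have "C \<subseteq> space (path_space T)" using closedin_subset[OF C] by (simp add: path_space_def)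
    note lip = path_Lipschitz_infdist[OF False this]
    have "path_infdist T C \<in> borel_measurable V"
    proof (rule borel_measurable_LIMSEQ_real)
      fix N :: nat
      define g where "g x k = (if k \<le> N then x (of_nat k / of_nat N) else 0)" for x :: "rat \<Rightarrow> real" and k :: nat
      have g: "g \<in> borel \<rightarrow>\<^sub>M borel"
      proof (rule measurable_coordinatewise_then_product)
        show "(\<lambda>x. g x k) \<in> borel_measurable borel" for k
          unfolding g_def
          by (cases "k \<le> N") (auto intro: borel_measurable_continuous_onI continuous_on_product_coordinates)
      qed
      have "(\<lambda>w. path_infdist T C (bernstein_path T N (g (rational_values T w)))) \<in> borel_measurable V"
        by (rule measurable_compose[OF measurable_compose[OF rv g] bernstein_path_measurable[OF T lip]])
      moreover have "g (rational_values T w) = (\<lambda>k. if k \<le> N then w (T * (real k / real N)) else 0)" for w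
      proof
        fix k
        show "g (rational_values T w) k = (if k \<le> N then w (T * (real k / real N)) else 0)"
          by (cases "N = 0") (auto simp: g_def rational_values_def of_rat_divide)
      qed
      ultimately show "(\<lambda>w. path_infdist T C (bernstein_path T N (\<lambda>k. if k \<le> N then w (T * (real k / real N)) else 0)))
          \<in> borel_measurable V" by simp
    next
      fix w assume "w \<in> space V"
      then show "(\<lambda>N. path_infdist T C (bernstein_path T N (\<lambda>k. if k \<le> N then w (T * (real k / real N)) else 0)))
          \<longlonglongrightarrow> path_infdist T C w"
        using bernstein_path_tendsto[OF T lip] by (simp add: spV)
    qed
    then have "{w \<in> space V. path_infdist T C w = 0} \<in> sets V" by measurable
    moreover have "{w \<in> space V. path_infdist T C w = 0} = C"
    proof -
      have "path_infdist T C w = 0" if "w \<in> C" for w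
      proof -
        have "mdist (path_metric T) w w = 0"
          using subsetD[OF \<open>C \<subseteq> _\<close> that] by (simp add: path_space_def)
        then show ?thesis
          using path_infdist_le[OF that, of T w] path_infdist_nonneg[OF False, of T w] by simp
      qed
      then show ?thesis
        using closedin_path_infdist_eq_0[OF C False] \<open>C \<subseteq> _\<close> spV by auto
    qed
    ultimately show ?thesis by simp
  qed simp
  have "sigma_sets (mspace (path_metric T)) {U. openin (mtopology_of (path_metric T)) U} \<subseteq> sets V"
  proof (rule sets.sigma_sets_subset'[of _ V, unfolded spV, simplified path_space_def space_borel_of_metric])
    show "mspace (path_metric T) \<in> sets V" using sets.top[of V] by (simp add: spV path_space_def)
    show "{U. openin (mtopology_of (path_metric T)) U} \<subseteq> sets V"
    proof safe
      fix U assume U: "openin (mtopology_of (path_metric T)) U"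
      have "closedin (mtopology_of (path_metric T)) (topspace (mtopology_of (path_metric T)) - U)"
        using U unfolding openin_closedin_eq by blast
      from closed[OF this] have "space V - U \<in> sets V"
        by (simp add: spV path_space_def)
      then have "space V - (space V - U) \<in> sets V" by blast
      moreover have "U \<subseteq> space V" using openin_subset[OF U] by (simp add: spV path_space_def)
      ultimately show "U \<in> sets V" by (simp add: double_diff)
    qed
  qed
  then have "A \<in> sets V" using A by (auto simp: path_space_def sets_borel_of_metric)
  then show ?thesis
    using that unfolding V_def by (auto simp: sets_vimage_algebra2)
qed

text \<open>The range of \<open>rational_values\<close>, for every \<open>T > 0\<close>, described by countably many conditions: a
  function on the rationals in \<open>[0, 1]\<close> extends continuously iff it is uniformly continuous.\<close>

definition rational_path_traces :: "(rat \<Rightarrow> real) set" where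
  "rational_path_traces = {x. (\<forall>r. \<not> (0 \<le> r \<and> r \<le> 1) \<longrightarrow> x r = 0) \<and>
     (\<forall>j::nat. \<exists>i::nat. \<forall>r s. 0 \<le> r \<and> r \<le> 1 \<and> 0 \<le> s \<and> s \<le> 1 \<and> \<bar>of_rat r - of_rat s\<bar> < 1 / real (Suc i)
        \<longrightarrow> \<bar>x r - x s\<bar> < 1 / real (Suc j))}"

lemma rational_path_traces_borel: "rational_path_traces \<in> sets borel"
proof -
  define D where "D r s i \<longleftrightarrow> 0 \<le> r \<and> r \<le> 1 \<and> 0 \<le> s \<and> s \<le> 1 \<and> \<bar>of_rat r - of_rat s\<bar> < 1 / real (Suc i)"
    for r s and i :: nat
  define Z where "Z r = {x :: rat \<Rightarrow> real. \<not> (0 \<le> r \<and> r \<le> 1) \<longrightarrow> x r = 0}" for r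
  define A where "A j i r s = {x :: rat \<Rightarrow> real. D r s i \<longrightarrow> \<bar>x r - x s\<bar> < 1 / real (Suc j)}" for j i :: nat and r s
  have "{x :: rat \<Rightarrow> real. x r = 0} \<in> sets borel" for r
    by (intro borel_closed closed_Collect_eq continuous_intros continuous_on_product_coordinates)
  then have Z: "Z r \<in> sets borel" for r
    by (cases "0 \<le> r \<and> r \<le> 1") (auto simp: Z_def)
  have "{x :: rat \<Rightarrow> real. \<bar>x r - x s\<bar> < 1 / real (Suc j)} \<in> sets borel" for r s j
    by (intro borel_open open_Collect_less continuous_intros continuous_on_product_coordinates)
  then have A: "A j i r s \<in> sets borel" for j i r s
    by (cases "D r s i") (auto simp: A_def)
  have "rational_path_traces = (\<Inter>r. Z r) \<inter> (\<Inter>j. \<Union>i. \<Inter>r. \<Inter>s. A j i r s)"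
    unfolding rational_path_traces_def Z_def A_def D_def
    by (simp only: set_eq_iff Int_iff mem_Collect_eq INT_iff UN_iff ball_UNIV bex_UNIV) simp
  also have "\<dots> \<in> sets borel"
  proof -
    have "(\<Inter>r. \<Inter>s. A j i r s) \<in> sets borel" for j i
      by (rule sets.countable_INT''; (rule sets.countable_INT'')?) (simp_all add: A)
    then have "(\<Inter>j. \<Union>i. \<Inter>r. \<Inter>s. A j i r s) \<in> sets borel"
      by (intro sets.countable_INT'' sets.countable_UN) auto
    moreover have "(\<Inter>r. Z r) \<in> sets borel"
      by (rule sets.countable_INT'') (simp_all add: Z)
    ultimately show ?thesis by blast
  qed
  finally show ?thesis .
qed

lemma rational_values_mem_traces:
  assumes T: "T > 0" and w: "w \<in> space (path_space T)"
  shows "rational_values T w \<in> rational_path_traces"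
proof -
  have "uniformly_continuous_on {0..1} (\<lambda>s. w (T * s))"
    by (intro compact_uniformly_continuous continuous_on_rescaled_path T w) simp
  then have uc: "\<forall>e>0. \<exists>d>0. \<forall>s\<in>{0..1}. \<forall>s'\<in>{0..1}. dist s' s < d \<longrightarrow> dist (w (T * s')) (w (T * s)) < e"
    unfolding uniformly_continuous_on_def .
  have "\<exists>i::nat. \<forall>r s. 0 \<le> r \<and> r \<le> 1 \<and> 0 \<le> s \<and> s \<le> 1 \<and> \<bar>of_rat r - of_rat s\<bar> < 1 / real (Suc i)
        \<longrightarrow> \<bar>rational_values T w r - rational_values T w s\<bar> < 1 / real (Suc j)" for j
  proof -
    have "0 < 1 / real (Suc j)" by simp
    with uc obtain d where d: "d > 0"
      "\<forall>s\<in>{0..1}. \<forall>s'\<in>{0..1}. dist s' s < d \<longrightarrow> dist (w (T * s')) (w (T * s)) < 1 / real (Suc j)"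
      by blast
    obtain i where i: "inverse (real (Suc i)) < d" using reals_Archimedean[OF d(1)] by auto
    show ?thesis
    proof (intro exI[of _ i] allI impI)
      fix r s :: rat assume *: "0 \<le> r \<and> r \<le> 1 \<and> 0 \<le> s \<and> s \<le> 1 \<and> \<bar>of_rat r - of_rat s\<bar> < 1 / real (Suc i)"
      then have "of_rat r \<in> {0..1::real}" "of_rat s \<in> {0..1::real}" "dist (of_rat r) (of_rat s :: real) < d"
        using i by (auto simp: dist_real_def inverse_eq_divide)
      then have "dist (w (T * of_rat r)) (w (T * of_rat s)) < 1 / real (Suc j)"
        using d(2) by blast
      then show "\<bar>rational_values T w r - rational_values T w s\<bar> < 1 / real (Suc j)"
        using * by (simp add: rational_values_def dist_real_def)
    qed
  qed
  moreover have "rational_values T w r = 0" if "\<not> (0 \<le> r \<and> r \<le> 1)" for r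
    using that by (auto simp: rational_values_def)
  ultimately show ?thesis
    unfolding rational_path_traces_def mem_Collect_eq by (intro conjI allI impI)
qed

lemma rational_path_traces_extend:
  assumes T: "T > 0" and x: "x \<in> rational_path_traces"
  shows "\<exists>w\<in>space (path_space T). rational_values T w = x"
proof -
  define f :: "real \<Rightarrow> real" where "f s = x (inv of_rat s)" for s
  have inj: "inj (of_rat :: rat \<Rightarrow> real)" by (simp add: inj_def)
  have f: "f (of_rat r) = x r" for r by (simp add: f_def inv_f_f[OF inj])
  have uc: "uniformly_continuous_on (of_rat ` {0..1}) f"
    unfolding uniformly_continuous_on_def
  proof (intro allI impI)
    fix e :: real assume "e > 0"
    obtain j where j: "inverse (real (Suc j)) < e" using reals_Archimedean[OF \<open>e > 0\<close>] by auto
    have "\<forall>j::nat. \<exists>i::nat. \<forall>r s. 0 \<le> r \<and> r \<le> 1 \<and> 0 \<le> s \<and> s \<le> 1 \<and> \<bar>of_rat r - of_rat s\<bar> < 1 / real (Suc i)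
        \<longrightarrow> \<bar>x r - x s\<bar> < 1 / real (Suc j)"
      using x unfolding rational_path_traces_def mem_Collect_eq by (rule conjunct2)
    from spec[OF this, of j] obtain i where i: "\<forall>r s. 0 \<le> r \<and> r \<le> 1 \<and> 0 \<le> s \<and> s \<le> 1 \<and> \<bar>of_rat r - of_rat s\<bar> < 1 / real (Suc i)
        \<longrightarrow> \<bar>x r - x s\<bar> < 1 / real (Suc j)"
      by (rule exE)
    show "\<exists>d>0. \<forall>s\<in>of_rat ` {0..1}. \<forall>s'\<in>of_rat ` {0..1}. dist s' s < d \<longrightarrow> dist (f s') (f s) < e"
    proof (intro exI[of _ "1 / real (Suc i)"] conjI ballI impI)
      fix s s' :: real assume ss: "s \<in> of_rat ` {0..1}" "s' \<in> of_rat ` {0..1}" "dist s' s < 1 / real (Suc i)"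
      obtain r where r: "s = of_rat r" "r \<in> {0..1}" using ss(1) by (rule imageE)
      obtain r' where r': "s' = of_rat r'" "r' \<in> {0..1}" using ss(2) by (rule imageE)
      have "\<bar>x r' - x r\<bar> < 1 / real (Suc j)"
        using spec[OF spec[OF i, of r'], of r] r r' ss(3) by (simp add: dist_real_def)
      then show "dist (f s') (f s) < e"
        using j unfolding r(1) r'(1) f dist_real_def inverse_eq_divide by linarith
    qed simp
  qed
  obtain g where g: "uniformly_continuous_on {0..1} g" "\<And>s. s \<in> of_rat ` {0..1} \<Longrightarrow> f s = g s"
  proof (rule uniformly_continuous_on_extension_on_closure[OF uc, unfolded closure_rationals_unit_interval])
    fix g :: "real \<Rightarrow> real"
    assume "uniformly_continuous_on {0..1} g" "\<And>s. s \<in> of_rat ` {0..1} \<Longrightarrow> f s = g s"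
    then show thesis by (rule that)
  qed
  define w where "w = (\<lambda>t\<in>{0..T}. g (t / T))"
  have "w \<in> space (path_space T)"
    unfolding w_def
  proof (rule restrict_mem_path_space, rule continuous_on_compose2[of "{0..1}" g])
    show "continuous_on {0..1} g" by (rule uniformly_continuous_imp_continuous[OF g(1)])
  qed (use T in \<open>auto intro!: continuous_intros\<close>)
  moreover have "rational_values T w = x"
  proof
    fix r
    show "rational_values T w r = x r"
    proof (cases "0 \<le> r \<and> r \<le> 1")
      case True
      have "g (of_rat r) = x r"
        using g(2)[of "of_rat r"] True unfolding f by simp
      then show ?thesis
        using True T of_rat_unit_interval[OF T, of r] by (simp add: rational_values_def w_def)
    next
      case False
      have "\<forall>r. \<not> (0 \<le> r \<and> r \<le> 1) \<longrightarrow> x r = 0"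
        using x unfolding rational_path_traces_def mem_Collect_eq by (rule conjunct1)
      then have "x r = 0" using False by blast
      then show ?thesis using False by (auto simp: rational_values_def)
    qed
  qed
  ultimately show ?thesis by blast
qed

definition path_upper_closure :: "real \<Rightarrow> (rat \<Rightarrow> real) set \<Rightarrow> (real \<Rightarrow> real) set" where
  "path_upper_closure T K = {w \<in> space (path_space T). \<exists>k\<in>K. k \<le> rational_values T w}"

text \<open>If paths above elements \<open>k n\<close> of \<open>K\<close> converge uniformly to \<open>w\<close>, then a subsequence of \<open>k\<close>
  converges in \<open>K\<close>, and its limit is below \<open>w\<close> at every coordinate.\<close>

lemma closedin_path_upper_closure:
  assumes T: "T > 0" and K: "compact K"
  shows "closedin (mtopology_of (path_metric T)) (path_upper_closure T K)"
proof -
  interpret P: Metric_space "mspace (path_metric T)" "mdist (path_metric T)"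
    by (rule Metric_space_mspace_mdist)
  have "openin P.mtopology (mspace (path_metric T) - path_upper_closure T K)"
    unfolding P.openin_mtopology
  proof (intro conjI allI impI)
    fix w assume w: "w \<in> mspace (path_metric T) - path_upper_closure T K"
    then have w_space: "w \<in> space (path_space T)" by (simp add: path_space_def)
    show "\<exists>r>0. P.mball w r \<subseteq> mspace (path_metric T) - path_upper_closure T K"
    proof (rule ccontr)
      assume neg: "\<not> ?thesis"
      have not_sub: "\<not> P.mball w (inverse (real (Suc n))) \<subseteq> mspace (path_metric T) - path_upper_closure T K" for n
      proof
        assume "P.mball w (inverse (real (Suc n))) \<subseteq> mspace (path_metric T) - path_upper_closure T K"
        then have "\<exists>r>0. P.mball w r \<subseteq> mspace (path_metric T) - path_upper_closure T K"
          by (intro exI[of _ "inverse (real (Suc n))"] conjI) simp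
        with neg show False by contradiction
      qed
      have "\<exists>c. c \<in> path_upper_closure T K \<and> mdist (path_metric T) w c < inverse (real (Suc n))" for n
      proof -
        obtain c where "c \<in> P.mball w (inverse (real (Suc n)))" "c \<in> path_upper_closure T K"
          using not_sub[of n] P.mball_subset_mspace by blast
        then show ?thesis unfolding P.in_mball by blast
      qed
      then obtain c where c: "\<And>n. c n \<in> path_upper_closure T K"
          "\<And>n. mdist (path_metric T) w (c n) < inverse (real (Suc n))"
        by metis
      then have "\<forall>n. \<exists>k\<in>K. k \<le> rational_values T (c n)"
        by (auto simp: path_upper_closure_def)
      then obtain k where k: "\<And>n. k n \<in> K" "\<And>n. k n \<le> rational_values T (c n)" by metis
      obtain l s where l: "l \<in> K" "strict_mono s" "(k \<circ> s) \<longlonglongrightarrow> l"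
        using seq_compactE[OF K[unfolded compact_eq_seq_compact_metric], of k] k(1) by blast
      have l_le: "l \<le> rational_values T w"
      proof (rule le_funI)
        fix r
        have lim_k: "((\<lambda>n. (k \<circ> s) n r) \<longlonglongrightarrow> l r)"
          using continuous_on_tendsto_compose[OF continuous_on_product_coordinates[of r] l(3)] by simp
        have lim_w: "(\<lambda>n. rational_values T w r + inverse (real (Suc (s n)))) \<longlonglongrightarrow> rational_values T w r + 0"
          using LIMSEQ_subseq_LIMSEQ[OF LIMSEQ_inverse_real_of_nat l(2)]
          by (intro tendsto_intros) (simp add: comp_def)
        have le: "(k \<circ> s) n r \<le> rational_values T w r + inverse (real (Suc (s n)))" for n
        proof -
          have cs: "c (s n) \<in> space (path_space T)" using c(1) by (simp add: path_upper_closure_def)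
          have "(k \<circ> s) n r \<le> rational_values T (c (s n)) r" using k(2)[of "s n"] by (simp add: le_fun_def)
          also have "\<dots> \<le> rational_values T w r + inverse (real (Suc (s n)))"
            using c(2)[of "s n"] abs_diff_le_mdist_path_metric[OF w_space cs of_rat_unit_interval[OF T, of r]]
            by (auto simp: rational_values_def)
          finally show ?thesis .
        qed
        show "l r \<le> rational_values T w r"
          using LIMSEQ_le[OF lim_k lim_w] le by simp
      qed
      have "w \<in> path_upper_closure T K"
        unfolding path_upper_closure_def using w_space l(1) l_le by blast
      then show False using w by simp
    qed
  qed (rule Diff_subset)
  moreover have "path_upper_closure T K \<subseteq> mspace (path_metric T)"
    by (auto simp: path_upper_closure_def path_space_def)
  ultimately show ?thesis
    by (simp add: closedin_def mtopology_of_def)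
qed

text \<open>\<open>C\<close> is the upper closure of a compact set that fills \<open>U\<close> up to \<open>e\<close>. The compact set is found in
  \<open>rat \<Rightarrow> real\<close>, inside the traces of paths in \<open>U\<close>, and its upper closure stays inside \<open>U\<close>
  because \<open>U\<close> is an upper set. Compactness refers to the product topology, which is enough for the
  upper closure to be closed.\<close>

lemma upper_set_inner_approximation:
  assumes T: "T > 0" and P: "prob_space P" and sets_P: "sets P = sets (path_space T)"
    and U: "U \<in> sets (path_space T)"
    and upper: "path_upper T U"
    and e: "e > 0"
  obtains C where "closedin (mtopology_of (path_metric T)) C" "C \<subseteq> U" "measure P U - e \<le> measure P C"
    "path_upper T C"
proof -
  interpret prob_space P by fact
  have space_P: "space P = space (path_space T)" using sets_P by (rule sets_eq_imp_space_eq)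
  obtain U' where U': "U' \<in> sets borel" "U = rational_values T -` U' \<inter> space (path_space T)"
    using path_space_eq_vimage_rational_values[OF T U] .
  define \<nu> where "\<nu> = distr P borel (rational_values T)"
  have rv [measurable]: "rational_values T \<in> P \<rightarrow>\<^sub>M borel"
    using measurable_rational_values[OF T] sets_P by (simp cong: measurable_cong_sets)
  interpret \<nu>: prob_space \<nu> unfolding \<nu>_def by (rule prob_space_distr) simp
  have B: "U' \<inter> rational_path_traces \<in> sets borel"
    using U'(1) rational_path_traces_borel by simp
  have \<nu>_meas: "measure \<nu> A = measure P (rational_values T -` A \<inter> space (path_space T))" if "A \<in> sets borel" for A
    unfolding \<nu>_def using that by (simp add: measure_distr space_P)
  have "rational_values T -` (U' \<inter> rational_path_traces) \<inter> space (path_space T) = U"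
    using U'(2) rational_values_mem_traces[OF T] by auto
  then have \<nu>_B: "measure \<nu> (U' \<inter> rational_path_traces) = measure P U"
    using \<nu>_meas[OF B] by simp
  have "\<exists>K. K \<subseteq> U' \<inter> rational_path_traces \<and> compact K
      \<and> measure \<nu> (U' \<inter> rational_path_traces) - e \<le> measure \<nu> K"
  proof (rule ccontr)
    assume neg: "\<not> ?thesis"
    have *: "measure \<nu> K \<le> measure \<nu> (U' \<inter> rational_path_traces) - e"
      if "K \<subseteq> U' \<inter> rational_path_traces" "compact K" for K
    proof (rule ccontr)
      assume "\<not> ?thesis"
      then have "measure \<nu> (U' \<inter> rational_path_traces) - e \<le> measure \<nu> K" by simp
      with neg that show False by blast
    qed
    have "emeasure \<nu> (U' \<inter> rational_path_traces)
        = (SUP K \<in> {K. K \<subseteq> U' \<inter> rational_path_traces \<and> compact K}. emeasure \<nu> K)"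
    proof (rule inner_regular)
      show "sets \<nu> = sets borel" by (simp add: \<nu>_def)
      show "emeasure \<nu> (space \<nu>) \<noteq> \<infinity>" by (simp add: \<nu>.emeasure_space_1)
    qed (rule B)
    also have "\<dots> \<le> ennreal (measure \<nu> (U' \<inter> rational_path_traces) - e)"
    proof (rule SUP_least)
      fix K assume "K \<in> {K. K \<subseteq> U' \<inter> rational_path_traces \<and> compact K}"
      then show "emeasure \<nu> K \<le> ennreal (measure \<nu> (U' \<inter> rational_path_traces) - e)"
        using *[of K] by (simp add: \<nu>.emeasure_eq_measure ennreal_leI)
    qed
    finally have "measure \<nu> (U' \<inter> rational_path_traces) \<le> measure \<nu> (U' \<inter> rational_path_traces) - e"
      using *[of "{}"] by (simp add: \<nu>.emeasure_eq_measure)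
    then show False using e by simp
  qed
  then obtain K where K: "K \<subseteq> U' \<inter> rational_path_traces" "compact K"
      "measure \<nu> (U' \<inter> rational_path_traces) - e \<le> measure \<nu> K"
    by blast
  define C where "C = path_upper_closure T K"
  show ?thesis
  proof (rule that)
    show closed: "closedin (mtopology_of (path_metric T)) C"
      unfolding C_def by (rule closedin_path_upper_closure[OF T K(2)])
    show "C \<subseteq> U"
    proof
      fix w assume "w \<in> C"
      then obtain k where k: "k \<in> K" "k \<le> rational_values T w" and w: "w \<in> space (path_space T)"
        by (auto simp: C_def path_upper_closure_def)
      obtain u where u: "u \<in> space (path_space T)" "rational_values T u = k"
        using rational_path_traces_extend[OF T, of k] K(1) k(1) by blast
      then have "u \<in> U" using U'(2) K(1) k(1) by auto
      moreover have "path_le T u w" using path_le_iff_rational_values[OF T u(1) w] u(2) k(2) by simp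
      ultimately show "w \<in> U" using path_upperD[OF upper _ w] by blast
    qed
    have "measure P U - e \<le> measure \<nu> K" using K(3) by (simp add: \<nu>_B)
    also have "\<dots> = measure P (rational_values T -` K \<inter> space (path_space T))"
      using K(2) by (intro \<nu>_meas borel_compact)
    also have "\<dots> \<le> measure P C"
    proof (rule finite_measure_mono)
      show "C \<in> sets P" using sets_path_space_closedin[OF closed] sets_P by simp
    qed (auto simp: C_def path_upper_closure_def)
    finally show "measure P U - e \<le> measure P C" .
    show "path_upper T C"
      unfolding path_upper_def
    proof (intro ballI impI)
      fix c v assume cv: "c \<in> C" "v \<in> space (path_space T)" "path_le T c v"
      obtain k where k: "k \<in> K" "k \<le> rational_values T c" and "c \<in> space (path_space T)"
        using cv(1) by (auto simp: C_def path_upper_closure_def)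
      then have "rational_values T c \<le> rational_values T v"
        using path_le_iff_rational_values[OF T, of c v] cv(2,3) by simp
      with k(2) have "k \<le> rational_values T v" by (rule order_trans)
      then show "v \<in> C" using k(1) cv(2) by (auto simp: C_def path_upper_closure_def)
    qed
  qed
qed

section \<open>From Lipschitz functions to square integrable functions\<close>

definition test_associated :: "real \<Rightarrow> (real \<Rightarrow> real) measure \<Rightarrow> bool" where
  "test_associated T P \<longleftrightarrow> (\<forall>f g. increasing_test T f \<longrightarrow> increasing_test T g \<longrightarrow>
     (\<integral>w. f w \<partial>P) * (\<integral>w. g w \<partial>P) \<le> (\<integral>w. f w * g w \<partial>P))"

text \<open>The test functions \<open>infdist_bump\<close> of the two sets converge to their indicators.\<close>

lemma closed_upper_sets_correlated:
  assumes P: "prob_space P" and sets_P: "sets P = sets (path_space T)"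
    and test: "test_associated T P"
    and C: "closedin (mtopology_of (path_metric T)) C" "path_upper T C"
    and D: "closedin (mtopology_of (path_metric T)) D" "path_upper T D"
  shows "measure P C * measure P D \<le> measure P (C \<inter> D)"
proof -
  interpret prob_space P by fact
  have space_P: "space P = space (path_space T)" using sets_P by (rule sets_eq_imp_space_eq)
  have sub: "C \<subseteq> space (path_space T)" "D \<subseteq> space (path_space T)"
    using closedin_subset[OF C(1)] closedin_subset[OF D(1)] by (simp_all add: path_space_def)
  have [measurable]: "C \<in> sets P" "D \<in> sets P"
    using C(1) D(1) sets_path_space_closedin sets_P by simp_all
  have tests: "increasing_test T (infdist_bump T C j)" "increasing_test T (infdist_bump T D j)" for j
    using increasing_test_infdist_bump[OF sub(1) C(2)] increasing_test_infdist_bump[OF sub(2) D(2)] by blast+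
  have meas [measurable]: "infdist_bump T C j \<in> borel_measurable P" "infdist_bump T D j \<in> borel_measurable P" for j
    using tests[THEN increasing_test_measurable] sets_P by (simp_all cong: measurable_cong_sets)
  have bounds: "\<bar>infdist_bump T C j w\<bar> \<le> 1" "\<bar>infdist_bump T D j w\<bar> \<le> 1" if "w \<in> space P" for j w
    using tests[of j] that by (auto simp: increasing_test_def space_P abs_le_iff intro: order_trans[of _ 0])
  have lim: "(\<lambda>j. infdist_bump T C j w) \<longlonglongrightarrow> indicator C w" "(\<lambda>j. infdist_bump T D j w) \<longlonglongrightarrow> indicator D w"
    if "w \<in> space P" for w
    using infdist_bump_tendsto[OF C(1)] infdist_bump_tendsto[OF D(1)] that by (simp_all add: space_P)
  have "(\<lambda>j. \<integral>w. infdist_bump T C j w \<partial>P) \<longlonglongrightarrow> (\<integral>w. indicator C w \<partial>P)"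
    by (rule integral_dominated_convergence[where w = "\<lambda>_. 1"]) (use bounds lim in auto)
  moreover have "(\<lambda>j. \<integral>w. infdist_bump T D j w \<partial>P) \<longlonglongrightarrow> (\<integral>w. indicator D w \<partial>P)"
    by (rule integral_dominated_convergence[where w = "\<lambda>_. 1"]) (use bounds lim in auto)
  ultimately have lim_prod: "(\<lambda>j. (\<integral>w. infdist_bump T C j w \<partial>P) * (\<integral>w. infdist_bump T D j w \<partial>P))
      \<longlonglongrightarrow> measure P C * measure P D"
    by (intro tendsto_mult) simp_all
  have "(\<lambda>j. \<integral>w. infdist_bump T C j w * infdist_bump T D j w \<partial>P) \<longlonglongrightarrow> (\<integral>w. indicator C w * indicator D w \<partial>P)"
  proof (rule integral_dominated_convergence[where w = "\<lambda>_. 1"])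
    show "AE w in P. (\<lambda>j. infdist_bump T C j w * infdist_bump T D j w) \<longlonglongrightarrow> indicator C w * indicator D w"
      by (intro AE_I2 tendsto_mult lim)
    show "AE w in P. norm (infdist_bump T C j w * infdist_bump T D j w) \<le> 1" for j
      using mult_mono[OF bounds] by (intro AE_I2) (simp add: abs_mult)
  qed simp_all
  moreover have "(\<integral>w. indicator C w * indicator D w \<partial>P) = measure P (C \<inter> D)"
    by (simp flip: indicator_inter_arith)
  ultimately have lim_int: "(\<lambda>j. \<integral>w. infdist_bump T C j w * infdist_bump T D j w \<partial>P) \<longlonglongrightarrow> measure P (C \<inter> D)"
    by simp
  show ?thesis
    using LIMSEQ_le[OF lim_prod lim_int] tests test by (simp add: test_associated_def)
qed

lemma upper_sets_correlated:
  assumes T: "T > 0" and P: "prob_space P" and sets_P: "sets P = sets (path_space T)"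
    and test: "test_associated T P"
    and U: "U \<in> sets (path_space T)" "path_upper T U"
    and V: "V \<in> sets (path_space T)" "path_upper T V"
  shows "measure P U * measure P V \<le> measure P (U \<inter> V)"
proof (rule field_le_epsilon)
  interpret prob_space P by fact
  fix \<delta> :: real assume "\<delta> > 0"
  \<comment> \<open>The error of the product is at most \<open>2 * e + e\<^sup>2 \<le> 3 * e\<close>.\<close>
  define e where "e = min 1 (\<delta> / 3)"
  have e: "e > 0" "e \<le> 1" "3 * e \<le> \<delta>" using \<open>\<delta> > 0\<close> by (auto simp: e_def)
  obtain C where C: "closedin (mtopology_of (path_metric T)) C" "C \<subseteq> U" "measure P U - e \<le> measure P C" "path_upper T C"
    using upper_set_inner_approximation[OF T P sets_P U e(1)] by blast
  obtain D where D: "closedin (mtopology_of (path_metric T)) D" "D \<subseteq> V" "measure P V - e \<le> measure P D" "path_upper T D"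
    using upper_set_inner_approximation[OF T P sets_P V e(1)] by blast
  have "measure P U * measure P V \<le> (measure P C + e) * (measure P D + e)"
    using C(3) D(3) e by (intro mult_mono) auto
  also have "\<dots> = measure P C * measure P D + (e * measure P C + e * measure P D + e * e)"
    by (simp add: algebra_simps)
  also have "\<dots> \<le> measure P (C \<inter> D) + (e * 1 + e * 1 + e * 1)"
    using e by (intro add_mono mult_left_mono closed_upper_sets_correlated[OF P sets_P test C(1,4) D(1,4)]) auto
  also have "\<dots> \<le> measure P (U \<inter> V) + \<delta>"
    using e C(2) D(2) U(1) V(1) sets_P by (intro add_mono finite_measure_mono) auto
  finally show "measure P U * measure P V \<le> measure P (U \<inter> V) + \<delta>" .
qed

text \<open>The layer cake formula \<open>f w = \<integral> 1{s < f w} ds\<close> over \<open>s \<ge> 0\<close>, with a weight \<open>h\<close>, by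
  Tonelli's theorem.\<close>

lemma (in sigma_finite_measure) nn_integral_layers:
  fixes f :: "'a \<Rightarrow> real" and h :: "'a \<Rightarrow> ennreal"
  assumes [measurable]: "f \<in> borel_measurable M" "h \<in> borel_measurable M"
    and nonneg: "\<And>w. w \<in> space M \<Longrightarrow> 0 \<le> f w"
  shows "(\<integral>\<^sup>+w. ennreal (f w) * h w \<partial>M)
    = (\<integral>\<^sup>+s. (\<integral>\<^sup>+w. indicator {w \<in> space M. s < f w} w * h w \<partial>M) * indicator {0..} s \<partial>lborel)"
proof -
  interpret pair_sigma_finite M lborel ..
  have "(\<integral>\<^sup>+w. ennreal (f w) * h w \<partial>M) = (\<integral>\<^sup>+w. \<integral>\<^sup>+s. indicator {0..<f w} s * h w \<partial>lborel \<partial>M)"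
    using nonneg by (intro nn_integral_cong) (simp add: nn_integral_multc)
  also have "\<dots> = (\<integral>\<^sup>+w. \<integral>\<^sup>+s. (if 0 \<le> s \<and> s < f w then h w else 0) \<partial>lborel \<partial>M)"
    by (intro nn_integral_cong) (auto simp: indicator_def)
  also have "\<dots> = (\<integral>\<^sup>+s. \<integral>\<^sup>+w. (if 0 \<le> s \<and> s < f w then h w else 0) \<partial>M \<partial>lborel)"
    by (rule Fubini'[symmetric]) measurable
  also have "\<dots> = (\<integral>\<^sup>+s. \<integral>\<^sup>+w. indicator {w \<in> space M. s < f w} w * h w * indicator {0..} s \<partial>M \<partial>lborel)"
    by (intro nn_integral_cong) (auto simp: indicator_def)
  also have "\<dots> = (\<integral>\<^sup>+s. (\<integral>\<^sup>+w. indicator {w \<in> space M. s < f w} w * h w \<partial>M) * indicator {0..} s \<partial>lborel)"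
    by (intro nn_integral_cong) (simp add: nn_integral_multc)
  finally show ?thesis .
qed

text \<open>The layers \<open>{f > s}\<close> and \<open>{g > t}\<close> are upper sets, hence positively correlated. Integrating over
  \<open>t\<close> and then over \<open>s\<close> gives the claim for \<open>f\<close> and \<open>g\<close>.\<close>

lemma nn_integral_increasing_correlated:
  assumes T: "T > 0" and P: "prob_space P" and sets_P: "sets P = sets (path_space T)"
    and test: "test_associated T P"
    and f: "f \<in> borel_measurable P" "increasing_on_space (path_space T) (path_le T) f" "\<And>w. w \<in> space P \<Longrightarrow> 0 \<le> f w"
    and g: "g \<in> borel_measurable P" "increasing_on_space (path_space T) (path_le T) g" "\<And>w. w \<in> space P \<Longrightarrow> 0 \<le> g w"
  shows "(\<integral>\<^sup>+w. ennreal (f w) \<partial>P) * (\<integral>\<^sup>+w. ennreal (g w) \<partial>P) \<le> (\<integral>\<^sup>+w. ennreal (f w) * ennreal (g w) \<partial>P)"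
proof -
  interpret prob_space P by fact
  have space_P: "space P = space (path_space T)" using sets_P by (rule sets_eq_imp_space_eq)
  note [measurable] = f(1) g(1)
  have upper: "{w \<in> space P. s < h w} \<in> sets (path_space T)"
      "path_upper T {w \<in> space P. s < h w}"
    if [measurable]: "h \<in> borel_measurable P" and "increasing_on_space (path_space T) (path_le T) h" for h and s :: real
  proof -
    have "{w \<in> space P. s < h w} \<in> sets P" by measurable
    then show "{w \<in> space P. s < h w} \<in> sets (path_space T)" using sets_P by simp
    show "path_upper T {w \<in> space P. s < h w}"
      using \<open>increasing_on_space _ _ h\<close>
      by (auto simp: path_upper_def increasing_on_space_def space_P intro: less_le_trans)
  qed
  have sets_le: "emeasure P {w \<in> space P. s < f w} * emeasure P {w \<in> space P. t < g w}
      \<le> emeasure P ({w \<in> space P. s < f w} \<inter> {w \<in> space P. t < g w})" for s t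
    unfolding emeasure_eq_measure
    using upper_sets_correlated[OF T P sets_P test upper[OF f(1,2)] upper[OF g(1,2)]]
    by (simp flip: ennreal_mult)
  have one: "(\<integral>\<^sup>+w. ennreal (h w) \<partial>P) = (\<integral>\<^sup>+s. emeasure P {w \<in> space P. s < h w} * indicator {0..} s \<partial>lborel)"
    if [measurable]: "h \<in> borel_measurable P" and "\<And>w. w \<in> space P \<Longrightarrow> 0 \<le> h w" for h
    using nn_integral_layers[of h "\<lambda>_. 1"] that by simp
  have step: "emeasure P {w \<in> space P. s < f w} * (\<integral>\<^sup>+w. ennreal (g w) \<partial>P)
      \<le> (\<integral>\<^sup>+w. indicator {w \<in> space P. s < f w} w * ennreal (g w) \<partial>P)" for s
  proof -
    have meas_t: "(\<lambda>t. emeasure P {w \<in> space P. t < g w}) \<in> borel_measurable lborel"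
      by measurable
    have "emeasure P {w \<in> space P. s < f w} * (\<integral>\<^sup>+w. ennreal (g w) \<partial>P)
      = (\<integral>\<^sup>+t. emeasure P {w \<in> space P. s < f w} * emeasure P {w \<in> space P. t < g w} * indicator {0..} t \<partial>lborel)"
      using meas_t by (subst one[OF g(1,3)]) (simp_all add: mult.assoc nn_integral_cmult)
    also have "\<dots> \<le> (\<integral>\<^sup>+t. (\<integral>\<^sup>+w. indicator {w \<in> space P. t < g w} w * indicator {w \<in> space P. s < f w} w \<partial>P) * indicator {0..} t \<partial>lborel)"
      using sets_le[of s] by (intro nn_integral_mono mult_right_mono) (simp_all flip: indicator_inter_arith add: Int_commute)
    also have "\<dots> = (\<integral>\<^sup>+w. indicator {w \<in> space P. s < f w} w * ennreal (g w) \<partial>P)"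
      using g by (subst nn_integral_layers[symmetric]) (auto simp: mult.commute)
    finally show ?thesis .
  qed
  have meas_s: "(\<lambda>t. emeasure P {w \<in> space P. t < f w}) \<in> borel_measurable lborel"
    by measurable
  have "(\<integral>\<^sup>+w. ennreal (f w) \<partial>P) * (\<integral>\<^sup>+w. ennreal (g w) \<partial>P)
    = (\<integral>\<^sup>+s. emeasure P {w \<in> space P. s < f w} * (\<integral>\<^sup>+w. ennreal (g w) \<partial>P) * indicator {0..} s \<partial>lborel)"
  proof -
    have "(\<integral>\<^sup>+w. ennreal (f w) \<partial>P) * G
        = (\<integral>\<^sup>+s. emeasure P {w \<in> space P. s < f w} * indicator {0..} s * G \<partial>lborel)" for G
      using meas_s by (subst one[OF f(1,3)]) (simp_all add: nn_integral_multc)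
    from this[of "\<integral>\<^sup>+w. ennreal (g w) \<partial>P"] show ?thesis by (simp add: mult_ac)
  qed
  also have "\<dots> \<le> (\<integral>\<^sup>+s. (\<integral>\<^sup>+w. indicator {w \<in> space P. s < f w} w * ennreal (g w) \<partial>P) * indicator {0..} s \<partial>lborel)"
    by (intro nn_integral_mono mult_right_mono step) simp
  also have "\<dots> = (\<integral>\<^sup>+w. ennreal (f w) * ennreal (g w) \<partial>P)"
    using f by (subst nn_integral_layers[symmetric]) auto
  finally show ?thesis .
qed

text \<open>The claim is invariant under adding constants, so it holds for functions bounded below; truncating
  from below at \<open>- n\<close> keeps functions increasing and is dominated.\<close>

lemma increasing_square_integrable_correlated:
  assumes T: "T > 0" and P: "prob_space P" and sets_P: "sets P = sets (path_space T)"
    and test: "test_associated T P"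
    and f: "square_integrable P f" "increasing_on_space (path_space T) (path_le T) f"
    and g: "square_integrable P g" "increasing_on_space (path_space T) (path_le T) g"
  shows "(\<integral>w. f w \<partial>P) * (\<integral>w. g w \<partial>P) \<le> (\<integral>w. f w * g w \<partial>P)"
proof -
  interpret prob_space P by fact
  have [measurable]: "f \<in> borel_measurable P" "g \<in> borel_measurable P"
    and sq: "integrable P (\<lambda>w. (f w)\<^sup>2)" "integrable P (\<lambda>w. (g w)\<^sup>2)"
    using f(1) g(1) by (simp_all add: square_integrable_def)
  have int1: "integrable P h" if [measurable]: "h \<in> borel_measurable P" and h2: "integrable P (\<lambda>w. (h w)\<^sup>2)" for h :: "_ \<Rightarrow> real"
    by (rule square_integrable_imp_integrable[OF that])
  have prod_int: "integrable P (\<lambda>w. \<bar>f w\<bar> * \<bar>g w\<bar>)"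
  proof (rule Bochner_Integration.integrable_bound[OF Bochner_Integration.integrable_add[OF sq]])
    show "AE w in P. norm (\<bar>f w\<bar> * \<bar>g w\<bar>) \<le> norm ((f w)\<^sup>2 + (g w)\<^sup>2)"
    proof (rule AE_I2)
      fix w
      have "2 * (\<bar>f w\<bar> * \<bar>g w\<bar>) \<le> (f w)\<^sup>2 + (g w)\<^sup>2"
        using sum_squares_bound[of "\<bar>f w\<bar>" "\<bar>g w\<bar>"] by simp
      moreover have "0 \<le> \<bar>f w\<bar> * \<bar>g w\<bar>" by simp
      ultimately have "\<bar>f w\<bar> * \<bar>g w\<bar> \<le> (f w)\<^sup>2 + (g w)\<^sup>2" by linarith
      then show "norm (\<bar>f w\<bar> * \<bar>g w\<bar>) \<le> norm ((f w)\<^sup>2 + (g w)\<^sup>2)" by simp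
    qed
  qed simp
  define tr where "tr h n w = max (h w) (- real n)" for h :: "(real \<Rightarrow> real) \<Rightarrow> real" and n :: nat and w
  have tr_le: "\<bar>tr h n w\<bar> \<le> \<bar>h w\<bar>" for h n w by (auto simp: tr_def)
  have tr_meas [measurable]: "tr h n \<in> borel_measurable P" if [measurable]: "h \<in> borel_measurable P" for h n
    unfolding tr_def by measurable
  have tr_int: "integrable P (tr f n)" "integrable P (tr g n)" "integrable P (\<lambda>w. tr f n w * tr g n w)" for n
  proof -
    show "integrable P (tr f n)"
      by (rule Bochner_Integration.integrable_bound[OF int1[of f]]) (auto simp: sq tr_le)
    show "integrable P (tr g n)"
      by (rule Bochner_Integration.integrable_bound[OF int1[of g]]) (auto simp: sq tr_le)
    show "integrable P (\<lambda>w. tr f n w * tr g n w)"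
      by (rule Bochner_Integration.integrable_bound[OF prod_int]) (auto simp: abs_mult intro!: mult_mono tr_le)
  qed
  have step: "(\<integral>w. tr f n w \<partial>P) * (\<integral>w. tr g n w \<partial>P) \<le> (\<integral>w. tr f n w * tr g n w \<partial>P)" for n
  proof -
    have inc: "increasing_on_space (path_space T) (path_le T) (\<lambda>w. tr h n w + n)"
      if "increasing_on_space (path_space T) (path_le T) h" for h
      using that by (fastforce simp: increasing_on_space_def tr_def)
    have nonneg: "0 \<le> tr h n w + n" for h w by (simp add: tr_def)
    have int_shift: "integrable P (\<lambda>w. (tr f n w + n) * (tr g n w + n))"
      using tr_int[of n] by (simp add: algebra_simps)
    have "ennreal ((\<integral>w. tr f n w + n \<partial>P) * (\<integral>w. tr g n w + n \<partial>P))
        = (\<integral>\<^sup>+w. ennreal (tr f n w + n) \<partial>P) * (\<integral>\<^sup>+w. ennreal (tr g n w + n) \<partial>P)"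
    proof -
      have "(\<integral>\<^sup>+w. ennreal (tr h n w + n) \<partial>P) = ennreal (\<integral>w. tr h n w + n \<partial>P)"
        "0 \<le> (\<integral>w. tr h n w + n \<partial>P)" if "integrable P (tr h n)" for h
        by (rule nn_integral_eq_integral, use that nonneg in simp, use nonneg in simp)
           (rule Bochner_Integration.integral_nonneg, use nonneg in simp)
      then show ?thesis using tr_int[of n] by (simp only: ennreal_mult)
    qed
    also have "\<dots> \<le> (\<integral>\<^sup>+w. ennreal (tr f n w + n) * ennreal (tr g n w + n) \<partial>P)"
      by (rule nn_integral_increasing_correlated[OF T P sets_P test _ inc[OF f(2)] _ _ inc[OF g(2)]])
         (auto simp: nonneg)
    also have "\<dots> = ennreal (\<integral>w. (tr f n w + n) * (tr g n w + n) \<partial>P)"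
      using int_shift nonneg by (simp add: nn_integral_eq_integral flip: ennreal_mult)
    finally have le: "(\<integral>w. tr f n w + n \<partial>P) * (\<integral>w. tr g n w + n \<partial>P) \<le> (\<integral>w. (tr f n w + n) * (tr g n w + n) \<partial>P)"
      by (subst (asm) ennreal_le_iff) (rule Bochner_Integration.integral_nonneg, simp add: nonneg)
    have prod_eq: "(\<integral>w. (tr f n w + n) * (tr g n w + n) \<partial>P)
        = (\<integral>w. tr f n w * tr g n w \<partial>P) + n * (\<integral>w. tr f n w \<partial>P) + n * (\<integral>w. tr g n w \<partial>P) + n * n"
    proof -
      have "(\<lambda>w. (tr f n w + n) * (tr g n w + n)) = (\<lambda>w. tr f n w * tr g n w + n * tr f n w + n * tr g n w + n * n)"
        by (simp add: algebra_simps)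
      then show ?thesis using tr_int[of n] by (simp add: prob_space)
    qed
    have shift: "(\<integral>w. tr h n w + n \<partial>P) = (\<integral>w. tr h n w \<partial>P) + n" if "integrable P (tr h n)" for h
      using that by (simp add: prob_space)
    show ?thesis
      using le unfolding prod_eq shift[OF tr_int(1)] shift[OF tr_int(2)] by (simp add: algebra_simps)
  qed
  have tr_lim: "(\<lambda>n. tr h n w) \<longlonglongrightarrow> h w" for h w
  proof (rule tendsto_eventually)
    obtain N :: nat where "- h w \<le> real N" using real_arch_simple by blast
    then show "eventually (\<lambda>n. tr h n w = h w) sequentially"
      by (intro eventually_sequentiallyI[of N]) (auto simp: tr_def max_def)
  qed
  have "(\<lambda>n. \<integral>w. tr f n w \<partial>P) \<longlonglongrightarrow> (\<integral>w. f w \<partial>P)"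
    by (rule integral_dominated_convergence[where w = "\<lambda>w. \<bar>f w\<bar>"]) (use int1[of f] sq tr_lim tr_le in auto)
  moreover have "(\<lambda>n. \<integral>w. tr g n w \<partial>P) \<longlonglongrightarrow> (\<integral>w. g w \<partial>P)"
    by (rule integral_dominated_convergence[where w = "\<lambda>w. \<bar>g w\<bar>"]) (use int1[of g] sq tr_lim tr_le in auto)
  ultimately have lim1: "(\<lambda>n. (\<integral>w. tr f n w \<partial>P) * (\<integral>w. tr g n w \<partial>P)) \<longlonglongrightarrow> (\<integral>w. f w \<partial>P) * (\<integral>w. g w \<partial>P)"
    by (rule tendsto_mult)
  have lim2: "(\<lambda>n. \<integral>w. tr f n w * tr g n w \<partial>P) \<longlonglongrightarrow> (\<integral>w. f w * g w \<partial>P)"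
  proof (rule integral_dominated_convergence[where w = "\<lambda>w. \<bar>f w\<bar> * \<bar>g w\<bar>"])
    show "AE w in P. (\<lambda>n. tr f n w * tr g n w) \<longlonglongrightarrow> f w * g w" by (intro AE_I2 tendsto_mult tr_lim)
    show "AE w in P. norm (tr f n w * tr g n w) \<le> \<bar>f w\<bar> * \<bar>g w\<bar>" for n
      by (intro AE_I2) (auto simp: abs_mult intro!: mult_mono tr_le)
  qed (simp_all add: prod_int)
  show ?thesis using LIMSEQ_le[OF lim1 lim2] step by blast
qed

section \<open>Conditioning to stay between two functions\<close>

lemma measurable_grid_values:
  assumes "T > 0" "N > 0"
  shows "grid_values T N \<in> path_space T \<rightarrow>\<^sub>M borel"
proof (rule measurable_coordinatewise_then_product)
  show "(\<lambda>w. grid_values T N w i) \<in> borel_measurable (path_space T)" for i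
    using measurable_path_eval[OF grid_time_mem[OF assms, of i]] by (cases "i \<le> N") (simp_all add: grid_values_def)
qed

definition grid_four_functions :: "real \<Rightarrow> (real \<Rightarrow> real) measure \<Rightarrow> bool" where
  "grid_four_functions T P \<longleftrightarrow> (\<forall>N>0. four_functions P (grid_values T N))"

lemma grid_four_functions_wiener: "T > 0 \<Longrightarrow> wiener_measure T W \<Longrightarrow> grid_four_functions T W"
  by (simp add: grid_four_functions_def wiener_four_functions)

lemma grid_four_functions_bridge:
  assumes T: "T > 0" and W: "wiener_measure T W"
  shows "grid_four_functions T (brownian_bridge_law T W x)"
  unfolding grid_four_functions_def four_functions_def
proof (intro allI impI)
  fix N :: nat and f1 f2 f3 f4 :: "(nat \<Rightarrow> real) \<Rightarrow> ennreal"
  assume N: "N > 0"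
    and meas: "f1 \<in> borel_measurable borel" "f2 \<in> borel_measurable borel"
    "f3 \<in> borel_measurable borel" "f4 \<in> borel_measurable borel"
    and le: "\<forall>x y. f1 x * f2 y \<le> f3 (sup x y) * f4 (inf x y)"
  have "sets W = sets (path_space T)" using W by (simp add: wiener_measure_def)
  then have bp: "bridge_path T x \<in> W \<rightarrow>\<^sub>M path_space T"
    using measurable_bridge_path[OF T] measurable_cong_sets by blast
  have eq: "(\<integral>\<^sup>+w. f (grid_values T N w) \<partial>brownian_bridge_law T W x)
      = (\<integral>\<^sup>+w. f (grid_values T N (bridge_path T x w)) \<partial>W)" if "f \<in> borel_measurable borel" for f :: "(nat \<Rightarrow> real) \<Rightarrow> ennreal"
    unfolding brownian_bridge_law_def
    by (rule nn_integral_distr[OF bp]) (use measurable_compose[OF measurable_grid_values[OF T N] that] in simp)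
  show "(\<integral>\<^sup>+w. f1 (grid_values T N w) \<partial>brownian_bridge_law T W x) * (\<integral>\<^sup>+w. f2 (grid_values T N w) \<partial>brownian_bridge_law T W x)
     \<le> (\<integral>\<^sup>+w. f3 (grid_values T N w) \<partial>brownian_bridge_law T W x) * (\<integral>\<^sup>+w. f4 (grid_values T N w) \<partial>brownian_bridge_law T W x)"
    unfolding eq[OF meas(1)] eq[OF meas(2)] eq[OF meas(3)] eq[OF meas(4)]
    using four_functionsD[OF bridge_four_functions[OF T W N, of x] meas] le by simp
qed

lemma grid_eventually_meets_interval:
  assumes T: "T > 0" and td: "0 \<le> t" "t < d" "d \<le> T"
  shows "eventually (\<lambda>N. \<exists>i\<le>N. t < grid_time T N i \<and> grid_time T N i < d) sequentially"
proof -
  obtain N0 :: nat where N0: "T / (d - t) < real N0" using reals_Archimedean2 by blast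
  show ?thesis
  proof (rule eventually_sequentiallyI[of N0])
    fix N assume "N0 \<le> N"
    then have N: "T / (d - t) < real N" using N0 by linarith
    moreover have "T / (d - t) > 0" using T td by simp
    ultimately have "N > 0" by (metis less_trans of_nat_0_less_iff)
    have TN: "T / real N < d - t" using N td \<open>N > 0\<close> by (simp add: field_simps)
    \<comment> \<open>The first grid point strictly after \<open>t\<close>.\<close>
    define i where "i = Suc (nat \<lfloor>t * real N / T\<rfloor>)"
    have i1: "t * real N / T < real i" and i2: "real i \<le> t * real N / T + 1"
      using T td by (auto simp: i_def) linarith+
    have gt: "t < grid_time T N i" using i1 T \<open>N > 0\<close> by (simp add: grid_time_def field_simps)
    have "grid_time T N i \<le> (t * real N / T + 1) * T / real N"
      unfolding grid_time_def using i2 T \<open>N > 0\<close> by (intro divide_right_mono mult_right_mono) auto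
    also have "\<dots> = t + T / real N" using T \<open>N > 0\<close> by (simp add: field_simps)
    also have "\<dots> < d" using TN by simp
    finally have lt: "grid_time T N i < d" .
    then have "real i * T / real N < T" using td by (simp add: grid_time_def)
    then have "i \<le> N" using T \<open>N > 0\<close> by (simp add: field_simps)
    then show "\<exists>i\<le>N. t < grid_time T N i \<and> grid_time T N i < d" using gt lt by blast
  qed
qed

text \<open>For \<open>t < T\<close> the strict inequality persists on an interval to the right of \<open>t\<close>, which a fine grid
  meets. The time \<open>T\<close>, where nothing is known about the right, belongs to every grid.\<close>

lemma grid_eventually_detects:
  fixes c d :: "real \<Rightarrow> ereal"
  assumes T: "T > 0" and t: "t \<in> {0..T}" and less: "c t < d t"
    and right: "t < T \<Longrightarrow> (c \<longlongrightarrow> c t) (at_right t)" "t < T \<Longrightarrow> (d \<longlongrightarrow> d t) (at_right t)"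
  shows "eventually (\<lambda>N. \<exists>i\<le>N. c (grid_time T N i) < d (grid_time T N i)) sequentially"
proof (cases "t = T")
  case True
  show ?thesis
  proof (rule eventually_sequentiallyI[of 1])
    fix N :: nat assume "1 \<le> N"
    then show "\<exists>i\<le>N. c (grid_time T N i) < d (grid_time T N i)"
      using less True by (intro exI[of _ N]) (simp add: grid_time_last)
  qed
next
  case False
  then have "t < T" using t by simp
  obtain z where z: "c t < z" "z < d t" using dense[OF less] by blast
  have "eventually (\<lambda>s. c s < z) (at_right t)" "eventually (\<lambda>s. z < d s) (at_right t)"
    using order_tendstoD[OF right(1)[OF \<open>t < T\<close>]] order_tendstoD[OF right(2)[OF \<open>t < T\<close>]] z by auto
  then have "eventually (\<lambda>s. c s < d s) (at_right t)"
    by eventually_elim (rule less_trans)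
  then obtain e where e: "e > t" "\<And>s. t < s \<Longrightarrow> s < e \<Longrightarrow> c s < d s"
    unfolding eventually_at_right_field by blast
  have "eventually (\<lambda>N. \<exists>i\<le>N. t < grid_time T N i \<and> grid_time T N i < min e T) sequentially"
    using t e(1) \<open>t < T\<close> by (intro grid_eventually_meets_interval[OF T]) auto
  then show ?thesis
    by eventually_elim (use e(2) in fastforce)
qed

definition grid_box :: "real \<Rightarrow> (real \<Rightarrow> ereal) \<Rightarrow> (real \<Rightarrow> ereal) \<Rightarrow> nat \<Rightarrow> (nat \<Rightarrow> real) set" where
  "grid_box T a b N = {x. \<forall>i\<le>N. a (grid_time T N i) \<le> ereal (x i) \<and> ereal (x i) \<le> b (grid_time T N i)}"

lemma grid_box_borel: "grid_box T a b N \<in> sets borel"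
proof -
  have "{x :: nat \<Rightarrow> real. x i \<in> ereal -` {a (grid_time T N i)..b (grid_time T N i)}} \<in> sets borel" for i
  proof -
    have "ereal -` {a (grid_time T N i)..b (grid_time T N i)} \<in> sets borel"
      by (intro borel_closed closed_vimage closed_atLeastAtMost continuous_on_ereal continuous_on_id)
    from measurable_sets[OF measurable_seq_coordinate this] show ?thesis
      by (simp add: vimage_def)
  qed
  then have "(\<Inter>i\<in>{..N}. {x :: nat \<Rightarrow> real. x i \<in> ereal -` {a (grid_time T N i)..b (grid_time T N i)}}) \<in> sets borel"
    by (intro sets.finite_INT) auto
  also have "(\<Inter>i\<in>{..N}. {x :: nat \<Rightarrow> real. x i \<in> ereal -` {a (grid_time T N i)..b (grid_time T N i)}}) = grid_box T a b N"
    by (auto simp: grid_box_def)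
  finally show ?thesis .
qed

lemma grid_box_sup_inf:
  assumes "x \<in> grid_box T a b N" "y \<in> grid_box T a b N"
  shows "sup x y \<in> grid_box T a b N" "inf x y \<in> grid_box T a b N"
  using assms by (auto simp: grid_box_def sup_max inf_min max_def min_def)

text \<open>A path between \<open>a\<close> and \<open>b\<close> lies in every box. A path that violates a bound at some time does so
  at a point of every fine grid, by \<open>grid_eventually_detects\<close> and right-continuity.\<close>

lemma indicator_grid_box_tendsto:
  assumes T: "T > 0" and a: "cadlag_on T a" and b: "cadlag_on T b" and w: "w \<in> space (path_space T)"
  shows "(\<lambda>N. indicator (grid_box T a b N) (grid_values T N w) :: real) \<longlonglongrightarrow> indicator (stays_between T a b) w"
proof (rule tendsto_eventually)
  have cont: "((\<lambda>s. ereal (w s)) \<longlongrightarrow> ereal (w t)) (at_right t)" if "t \<in> {0..T}" "t < T" for t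
  proof -
    have "continuous_on {t..T} w"
      using w that by (auto simp: space_path_space intro: continuous_on_subset)
    then have "(w \<longlongrightarrow> w t) (at_right t)" using that by (intro continuous_on_Icc_at_rightD) auto
    then show ?thesis by simp
  qed
  have ra: "(a \<longlongrightarrow> a t) (at_right t)" "(b \<longlongrightarrow> b t) (at_right t)" if "t \<in> {0..T}" "t < T" for t
    using a b that by (auto simp: cadlag_on_def)
  show "eventually (\<lambda>N. indicator (grid_box T a b N) (grid_values T N w) = (indicator (stays_between T a b) w :: real)) sequentially"
  proof (cases "w \<in> stays_between T a b")
    case True
    show ?thesis
    proof (rule eventually_sequentiallyI[of 1])
      fix N :: nat assume "1 \<le> N"
      then have "grid_values T N w \<in> grid_box T a b N"
        using True grid_time_mem[OF T] by (auto simp: grid_box_def grid_values_def stays_between_def)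
      then show "indicator (grid_box T a b N) (grid_values T N w) = (indicator (stays_between T a b) w :: real)"
        using True by simp
    qed
  next
    case False
    then obtain t where t: "t \<in> {0..T}" and "ereal (w t) < a t \<or> b t < ereal (w t)"
      using w by (auto simp: stays_between_def not_le)
    then have "eventually (\<lambda>N. \<exists>i\<le>N. ereal (w (grid_time T N i)) < a (grid_time T N i)
        \<or> b (grid_time T N i) < ereal (w (grid_time T N i))) sequentially"
    proof (elim disjE)
      assume *: "ereal (w t) < a t"
      have "eventually (\<lambda>N. \<exists>i\<le>N. ereal (w (grid_time T N i)) < a (grid_time T N i)) sequentially"
        using grid_eventually_detects[OF T t, of "\<lambda>s. ereal (w s)" a] * cont[OF t] ra(1)[OF t] by blast
      then show ?thesis by eventually_elim blast
    next
      assume *: "b t < ereal (w t)"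
      have "eventually (\<lambda>N. \<exists>i\<le>N. b (grid_time T N i) < ereal (w (grid_time T N i))) sequentially"
        using grid_eventually_detects[OF T t, of b "\<lambda>s. ereal (w s)"] * cont[OF t] ra(2)[OF t] by blast
      then show ?thesis by eventually_elim blast
    qed
    then show ?thesis
    proof eventually_elim
      fix N assume "\<exists>i\<le>N. ereal (w (grid_time T N i)) < a (grid_time T N i)
        \<or> b (grid_time T N i) < ereal (w (grid_time T N i))"
      then have "grid_values T N w \<notin> grid_box T a b N"
        by (auto simp: grid_box_def grid_values_def not_le[symmetric])
      then show "indicator (grid_box T a b N) (grid_values T N w) = (indicator (stays_between T a b) w :: real)"
        using False by simp
    qed
  qed
qed

lemma bernstein_grid_tendsto:
  assumes "T > 0" "increasing_test T f" "w \<in> space (path_space T)"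
  shows "(\<lambda>N. f (bernstein_path T N (grid_values T N w))) \<longlonglongrightarrow> f w"
proof -
  obtain L where "path_Lipschitz T L f" using assms(2) by (auto simp: increasing_test_def)
  from bernstein_path_tendsto[OF assms(1) this assms(3)]
  have "(\<lambda>N. f (bernstein_path T N (\<lambda>k. if k \<le> N then w (T * (real k / real N)) else 0))) \<longlonglongrightarrow> f w" .
  moreover have "(\<lambda>k. if k \<le> N then w (T * (real k / real N)) else 0) = grid_values T N w" for N
    by (auto simp: grid_values_def grid_time_def fun_eq_iff mult.commute)
  ultimately show ?thesis by simp
qed

lemma increasing_testD:
  assumes "increasing_test T f"
  shows "w \<in> space (path_space T) \<Longrightarrow> 0 \<le> f w" "w \<in> space (path_space T) \<Longrightarrow> f w \<le> 1"
    "u \<in> space (path_space T) \<Longrightarrow> v \<in> space (path_space T) \<Longrightarrow> path_le T u v \<Longrightarrow> f u \<le> f v"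
  using assms by (auto simp: increasing_test_def increasing_on_space_def)

lemma bernstein_test_measurable:
  assumes "T > 0" "increasing_test T f"
  shows "(\<lambda>x. f (bernstein_path T N x)) \<in> borel_measurable (borel :: (nat \<Rightarrow> real) measure)"
  using assms bernstein_path_measurable by (auto simp: increasing_test_def)

text \<open>The four functions are \<open>F * I\<close>, \<open>G * I\<close>, \<open>F * G * I\<close> and \<open>I\<close>, read as functions of the grid
  values. Their hypothesis holds because the box is a sublattice and \<open>F\<close>, \<open>G\<close> are increasing.\<close>

lemma grid_increasing_correlated:
  fixes a b :: "real \<Rightarrow> ereal"
  assumes T: "T > 0" and P: "prob_space P" and sets_P: "sets P = sets (path_space T)"
    and ff: "grid_four_functions T P" and N: "N > 0"
    and f: "increasing_test T f" and g: "increasing_test T g"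
  defines "F \<equiv> \<lambda>w. f (bernstein_path T N (grid_values T N w))"
    and "G \<equiv> \<lambda>w. g (bernstein_path T N (grid_values T N w))"
    and "I \<equiv> \<lambda>w. indicator (grid_box T a b N) (grid_values T N w) :: real"
  shows "(\<integral>w. F w * I w \<partial>P) * (\<integral>w. G w * I w \<partial>P) \<le> (\<integral>w. F w * G w * I w \<partial>P) * (\<integral>w. I w \<partial>P)"
proof -
  interpret prob_space P by fact
  define F' where "F' x = f (bernstein_path T N x)" for x
  define G' where "G' x = g (bernstein_path T N x)" for x
  define I' where "I' x = (indicator (grid_box T a b N) x :: real)" for x
  have meas [measurable]: "F' \<in> borel_measurable borel" "G' \<in> borel_measurable borel" "I' \<in> borel_measurable borel"
    unfolding F'_def G'_def I'_def using grid_box_borel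
    by (auto intro: bernstein_test_measurable[OF T] f g)
  have Z [measurable]: "grid_values T N \<in> P \<rightarrow>\<^sub>M borel"
    using measurable_grid_values[OF T N] sets_P measurable_cong_sets by blast
  have bounds: "0 \<le> F' x" "F' x \<le> 1" "0 \<le> G' x" "G' x \<le> 1" "0 \<le> I' x" "I' x \<le> 1" for x
    unfolding F'_def G'_def I'_def
    using increasing_testD(1,2)[OF f bernstein_path_mem[OF T]] increasing_testD(1,2)[OF g bernstein_path_mem[OF T]]
    by (auto simp: indicator_def)
  have mono: "F' x \<le> F' y" "G' x \<le> G' y" if "x \<le> y" for x y
    using bernstein_path_mono[OF T, of N x y] that
      increasing_testD(3)[OF f bernstein_path_mem[OF T] bernstein_path_mem[OF T]]
      increasing_testD(3)[OF g bernstein_path_mem[OF T] bernstein_path_mem[OF T]]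
    unfolding F'_def G'_def by (auto simp: le_fun_def)
  have pt: "F' x * I' x * (G' y * I' y) \<le> F' (sup x y) * G' (sup x y) * I' (sup x y) * I' (inf x y)" for x y
  proof (cases "x \<in> grid_box T a b N \<and> y \<in> grid_box T a b N")
    case True
    then have "I' x = 1" "I' y = 1" "I' (sup x y) = 1" "I' (inf x y) = 1"
      using grid_box_sup_inf[of x T a b N y] by (auto simp: I'_def)
    then show ?thesis
      using mono[of x "sup x y"] mono[of y "sup x y"] bounds by (auto intro!: mult_mono)
  next
    case False
    then have "I' x * I' y = 0" by (auto simp: I'_def)
    then have "F' x * I' x * (G' y * I' y) = 0" by auto
    moreover have "0 \<le> F' (sup x y) * G' (sup x y) * I' (sup x y) * I' (inf x y)"
      by (intro mult_nonneg_nonneg bounds)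
    ultimately show ?thesis by linarith
  qed
  have main: "(\<integral>\<^sup>+w. ennreal (F' (grid_values T N w) * I' (grid_values T N w)) \<partial>P)
      * (\<integral>\<^sup>+w. ennreal (G' (grid_values T N w) * I' (grid_values T N w)) \<partial>P)
    \<le> (\<integral>\<^sup>+w. ennreal (F' (grid_values T N w) * G' (grid_values T N w) * I' (grid_values T N w)) \<partial>P)
      * (\<integral>\<^sup>+w. ennreal (I' (grid_values T N w)) \<partial>P)"
  proof (rule four_functionsD)
    show "four_functions P (grid_values T N)"
      using ff N by (simp add: grid_four_functions_def)
    show "ennreal (F' x * I' x) * ennreal (G' y * I' y)
      \<le> ennreal (F' (sup x y) * G' (sup x y) * I' (sup x y)) * ennreal (I' (inf x y))" for x y
    proof -
      have "ennreal (F' x * I' x) * ennreal (G' y * I' y) = ennreal (F' x * I' x * (G' y * I' y))"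
        using bounds by (intro ennreal_mult[symmetric]) auto
      also have "\<dots> \<le> ennreal (F' (sup x y) * G' (sup x y) * I' (sup x y) * I' (inf x y))"
        by (rule ennreal_leI[OF pt])
      also have "\<dots> = ennreal (F' (sup x y) * G' (sup x y) * I' (sup x y)) * ennreal (I' (inf x y))"
        using bounds by (intro ennreal_mult) auto
      finally show ?thesis .
    qed
  qed measurable
  have real_int: "(\<integral>\<^sup>+w. ennreal (H (grid_values T N w)) \<partial>P) = ennreal (\<integral>w. H (grid_values T N w) \<partial>P)"
    "0 \<le> (\<integral>w. H (grid_values T N w) \<partial>P)"
    if [measurable]: "H \<in> borel_measurable borel" and "\<And>x. 0 \<le> H x" "\<And>x. H x \<le> 1" for H
  proof -
    have "integrable P (\<lambda>w. H (grid_values T N w))"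
      using that by (intro integrable_const_bound[of _ 1]) auto
    then show "(\<integral>\<^sup>+w. ennreal (H (grid_values T N w)) \<partial>P) = ennreal (\<integral>w. H (grid_values T N w) \<partial>P)"
      using that(2) by (intro nn_integral_eq_integral) auto
    show "0 \<le> (\<integral>w. H (grid_values T N w) \<partial>P)"
      using that(2) by (intro Bochner_Integration.integral_nonneg) auto
  qed
  have b: "0 \<le> F' x * I' x \<and> F' x * I' x \<le> 1" "0 \<le> G' x * I' x \<and> G' x * I' x \<le> 1"
    "0 \<le> F' x * G' x * I' x \<and> F' x * G' x * I' x \<le> 1" for x
    using bounds by (simp_all add: mult_le_one)
  have m: "(\<lambda>x. F' x * I' x) \<in> borel_measurable borel" "(\<lambda>x. G' x * I' x) \<in> borel_measurable borel"
    "(\<lambda>x. F' x * G' x * I' x) \<in> borel_measurable borel"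
    by measurable
  note i1 = real_int[OF m(1) conjunct1[OF b(1)] conjunct2[OF b(1)]]
    and i2 = real_int[OF m(2) conjunct1[OF b(2)] conjunct2[OF b(2)]]
    and i3 = real_int[OF m(3) conjunct1[OF b(3)] conjunct2[OF b(3)]]
    and i4 = real_int[OF meas(3) bounds(5,6)]
  show ?thesis
    using main unfolding i1(1) i2(1) i3(1) i4(1) ennreal_mult[OF i1(2) i2(2), symmetric] ennreal_mult[OF i3(2) i4(2), symmetric]
      ennreal_le_iff[OF mult_nonneg_nonneg[OF i3(2) i4(2)]]
    unfolding F_def G_def I_def F'_def G'_def I'_def .
qed

text \<open>The grid version \<open>grid_increasing_correlated\<close> passes to the limit by dominated convergence. The
  grids have \<open>Suc N\<close> cells, because a grid without cells consists of time \<open>0\<close> only.\<close>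

lemma stays_between_increasing_correlated:
  assumes T: "T > 0" and P: "prob_space P" and sets_P: "sets P = sets (path_space T)"
    and ff: "grid_four_functions T P"
    and a: "cadlag_on T a" and b: "cadlag_on T b"
    and f: "increasing_test T f" and g: "increasing_test T g"
  defines "K \<equiv> stays_between T a b"
  shows "(\<integral>w. f w * indicator K w \<partial>P) * (\<integral>w. g w * indicator K w \<partial>P)
    \<le> (\<integral>w. f w * g w * indicator K w \<partial>P) * measure P K"
proof -
  interpret prob_space P by fact
  have space_P: "space P = space (path_space T)" using sets_P by (rule sets_eq_imp_space_eq)
  have K: "K \<in> sets P" unfolding K_def sets_P by (rule measurable_stays_between)
  define F where "F N w = f (bernstein_path T N (grid_values T N w))" for N w
  define G where "G N w = g (bernstein_path T N (grid_values T N w))" for N w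
  define I where "I N w = (indicator (grid_box T a b N) (grid_values T N w) :: real)" for N w
  have Z [measurable]: "grid_values T (Suc N) \<in> P \<rightarrow>\<^sub>M borel" for N
    using measurable_grid_values[OF T, of "Suc N"] sets_P measurable_cong_sets by blast
  have meas [measurable]: "F (Suc N) \<in> borel_measurable P" "G (Suc N) \<in> borel_measurable P" "I (Suc N) \<in> borel_measurable P" for N
    unfolding F_def G_def I_def
    using measurable_compose[OF Z bernstein_test_measurable[OF T f]]
      measurable_compose[OF Z bernstein_test_measurable[OF T g]]
      measurable_compose[OF Z borel_measurable_indicator[OF grid_box_borel]] by blast+
  have fg_meas [measurable]: "f \<in> borel_measurable P" "g \<in> borel_measurable P"
    using f g increasing_test_measurable sets_P measurable_cong_sets by blast+
  have bounds: "\<bar>F N w\<bar> \<le> 1" "\<bar>G N w\<bar> \<le> 1" "\<bar>I N w\<bar> \<le> 1" for N w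
    unfolding F_def G_def I_def
    using increasing_testD(1,2)[OF f bernstein_path_mem[OF T]] increasing_testD(1,2)[OF g bernstein_path_mem[OF T]]
    by (auto simp: indicator_def)
  have bounds2: "\<bar>F N w * I N w\<bar> \<le> 1" "\<bar>G N w * I N w\<bar> \<le> 1" "\<bar>F N w * G N w * I N w\<bar> \<le> 1" for N w
    using bounds[of N w] by (simp_all add: abs_mult mult_le_one)
  have limF: "(\<lambda>N. F (Suc N) w) \<longlonglongrightarrow> f w" and limG: "(\<lambda>N. G (Suc N) w) \<longlonglongrightarrow> g w"
    and limI: "(\<lambda>N. I (Suc N) w) \<longlonglongrightarrow> indicator K w" if "w \<in> space P" for w
    using that bernstein_grid_tendsto[OF T f] bernstein_grid_tendsto[OF T g]
      indicator_grid_box_tendsto[OF T a b] unfolding F_def G_def I_def K_def space_P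
    by (intro LIMSEQ_Suc; blast)+
  have "(\<lambda>N. \<integral>w. F (Suc N) w * I (Suc N) w \<partial>P) \<longlonglongrightarrow> (\<integral>w. f w * indicator K w \<partial>P)"
    by (rule integral_dominated_convergence[where w = "\<lambda>_. 1"])
       (use K bounds2 in \<open>auto intro!: AE_I2 tendsto_mult limF limI\<close>)
  moreover have "(\<lambda>N. \<integral>w. G (Suc N) w * I (Suc N) w \<partial>P) \<longlonglongrightarrow> (\<integral>w. g w * indicator K w \<partial>P)"
    by (rule integral_dominated_convergence[where w = "\<lambda>_. 1"])
       (use K bounds2 in \<open>auto intro!: AE_I2 tendsto_mult limG limI\<close>)
  ultimately have lim1: "(\<lambda>N. (\<integral>w. F (Suc N) w * I (Suc N) w \<partial>P) * (\<integral>w. G (Suc N) w * I (Suc N) w \<partial>P))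
      \<longlonglongrightarrow> (\<integral>w. f w * indicator K w \<partial>P) * (\<integral>w. g w * indicator K w \<partial>P)"
    by (rule tendsto_mult)
  have "(\<lambda>N. \<integral>w. F (Suc N) w * G (Suc N) w * I (Suc N) w \<partial>P) \<longlonglongrightarrow> (\<integral>w. f w * g w * indicator K w \<partial>P)"
    by (rule integral_dominated_convergence[where w = "\<lambda>_. 1"])
       (use K bounds2 in \<open>auto intro!: AE_I2 tendsto_mult limF limG limI\<close>)
  moreover have "(\<lambda>N. \<integral>w. I (Suc N) w \<partial>P) \<longlonglongrightarrow> (\<integral>w. indicator K w \<partial>P)"
    by (rule integral_dominated_convergence[where w = "\<lambda>_. 1"])
       (use K bounds in \<open>auto intro!: AE_I2 limI\<close>)
  ultimately have lim2: "(\<lambda>N. (\<integral>w. F (Suc N) w * G (Suc N) w * I (Suc N) w \<partial>P) * (\<integral>w. I (Suc N) w \<partial>P))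
      \<longlonglongrightarrow> (\<integral>w. f w * g w * indicator K w \<partial>P) * (\<integral>w. indicator K w \<partial>P)"
    by (rule tendsto_mult)
  have "(\<integral>w. f w * indicator K w \<partial>P) * (\<integral>w. g w * indicator K w \<partial>P)
      \<le> (\<integral>w. f w * g w * indicator K w \<partial>P) * (\<integral>w. indicator K w \<partial>P)"
    using LIMSEQ_le[OF lim1 lim2] grid_increasing_correlated[OF T P sets_P ff _ f g]
    unfolding F_def G_def I_def by blast
  then show ?thesis using K by simp
qed

section \<open>The conditioned Brownian processes\<close>

text \<open>Conditioning on a null event gives the zero measure, because \<open>0 / 0 = 0\<close> in \<open>ennreal\<close>; the
  correlation inequality then reads \<open>0 \<le> 0\<close>.\<close>

lemma integral_uniform_measure_null:
  assumes "K \<in> sets P" "emeasure P K = 0"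
  shows "(\<integral>w. f w \<partial>uniform_measure P K) = (0 :: real)"
proof (rule integral_eq_zero_AE)
  have "emeasure (uniform_measure P K) (space P) = 0"
    using assms sets.sets_into_space[OF assms(1)] by (simp add: emeasure_uniform_measure Int_absorb2)
  then have "AE w in uniform_measure P K. False"
    by (intro AE_I[of _ _ "space P"]) auto
  then show "AE w in uniform_measure P K. f w = 0" by eventually_elim simp
qed

lemma (in finite_measure) integral_uniform_measure_eq:
  fixes f :: "'a \<Rightarrow> real"
  assumes [measurable]: "K \<in> sets M" "f \<in> borel_measurable M" and "measure M K > 0"
  shows "(\<integral>w. f w \<partial>uniform_measure M K) = (\<integral>w. f w * indicator K w \<partial>M) / measure M K"
proof -
  have "uniform_measure M K = density M (\<lambda>w. ennreal (indicator K w / measure M K))"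
    unfolding uniform_measure_def using assms(3)
    by (intro density_cong) (auto simp: emeasure_eq_measure indicator_def divide_ennreal simp flip: ennreal_1)
  then have "(\<integral>w. f w \<partial>uniform_measure M K) = (\<integral>w. (indicator K w / measure M K) *\<^sub>R f w \<partial>M)"
    by (simp add: integral_density)
  then show ?thesis by (simp add: mult.commute)
qed

lemma test_associated_uniform_measure:
  assumes T: "T > 0" and P: "prob_space P" and sets_P: "sets P = sets (path_space T)"
    and ff: "grid_four_functions T P" and a: "cadlag_on T a" and b: "cadlag_on T b"
  shows "test_associated T (uniform_measure P (stays_between T a b))"
  unfolding test_associated_def
proof (intro allI impI)
  fix f g assume f: "increasing_test T f" and g: "increasing_test T g"
  interpret prob_space P by fact
  have K: "stays_between T a b \<in> sets P" unfolding sets_P by (rule measurable_stays_between)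
  have [measurable]: "f \<in> borel_measurable P" "g \<in> borel_measurable P"
    using f g increasing_test_measurable sets_P measurable_cong_sets by blast+
  show "(\<integral>w. f w \<partial>uniform_measure P (stays_between T a b)) * (\<integral>w. g w \<partial>uniform_measure P (stays_between T a b))
    \<le> (\<integral>w. f w * g w \<partial>uniform_measure P (stays_between T a b))"
  proof (cases "measure P (stays_between T a b) > 0")
    case True
    with stays_between_increasing_correlated[OF T P sets_P ff a b f g] show ?thesis
      by (simp add: integral_uniform_measure_eq[OF K] field_simps)
  next
    case False
    then have "emeasure P (stays_between T a b) = 0"
      by (simp add: emeasure_eq_measure not_less measure_le_0_iff)
    then show ?thesis by (simp add: integral_uniform_measure_null[OF K])
  qed
qed

lemma test_associated_weak_limit:
  assumes lim: "weak_limit_of_measures (path_metric T) \<mu> Q F" and F: "F \<noteq> bot"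
    and assoc: "eventually (\<lambda>i. test_associated T (\<mu> i)) F"
  shows "test_associated T Q"
  unfolding test_associated_def
proof (intro allI impI)
  fix f g assume f: "increasing_test T f" and g: "increasing_test T g"
  have conv: "((\<lambda>i. \<integral>u. h u \<partial>\<mu> i) \<longlongrightarrow> (\<integral>u. h u \<partial>Q)) F"
    if "continuous_map (mtopology_of (path_metric T)) euclideanreal h"
      and "\<And>w. w \<in> space (path_space T) \<Longrightarrow> \<bar>h w\<bar> \<le> 1" for h
  proof -
    have "bounded (h ` mspace (path_metric T))"
      using that(2) by (intro boundedI[of _ 1]) (auto simp: path_space_def)
    then show ?thesis using lim that(1) unfolding weak_limit_of_measures_def by blast
  qed
  have cont: "continuous_map (mtopology_of (path_metric T)) euclideanreal f"
    "continuous_map (mtopology_of (path_metric T)) euclideanreal g"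
    using f g path_Lipschitz_continuous_map by (auto simp: increasing_test_def)
  have bounds: "\<bar>f w\<bar> \<le> 1" "\<bar>g w\<bar> \<le> 1" "\<bar>f w * g w\<bar> \<le> 1" if "w \<in> space (path_space T)" for w
    using increasing_testD(1,2)[OF f that] increasing_testD(1,2)[OF g that]
    by (simp_all add: abs_mult mult_le_one)
  show "(\<integral>w. f w \<partial>Q) * (\<integral>w. g w \<partial>Q) \<le> (\<integral>w. f w * g w \<partial>Q)"
  proof (rule tendsto_le[OF F])
    show "((\<lambda>i. \<integral>w. f w * g w \<partial>\<mu> i) \<longlongrightarrow> (\<integral>w. f w * g w \<partial>Q)) F"
      by (intro conv continuous_map_real_mult cont bounds)
    show "((\<lambda>i. (\<integral>w. f w \<partial>\<mu> i) * (\<integral>w. g w \<partial>\<mu> i)) \<longlongrightarrow> (\<integral>w. f w \<partial>Q) * (\<integral>w. g w \<partial>Q)) F"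
      by (intro tendsto_mult conv cont bounds)
    show "eventually (\<lambda>i. (\<integral>w. f w \<partial>\<mu> i) * (\<integral>w. g w \<partial>\<mu> i) \<le> (\<integral>w. f w * g w \<partial>\<mu> i)) F"
      using assoc by eventually_elim (use f g in \<open>auto simp: test_associated_def\<close>)
  qed
qed

lemma positively_associatedI_test:
  assumes T: "T > 0" and M: "prob_space M" and B: "B \<in> M \<rightarrow>\<^sub>M path_space T"
    and test: "test_associated T (distr M (path_space T) B)"
  shows "positively_associated M (path_space T) (path_le T) B"
  unfolding positively_associated_def
proof (intro allI impI)
  fix f g
  assume inc: "increasing_on_space (path_space T) (path_le T) f" "increasing_on_space (path_space T) (path_le T) g"
    and sq: "square_integrable (distr M (path_space T) B) f" "square_integrable (distr M (path_space T) B) g"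
  have meas: "f \<in> borel_measurable (path_space T)" "g \<in> borel_measurable (path_space T)"
    using sq by (simp_all add: square_integrable_def)
  have "prob_space (distr M (path_space T) B)" by (rule prob_space.prob_space_distr[OF M B])
  from increasing_square_integrable_correlated[OF T this _ test sq(1) inc(1) sq(2) inc(2)]
  have "(\<integral>w. f w \<partial>distr M (path_space T) B) * (\<integral>w. g w \<partial>distr M (path_space T) B)
      \<le> (\<integral>w. f w * g w \<partial>distr M (path_space T) B)" by simp
  then show "(\<integral>\<omega>. f (B \<omega>) * g (B \<omega>) \<partial>M) \<ge> (\<integral>\<omega>. f (B \<omega>) \<partial>M) * (\<integral>\<omega>. g (B \<omega>) \<partial>M)"
    using meas by (simp add: integral_distr[OF B])
qed

lemma cadlag_on_const: "cadlag_on T (\<lambda>_. c)"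
  by (auto simp: cadlag_on_def)

lemma stays_above_eq_stays_between: "stays_above T c = stays_between T (\<lambda>_. ereal c) (\<lambda>_. \<infinity>)"
  by (simp add: stays_above_def stays_between_def)

lemma prob_space_brownian_bridge_law:
  assumes "T > 0" "wiener_measure T W"
  shows "prob_space (brownian_bridge_law T W x)" "sets (brownian_bridge_law T W x) = sets (path_space T)"
proof -
  have "sets W = sets (path_space T)" "prob_space W" using assms(2) by (simp_all add: wiener_measure_def)
  then show "prob_space (brownian_bridge_law T W x)"
    unfolding brownian_bridge_law_def
    using measurable_bridge_path[OF assms(1)] measurable_cong_sets prob_space.prob_space_distr by blast
  show "sets (brownian_bridge_law T W x) = sets (path_space T)" by (simp add: brownian_bridge_law_def)
qed

text \<open>The unconditioned law is the case of the bounds \<open>- \<infinity>\<close> and \<open>\<infinity>\<close>.\<close>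

lemma test_associated_whole_path_space:
  assumes T: "T > 0" and P: "prob_space P" and sets_P: "sets P = sets (path_space T)"
    and ff: "grid_four_functions T P"
  shows "test_associated T P"
  unfolding test_associated_def
proof (intro allI impI)
  fix f g assume f: "increasing_test T f" and g: "increasing_test T g"
  interpret prob_space P by fact
  have space_P: "space P = space (path_space T)" using sets_P by (rule sets_eq_imp_space_eq)
  have K: "stays_between T (\<lambda>_. - \<infinity>) (\<lambda>_. \<infinity>) = space P"
    by (simp add: stays_between_def space_P)
  have drop: "(\<integral>w. h w * indicator (space P) w \<partial>P) = (\<integral>w. h w \<partial>P)" for h :: "(real \<Rightarrow> real) \<Rightarrow> real"
    by (rule Bochner_Integration.integral_cong) auto
  show "(\<integral>w. f w \<partial>P) * (\<integral>w. g w \<partial>P) \<le> (\<integral>w. f w * g w \<partial>P)"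
    using stays_between_increasing_correlated[OF T P sets_P ff cadlag_on_const cadlag_on_const f g, of "- \<infinity>" "\<infinity>"]
    unfolding K drop by (simp add: prob_space)
qed

theorem corollary1p9:
  fixes T :: real and W :: "(real \<Rightarrow> real) measure"
    and M :: "'a measure" and B :: "'a \<Rightarrow> real \<Rightarrow> real"
  assumes "T > 0" and "wiener_measure T W"
    and "prob_space M" and "B \<in> M \<rightarrow>\<^sub>M path_space T"
  shows
    "(\<forall>x. distr M (path_space T) B = brownian_bridge_law T W x
        \<longrightarrow> positively_associated M (path_space T) (path_le T) B)
     \<and> (brownian_excursion_law T W (distr M (path_space T) B)
        \<longrightarrow> positively_associated M (path_space T) (path_le T) B)
     \<and> (brownian_meander_law T W (distr M (path_space T) B)
        \<longrightarrow> positively_associated M (path_space T) (path_le T) B)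
     \<and> (\<forall>a b. cadlag_on T a \<longrightarrow> cadlag_on T b
        \<longrightarrow> measure W (stays_between T a b) > 0
        \<longrightarrow> distr M (path_space T) B = uniform_measure W (stays_between T a b)
        \<longrightarrow> positively_associated M (path_space T) (path_le T) B)"
proof -
  note T = \<open>T > 0\<close> and W = \<open>wiener_measure T W\<close>
  note associatedI = positively_associatedI_test[OF T \<open>prob_space M\<close> \<open>B \<in> _\<close>]
  have wiener: "prob_space W" "sets W = sets (path_space T)"
    using W by (simp_all add: wiener_measure_def)
  note bridge = prob_space_brownian_bridge_law[OF T W]
  note conditioned_wiener = test_associated_uniform_measure[OF T wiener grid_four_functions_wiener[OF T W]]
  note conditioned_bridge = test_associated_uniform_measure[OF T bridge grid_four_functions_bridge[OF T W]]
  show ?thesis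
  proof (intro conjI allI impI)
    fix x assume law: "distr M (path_space T) B = brownian_bridge_law T W x"
    show "positively_associated M (path_space T) (path_le T) B"
      by (rule associatedI, unfold law)
         (rule test_associated_whole_path_space[OF T bridge grid_four_functions_bridge[OF T W]])
  next
    assume "brownian_excursion_law T W (distr M (path_space T) B)"
    then show "positively_associated M (path_space T) (path_le T) B"
      unfolding brownian_excursion_law_def stays_above_eq_stays_between
      by (rule associatedI[OF test_associated_weak_limit])
         (auto intro!: always_eventually conditioned_bridge cadlag_on_const)
  next
    assume "brownian_meander_law T W (distr M (path_space T) B)"
    then show "positively_associated M (path_space T) (path_le T) B"
      unfolding brownian_meander_law_def stays_above_eq_stays_between
      by (rule associatedI[OF test_associated_weak_limit])
         (auto intro!: always_eventually conditioned_wiener cadlag_on_const)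
  next
    fix a b assume "cadlag_on T a" "cadlag_on T b"
      and law: "distr M (path_space T) B = uniform_measure W (stays_between T a b)"
    then show "positively_associated M (path_space T) (path_le T) B"
      by (intro associatedI) (simp add: conditioned_wiener)
  qed
qed

end
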